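(* (i) Let $(\rho)\neq\{0\}$ be a principal ideal that is not am-stable. Then there are two principal ideals $(\eta^{(1)})$ and $(\eta^{(2)})$, with $(\eta^{(1)})$ possibly zero, such that $$(\eta^{(1)})\subsetneq(\rho)\subsetneq(\eta^{(2)}),\quad (\eta^{(1)})^{oo}=(\rho)^o,\quad\text{and}\quad (\rho)^{oo}=(\eta^{(2)})^o.$$ (ii) Let $(\rho)\neq\{0\}$ be a principal ideal that is not am-$\infty$ stable. Then there are two principal ideals $(\eta^{(1)})$ and $(\eta^{(2)})$ such that $$(\eta^{(1)})\subsetneq(\rho)\subsetneq(\eta^{(2)}),\quad (\eta^{(1)})^{oo\infty}=(\rho)^{o\infty},\quad\text{and}\quad (\rho)^{oo\infty}=(\eta^{(2)})^{o\infty}.$$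
   Context: $H$ is a separable infinite-dimensional complex Hilbert space. "Ideal" means a two-sided ideal of $B(H)$ contained in the compact operators. $c_o^*$ is the set of nonnegative monotone nonincreasing sequences converging to $0$, and $(\ell^1)^*$ the set of summable sequences in $c_o^*$. $\Sigma(I):=\{s(X)\mid X\in I\}\subset c_o^*$, where $s(X)$ is the sequence of s-numbers (singular values) of $X$; $I\mapsto\Sigma(I)$ is an inclusion-preserving bijection between ideals and the hereditary (solid) subcones of $c_o^*$ invariant under the ampliations $D_m$, $(D_m\xi)_n:=\xi_{\lceil n/m\rceil}$, $m\in\mathbb N$. For $\xi\in c_o^*$, $(\xi)$ is the principal ideal generated by $\mathrm{diag}\,\xi$; every principal ideal has this form, and $\eta\in\Sigma((\xi))$ iff $\eta=O(D_m\xi)$ for some $m\in\mathbb N$. $\mathscr L_1$ is the trace class. $\omega=\langle 1/n\rangle$ and $se(\omega)$ is the ideal with $\Sigma(se(\omega))=\{\xi\in c_o^*\mid\xi=o(\omega)\}$. For $\xi\in c_o^*$ put $(\xi_a)_n:=\frac1n\sum_{j=1}^n\xi_j$. ${}_aI$ is the ideal with $\Sigma({}_aI)=\{\xi\in c_o^*\mid\xi_a\in\Sigma(I)\}$; $I_a$ is the ideal with $\Sigma(I_a)=\{\xi\in c_o^*\mid\xi=O(\eta_a)\text{ for some }\eta\in\Sigma(I)\}$; $I^o:=({}_aI)_a$ (am-interior). $I$ is am-open if $I=I^o$ and am-stable if $I={}_aI$ (equivalently $I=I_a$). $I^{oo}$ is the smallest am-open ideal containing $I$. For $\xi\in(\ell^1)^*$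 put $(\xi_{a_\infty})_n:=\frac1n\sum_{j=n+1}^\infty\xi_j$. ${}_{a_\infty}I$ is the ideal with $\Sigma({}_{a_\infty}I)=\{\xi\in(\ell^1)^*\mid\xi_{a_\infty}\in\Sigma(I)\}$; $I_{a_\infty}$ is the ideal with $\Sigma(I_{a_\infty})=\{\xi\in c_o^*\mid\xi=O(\eta_{a_\infty})\text{ for some }\eta\in\Sigma(I\cap\mathscr L_1)\}$; $I^{o\infty}:=({}_{a_\infty}I)_{a_\infty}$. $I$ is am-$\infty$ open if $I=I^{o\infty}$ and am-$\infty$ stable if $I={}_{a_\infty}I$ (equivalently $I\subset\mathscr L_1$ and $I=I_{a_\infty}$). $I^{oo\infty}$ is the smallest am-$\infty$ open ideal containing $I\cap se(\omega)$. *)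

theory Defs
  imports "HOL-Analysis.Analysis" "HOL-Algebra.Ideal" "HOL-Library.Landau_Symbols"
begin

section \<open>Complex Hilbert spaces\<close>

text \<open>
  A complex Hilbert space is presented over its underlying real Hilbert space, so that norm,
  topology and completeness are those of the library. The complex inner product is linear in the
  first argument; its real part is the real inner product, hence
  \<open>norm x = sqrt (Re (cinner x x))\<close>.
\<close>

class complex_hilbert = real_inner + complete_space +
  fixes scaleC :: "complex \<Rightarrow> 'a \<Rightarrow> 'a" (infixr "*\<^sub>C" 75)
    and cinner :: "'a \<Rightarrow> 'a \<Rightarrow> complex"
  assumes scaleC_add_right: "c *\<^sub>C (x + y) = c *\<^sub>C x + c *\<^sub>C y"
    and scaleC_add_left: "(c + d) *\<^sub>C x = c *\<^sub>C x + d *\<^sub>C x"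
    and scaleC_scaleC: "c *\<^sub>C d *\<^sub>C x = (c * d) *\<^sub>C x"
    and scaleR_scaleC: "r *\<^sub>R x = complex_of_real r *\<^sub>C x"
    and cinner_commute: "cinner x y = cnj (cinner y x)"
    and cinner_add_left: "cinner (x + y) z = cinner x z + cinner y z"
    and cinner_scaleC_left: "cinner (c *\<^sub>C x) y = c * cinner x y"
    and inner_eq_Re_cinner: "x \<bullet> y = Re (cinner x y)"

interpretation complex_vector: vector_space "scaleC :: complex \<Rightarrow> 'a \<Rightarrow> 'a::complex_hilbert"
proof
  show "1 *\<^sub>C x = x" for x :: 'a
    using scaleR_scaleC[of 1 x] by simp
qed (simp_all add: scaleC_add_right scaleC_add_left scaleC_scaleC)

text \<open>
  A Hilbert space has an orthonormal basis indexed by the natural numbers if and only if it is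
  separable and infinite-dimensional.
\<close>

definition orthonormal_basis :: "(nat \<Rightarrow> 'h::complex_hilbert) \<Rightarrow> bool" where
  "orthonormal_basis e \<longleftrightarrow>
     (\<forall>i j. cinner (e i) (e j) = (if i = j then 1 else 0)) \<and>
     closure (complex_vector.span (range e)) = UNIV"


section \<open>Operators and s-numbers\<close>

definition BH :: "('h::complex_hilbert \<Rightarrow>\<^sub>L 'h) ring" where
  "BH = \<lparr>carrier = {X. \<forall>c h. blinfun_apply X (c *\<^sub>C h) = c *\<^sub>C blinfun_apply X h},
         mult = (o\<^sub>L), one = id_blinfun, zero = 0, add = (+)\<rparr>"

lemma ring_BH: "ring (BH :: ('h::complex_hilbert \<Rightarrow>\<^sub>L 'h) ring)"
proof (rule ringI)
  show "abelian_group (BH :: ('h \<Rightarrow>\<^sub>L 'h) ring)"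
  proof (rule abelian_groupI)
    fix X :: "'h \<Rightarrow>\<^sub>L 'h" assume "X \<in> carrier BH"
    then have "- X \<in> carrier BH \<and> - X \<oplus>\<^bsub>BH\<^esub> X = \<zero>\<^bsub>BH\<^esub>"
      by (simp add: BH_def blinfun.minus_left complex_vector.scale_minus_right)
    then show "\<exists>Y\<in>carrier BH. Y \<oplus>\<^bsub>BH\<^esub> X = \<zero>\<^bsub>BH\<^esub>" by blast
  qed (auto simp: BH_def blinfun.add_left blinfun.zero_left scaleC_add_right)
  show "Group.monoid (BH :: ('h \<Rightarrow>\<^sub>L 'h) ring)"
    by (rule monoidI) (auto simp: BH_def intro!: blinfun_eqI)
qed (auto simp: BH_def blinfun.add_left blinfun.add_right intro!: blinfun_eqI)

definition compact_operators :: "('h::complex_hilbert \<Rightarrow>\<^sub>L 'h) set" where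
  "compact_operators = {X \<in> carrier BH. compact (closure (blinfun_apply X ` cball 0 1))}"

text \<open>
  The library's \<^const>\<open>adjoint\<close> refers to the real inner product; on complex-linear operators
  it is the Hilbert space adjoint.
\<close>

lemma adjoint_cinner:
  fixes X :: "'h::complex_hilbert \<Rightarrow>\<^sub>L 'h"
  assumes "X \<in> carrier BH" and "\<And>h k. cinner (blinfun_apply X h) k = cinner h (Y k)"
  shows "adjoint (blinfun_apply X) = Y"
  by (rule adjoint_unique) (simp add: inner_eq_Re_cinner assms(2))

text \<open>
  Sequences indexed from 1 in the literature are indexed from 0 here: \<open>\<xi> n\<close> stands for
  \<open>\<xi>\<^sub>n\<^sub>+\<^sub>1\<close>.
\<close>

definition c0_star :: "(nat \<Rightarrow> real) set" where
  "c0_star = {\<xi>. (\<forall>n. 0 \<le> \<xi> n) \<and> decseq \<xi> \<and> \<xi> \<longlonglongrightarrow> 0}"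

definition l1_star :: "(nat \<Rightarrow> real) set" where
  "l1_star = {\<xi> \<in> c0_star. summable \<xi>}"

text \<open>
  The s-numbers of a compact operator \<open>X\<close>: the square roots of the nonzero eigenvalues of
  \<open>X\<^sup>* X\<close> in nonincreasing order, each repeated according to its multiplicity, followed by zeros
  if \<open>X\<close> has finite rank.
\<close>

definition s_numbers :: "('h::complex_hilbert \<Rightarrow>\<^sub>L 'h) \<Rightarrow> nat \<Rightarrow> real" where
  "s_numbers X = (THE \<sigma>. \<sigma> \<in> c0_star \<and>
     (\<forall>t>0. card {n. \<sigma> n = t} =
        complex_vector.dim
          {h. adjoint (blinfun_apply X) (blinfun_apply X h) = complex_of_real (t\<^sup>2) *\<^sub>C h}))"

definition diag :: "(nat \<Rightarrow> 'h::complex_hilbert) \<Rightarrow> (nat \<Rightarrow> real) \<Rightarrow> 'h \<Rightarrow>\<^sub>L 'h" where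
  "diag e \<xi> = Blinfun (\<lambda>h. \<Sum>n. (complex_of_real (\<xi> n) * cinner h (e n)) *\<^sub>C e n)"


section \<open>Operator ideals\<close>

definition op_ideal :: "('h::complex_hilbert \<Rightarrow>\<^sub>L 'h) set \<Rightarrow> bool" where
  "op_ideal I \<longleftrightarrow> ideal I BH \<and> I \<subseteq> compact_operators"

definition char_set :: "('h::complex_hilbert \<Rightarrow>\<^sub>L 'h) set \<Rightarrow> (nat \<Rightarrow> real) set" where
  "char_set I = s_numbers ` I"

definition ideal_of_char_set :: "(nat \<Rightarrow> real) set \<Rightarrow> ('h::complex_hilbert \<Rightarrow>\<^sub>L 'h) set" where
  "ideal_of_char_set S = (THE I. op_ideal I \<and> char_set I = S)"

definition principal_ideal ::
    "(nat \<Rightarrow> 'h::complex_hilbert) \<Rightarrow> (nat \<Rightarrow> real) \<Rightarrow> ('h \<Rightarrow>\<^sub>L 'h) set" where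
  "principal_ideal e \<xi> = Idl\<^bsub>BH\<^esub> {diag e \<xi>}"

definition trace_class :: "('h::complex_hilbert \<Rightarrow>\<^sub>L 'h) set" where
  "trace_class = {X \<in> compact_operators. summable (s_numbers X)}"

definition se_omega :: "('h::complex_hilbert \<Rightarrow>\<^sub>L 'h) set" where
  "se_omega = ideal_of_char_set {\<xi> \<in> c0_star. \<xi> \<in> o(\<lambda>n. 1 / real (Suc n))}"

text \<open>
  For sequences in \<open>c\<^sub>o\<^sup>*\<close>, \<open>\<xi> = O(\<eta>)\<close> means \<open>\<xi>\<^sub>n \<le> M \<eta>\<^sub>n\<close> for all \<open>n\<close>. The bound must not be
  restricted to large \<open>n\<close>: every finitely supported \<open>\<xi>\<close> would then be \<open>O(0)\<close>.
\<close>

definition dominated :: "(nat \<Rightarrow> real) \<Rightarrow> (nat \<Rightarrow> real) \<Rightarrow> bool" where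
  "dominated \<xi> \<eta> \<longleftrightarrow> (\<exists>M. \<forall>n. \<xi> n \<le> M * \<eta> n)"


subsection \<open>Arithmetic means\<close>

definition am_seq :: "(nat \<Rightarrow> real) \<Rightarrow> nat \<Rightarrow> real" where
  "am_seq \<xi> n = (\<Sum>j\<le>n. \<xi> j) / real (Suc n)"

text \<open>The ideals \<open>\<^sub>aI\<close>, \<open>I\<^sub>a\<close>, \<open>I\<^sup>o = (\<^sub>aI)\<^sub>a\<close> and \<open>I\<^sup>o\<^sup>o\<close>.\<close>

definition pre_am :: "('h::complex_hilbert \<Rightarrow>\<^sub>L 'h) set \<Rightarrow> ('h \<Rightarrow>\<^sub>L 'h) set" where
  "pre_am I = ideal_of_char_set {\<xi> \<in> c0_star. am_seq \<xi> \<in> char_set I}"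

definition am :: "('h::complex_hilbert \<Rightarrow>\<^sub>L 'h) set \<Rightarrow> ('h \<Rightarrow>\<^sub>L 'h) set" where
  "am I = ideal_of_char_set {\<xi> \<in> c0_star. \<exists>\<eta>\<in>char_set I. dominated \<xi> (am_seq \<eta>)}"

definition am_interior :: "('h::complex_hilbert \<Rightarrow>\<^sub>L 'h) set \<Rightarrow> ('h \<Rightarrow>\<^sub>L 'h) set" where
  "am_interior I = am (pre_am I)"

definition am_open :: "('h::complex_hilbert \<Rightarrow>\<^sub>L 'h) set \<Rightarrow> bool" where
  "am_open I \<longleftrightarrow> op_ideal I \<and> I = am_interior I"

definition am_stable :: "('h::complex_hilbert \<Rightarrow>\<^sub>L 'h) set \<Rightarrow> bool" where
  "am_stable I \<longleftrightarrow> op_ideal I \<and> I = pre_am I"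

definition am_oo :: "('h::complex_hilbert \<Rightarrow>\<^sub>L 'h) set \<Rightarrow> ('h \<Rightarrow>\<^sub>L 'h) set" where
  "am_oo I = (LEAST J. am_open J \<and> I \<subseteq> J)"


subsection \<open>Arithmetic means at infinity\<close>

definition am_inf_seq :: "(nat \<Rightarrow> real) \<Rightarrow> nat \<Rightarrow> real" where
  "am_inf_seq \<xi> n = (\<Sum>j. \<xi> (j + Suc n)) / real (Suc n)"

text \<open>
  The counterparts at infinity. For \<open>I = {0}\<close> no ideal has the characteristic set prescribed
  for \<open>pre_am_inf I\<close>, because the sequences \<open>(\<xi>\<^sub>1, 0, 0, \<dots>)\<close> have zero tails;
  \<open>pre_am_inf {0}\<close> is therefore unspecified.
\<close>

definition pre_am_inf :: "('h::complex_hilbert \<Rightarrow>\<^sub>L 'h) set \<Rightarrow> ('h \<Rightarrow>\<^sub>L 'h) set" where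
  "pre_am_inf I = ideal_of_char_set {\<xi> \<in> l1_star. am_inf_seq \<xi> \<in> char_set I}"

definition am_inf :: "('h::complex_hilbert \<Rightarrow>\<^sub>L 'h) set \<Rightarrow> ('h \<Rightarrow>\<^sub>L 'h) set" where
  "am_inf I = ideal_of_char_set
     {\<xi> \<in> c0_star. \<exists>\<eta>\<in>char_set (I \<inter> trace_class). dominated \<xi> (am_inf_seq \<eta>)}"

definition am_inf_interior :: "('h::complex_hilbert \<Rightarrow>\<^sub>L 'h) set \<Rightarrow> ('h \<Rightarrow>\<^sub>L 'h) set" where
  "am_inf_interior I = am_inf (pre_am_inf I)"

definition am_inf_open :: "('h::complex_hilbert \<Rightarrow>\<^sub>L 'h) set \<Rightarrow> bool" where
  "am_inf_open I \<longleftrightarrow> op_ideal I \<and> I = am_inf_interior I"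

definition am_inf_stable :: "('h::complex_hilbert \<Rightarrow>\<^sub>L 'h) set \<Rightarrow> bool" where
  "am_inf_stable I \<longleftrightarrow> op_ideal I \<and> I = pre_am_inf I"

definition am_inf_oo :: "('h::complex_hilbert \<Rightarrow>\<^sub>L 'h) set \<Rightarrow> ('h \<Rightarrow>\<^sub>L 'h) set" where
  "am_inf_oo I = (LEAST J. am_inf_open J \<and> I \<inter> se_omega \<subseteq> J)"

end

theory Submission
  imports Defs
begin

text \<open>
  By the Calkin correspondence, which rests on the singular value decomposition of compact
  operators, the statement is one about characteristic sets of sequences. With
  \<open>\<phi> n = (n + 1) \<rho> n\<close> (indices from 0), a sequence is up to equivalence an arithmetic mean if and
  only if \<open>\<phi>\<close> increases, and, up to equivalence and ampliation, an arithmetic mean at infinity if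
  and only if \<open>\<phi>\<close> decreases to 0. Hence the interior of a principal ideal is given by the largest
  minorant of \<open>\<phi>\<close> that is monotone in this sense, and its open hull by the smallest such
  majorant. If \<open>(\<rho>)\<close> is not open, these envelopes are the required generators. If \<open>(\<rho>)\<close> is open
  but not stable, then \<open>\<phi>\<close> is almost constant on intervals \<open>[p, q]\<close> with \<open>q / p\<close> arbitrarily large,
  and replacing \<open>\<rho>\<close> there by its value at \<open>q\<close> or at \<open>p\<close> changes the principal ideal but not
  the envelopes. At infinity the interior is \<open>se(\<omega>)\<close>, which is not principal, as soon as the
  ideal contains \<open>\<omega>\<close>; the same holds for the open hull as soon as \<open>(n + 1) \<rho> n\<close> does not tend
  to 0.
\<close>

section \<open>Complex Hilbert spaces\<close>

text \<open>Membership in a principal ideal hides an ampliation. If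
  \<open>(n + 1) * \<kappa> n\<close> increases, ampliating \<kappa> costs only a constant factor,
  and envelopes can be compared termwise; if it decreases this fails, and the lower envelope at
  infinity is largest only up to an ampliation. A modified generator has to escape every constant
  and every ampliation at once, which is why the flat stretches must have unbounded relative length.
  They come from instability by contraposition: if \<phi> changes by a factor 2 whenever the index
  grows by a fixed factor, the sums of \<rho> are controlled by geometric series, the mean of \<rho>
  lies in the ideal, and the ideal is stable. At infinity, tails ignore the first term, and a finite
  rank correction available in every nonzero ideal restores it. Where the hull is
  \<open>se_set\<close>, no envelope is at hand; instead, a sequence outside \<open>se_set\<close>
  exceeds a multiple of \<open>omega\<close> along a subsequence, and quasiconvexity carries an
  estimate from that subsequence to all smaller indices.\<close>

instance complex_hilbert \<subseteq> banach ..

lemma cinner_add_right: "cinner x (y + z) = cinner x y + cinner x (z :: 'h::complex_hilbert)"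
  by (metis cinner_add_left cinner_commute complex_cnj_add)

lemma cinner_scaleC_right: "cinner x (c *\<^sub>C y) = cnj c * cinner x (y :: 'h::complex_hilbert)"
  by (metis cinner_scaleC_left cinner_commute complex_cnj_mult)

lemma cinner_zero_left [simp]: "cinner 0 (y :: 'h::complex_hilbert) = 0"
  using cinner_add_left[of 0 0 y] by simp

lemma cinner_zero_right [simp]: "cinner (y :: 'h::complex_hilbert) 0 = 0"
  using cinner_add_right[of y 0 0] by simp

lemma cinner_minus_left: "cinner (- x) (y :: 'h::complex_hilbert) = - cinner x y"
  using cinner_add_left[of x "- x" y] by (simp add: eq_neg_iff_add_eq_0 add.commute)

lemma cinner_minus_right: "cinner x (- y :: 'h::complex_hilbert) = - cinner x y"
  using cinner_add_right[of x y "- y"] by (simp add: eq_neg_iff_add_eq_0 add.commute)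

lemma cinner_diff_left: "cinner (x - z) (y :: 'h::complex_hilbert) = cinner x y - cinner z y"
  using cinner_add_left[of x "- z" y] by (simp add: cinner_minus_left)

lemma cinner_diff_right: "cinner x (y - z :: 'h::complex_hilbert) = cinner x y - cinner x z"
  using cinner_add_right[of x y "- z"] by (simp add: cinner_minus_right)

lemma cinner_sum_left: "cinner (\<Sum>i\<in>A. f i) (y :: 'h::complex_hilbert) = (\<Sum>i\<in>A. cinner (f i) y)"
  by (induction A rule: infinite_finite_induct) (simp_all add: cinner_add_left)

lemma cinner_sum_right: "cinner (y :: 'h::complex_hilbert) (\<Sum>i\<in>A. f i) = (\<Sum>i\<in>A. cinner y (f i))"
  by (induction A rule: infinite_finite_induct) (simp_all add: cinner_add_right)

lemma cinner_self: "cinner x x = complex_of_real ((norm (x :: 'h::complex_hilbert))\<^sup>2)"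
proof -
  have "Im (cinner x x) = 0"
    using cinner_commute[of x x] by (metis cnj.simps(2) neg_equal_zero)
  moreover have "Re (cinner x x) = (norm x)\<^sup>2"
    by (simp add: inner_eq_Re_cinner[symmetric] power2_norm_eq_inner)
  ultimately show ?thesis by (simp add: complex_eq_iff)
qed

lemma cinner_eq_0_commute: "cinner x y = 0 \<longleftrightarrow> cinner y (x :: 'h::complex_hilbert) = 0"
  by (metis cinner_commute complex_cnj_zero_iff)

lemma norm_scaleC: "norm (c *\<^sub>C x) = cmod c * norm (x :: 'h::complex_hilbert)"
proof -
  have "complex_of_real ((norm (c *\<^sub>C x))\<^sup>2) = complex_of_real ((cmod c)\<^sup>2 * (norm x)\<^sup>2)"
    by (simp only: cinner_self[symmetric] cinner_scaleC_left cinner_scaleC_right of_real_mult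
        mult.assoc[symmetric] complex_norm_square) (simp add: mult.commute)
  then have "(norm (c *\<^sub>C x))\<^sup>2 = (cmod c * norm x)\<^sup>2"
    by (simp only: of_real_eq_iff power_mult_distrib)
  then show ?thesis by (simp add: power2_eq_iff_nonneg)
qed

text \<open>The phase \<open>c\<close> turns the inner product into its modulus, a real number, so
  the Cauchy-Schwarz inequality of the real inner product applies to \<open>c *\<^sub>C x\<close>
  and \<open>y\<close>.\<close>

lemma cmod_cinner_le: "cmod (cinner x y) \<le> norm x * norm (y :: 'h::complex_hilbert)"
proof -
  define c where "c = cnj (sgn (cinner x y))"
  have "cinner (c *\<^sub>C x) y = complex_of_real (cmod (cinner x y))" if "cinner x y \<noteq> 0"
    using that by (simp add: c_def cinner_scaleC_left sgn_div_norm scaleR_conv_of_real mult.assoc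
        mult.commute[of "cnj _"] complex_norm_square[symmetric] power2_eq_square left_inverse)
  then have "cmod (cinner x y) = (c *\<^sub>C x) \<bullet> y"
    by (cases "cinner x y = 0") (simp_all add: inner_eq_Re_cinner cinner_scaleC_left c_def)
  also have "\<dots> \<le> norm (c *\<^sub>C x) * norm y" by (rule norm_cauchy_schwarz)
  also have "\<dots> \<le> norm x * norm y"
    by (intro mult_right_mono) (auto simp: norm_scaleC c_def norm_sgn mult_left_le_one_le)
  finally show ?thesis .
qed

lemma bounded_linear_cinner_left: "bounded_linear (\<lambda>x. cinner x (y :: 'h::complex_hilbert))"
proof (rule bounded_linear_intro)
  show "cinner (r *\<^sub>R x) y = r *\<^sub>R cinner x y" for r x
    by (simp add: scaleR_scaleC cinner_scaleC_left scaleR_conv_of_real)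
  show "norm (cinner x y) \<le> norm x * norm y" for x
    by (rule cmod_cinner_le)
qed (simp add: cinner_add_left)

lemma bounded_linear_scaleC_left: "bounded_linear (\<lambda>c. c *\<^sub>C (x :: 'h::complex_hilbert))"
  by (rule bounded_linear_intro[where K = "norm x"])
    (simp_all add: scaleC_add_left scaleR_scaleC scaleC_scaleC norm_scaleC scaleR_conv_of_real)

lemma bounded_linear_scaleC_right: "bounded_linear (\<lambda>x. c *\<^sub>C (x :: 'h::complex_hilbert))"
  by (rule bounded_linear_intro[where K = "cmod c"])
    (simp_all add: scaleC_add_right scaleR_scaleC scaleC_scaleC norm_scaleC mult.commute)

section \<open>Orthogonal systems\<close>

text \<open>
  Vectors of norm less than 1 are allowed so that the left singular vectors belonging to the
  singular value 0 can be taken to be 0.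
\<close>

definition orthosys :: "(nat \<Rightarrow> 'h::complex_hilbert) \<Rightarrow> bool" where
  "orthosys a \<longleftrightarrow> (\<forall>m n. m \<noteq> n \<longrightarrow> cinner (a m) (a n) = 0) \<and> (\<forall>n. norm (a n) \<le> 1)"

lemma orthosys_sum_norm:
  assumes "orthosys a" "finite F"
  shows "(norm (\<Sum>n\<in>F. c n *\<^sub>C a n))\<^sup>2 = (\<Sum>n\<in>F. (cmod (c n))\<^sup>2 * (norm (a n))\<^sup>2)"
proof -
  have "complex_of_real ((norm (\<Sum>n\<in>F. c n *\<^sub>C a n))\<^sup>2) =
      (\<Sum>n\<in>F. \<Sum>m\<in>F. c n * cnj (c m) * cinner (a n) (a m))"
    unfolding cinner_self[symmetric] cinner_sum_left
    by (simp add: cinner_sum_right cinner_scaleC_left cinner_scaleC_right sum_distrib_left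
        mult.assoc mult.left_commute)
  also have "\<dots> = (\<Sum>n\<in>F. \<Sum>m\<in>F. if m = n then c n * cnj (c n) * cinner (a n) (a n) else 0)"
    using assms(1) by (intro sum.cong) (auto simp: orthosys_def)
  also have "\<dots> = (\<Sum>n\<in>F. complex_of_real ((cmod (c n))\<^sup>2 * (norm (a n))\<^sup>2))"
    using assms(2) by (intro sum.cong) (auto simp: cinner_self complex_norm_square simp del: of_real_power)
  finally show ?thesis by (simp only: of_real_sum[symmetric] of_real_eq_iff)
qed

lemma orthosys_sum_norm_le:
  assumes "orthosys a" "finite F"
  shows "(norm (\<Sum>n\<in>F. c n *\<^sub>C a n))\<^sup>2 \<le> (\<Sum>n\<in>F. (cmod (c n))\<^sup>2)"
  unfolding orthosys_sum_norm[OF assms]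
proof (rule sum_mono)
  fix n assume "n \<in> F"
  have "(norm (a n))\<^sup>2 \<le> 1" using assms(1) by (simp add: orthosys_def power_le_one)
  then show "(cmod (c n))\<^sup>2 * (norm (a n))\<^sup>2 \<le> (cmod (c n))\<^sup>2"
    by (simp add: mult_left_le)
qed

text \<open>Expansion of \<open>norm (h - g)\<close> squared, where \<open>g\<close> is the
  candidate for the projection of \<open>h\<close>. Since the vectors may be shorter than 1, the
  square of \<open>norm g\<close> is only at most \<open>S\<close>, not equal to it; this direction
  suffices.\<close>

lemma Bessel_inequality:
  assumes "orthosys a" "finite F"
  shows "(\<Sum>n\<in>F. (cmod (cinner h (a n)))\<^sup>2) \<le> (norm h)\<^sup>2"
proof -
  define g where "g = (\<Sum>n\<in>F. cinner h (a n) *\<^sub>C a n)"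
  define S where "S = (\<Sum>n\<in>F. (cmod (cinner h (a n)))\<^sup>2)"
  have "cinner h g = (\<Sum>n\<in>F. complex_of_real ((cmod (cinner h (a n)))\<^sup>2))"
    by (simp only: g_def cinner_sum_right cinner_scaleC_right complex_norm_square mult.commute)
  then have hg: "cinner h g = complex_of_real S" by (simp add: S_def)
  then have gh: "cinner g h = complex_of_real S"
    by (metis cinner_commute complex_cnj_complex_of_real)
  have "complex_of_real ((norm (h - g))\<^sup>2) = complex_of_real ((norm h)\<^sup>2 - 2 * S + (norm g)\<^sup>2)"
    unfolding cinner_self[symmetric] cinner_diff_left cinner_diff_right hg gh
    by (simp add: cinner_self)
  then have "(norm (h - g))\<^sup>2 = (norm h)\<^sup>2 - 2 * S + (norm g)\<^sup>2"
    by (simp only: of_real_eq_iff)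
  moreover have "(norm g)\<^sup>2 \<le> S"
    unfolding g_def S_def by (rule orthosys_sum_norm_le[OF assms])
  ultimately show ?thesis unfolding S_def by (smt (verit) zero_le_power2)
qed

lemma orthosys_summable:
  assumes a: "orthosys a" and c: "summable (\<lambda>n. (cmod (c n))\<^sup>2)"
  shows "summable (\<lambda>n. c n *\<^sub>C a n)"
  unfolding summable_Cauchy
proof (intro allI impI)
  fix \<epsilon> :: real assume \<epsilon>: "0 < \<epsilon>"
  obtain N where N: "\<And>m n. m \<ge> N \<Longrightarrow> norm (sum (\<lambda>n. (cmod (c n))\<^sup>2) {m..<n}) < \<epsilon>\<^sup>2"
    using c \<epsilon> unfolding summable_Cauchy by (meson zero_less_power)
  show "\<exists>N. \<forall>m\<ge>N. \<forall>n. norm (\<Sum>k = m..<n. c k *\<^sub>C a k) < \<epsilon>"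
  proof (intro exI allI impI)
    fix m n assume "N \<le> m"
    have "(norm (\<Sum>k = m..<n. c k *\<^sub>C a k))\<^sup>2 < \<epsilon>\<^sup>2"
      using orthosys_sum_norm_le[OF a, of "{m..<n}" c] N[OF \<open>N \<le> m\<close>, of n] by auto
    then show "norm (\<Sum>k = m..<n. c k *\<^sub>C a k) < \<epsilon>"
      using \<epsilon> by (simp add: power_less_imp_less_base)
  qed
qed

text \<open>Diagonal operators, partial isometries between orthonormal systems and Schmidt
  expansions of compact operators all have this form, so that adjoints and products reduce to
  computations with coefficients. \<open>Blinfun\<close> returns the intended operator only for
  bounded linear maps; the locale \<open>schmidt\<close> collects conditions that guarantee
  this.\<close>

definition schmidt_op ::
    "(nat \<Rightarrow> complex) \<Rightarrow> (nat \<Rightarrow> 'h::complex_hilbert) \<Rightarrow> (nat \<Rightarrow> 'h) \<Rightarrow> 'h \<Rightarrow>\<^sub>L 'h" where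
  "schmidt_op c a b = Blinfun (\<lambda>h. \<Sum>n. (c n * cinner h (a n)) *\<^sub>C b n)"

locale schmidt =
  fixes c :: "nat \<Rightarrow> complex" and a b :: "nat \<Rightarrow> 'h::complex_hilbert"
  assumes bdd: "bounded (range c)" and a: "orthosys a" and b: "orthosys b"
begin

lemma bounded_coeff: obtains M where "M \<ge> 0" "\<And>n. cmod (c n) \<le> M"
  using bdd by (metis bounded_iff norm_ge_zero order_trans rangeI)

lemma coeff_sum_le:
  assumes M: "\<And>n. n \<in> F \<Longrightarrow> cmod (c n) \<le> M" and "finite F"
  shows "(\<Sum>n\<in>F. (cmod (c n * cinner h (a n)))\<^sup>2) \<le> (M * norm h)\<^sup>2"
proof -
  have "(\<Sum>n\<in>F. (cmod (c n * cinner h (a n)))\<^sup>2) \<le> (\<Sum>n\<in>F. M\<^sup>2 * (cmod (cinner h (a n)))\<^sup>2)"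
    by (intro sum_mono) (auto simp: norm_mult power_mult_distrib intro!: mult_right_mono power_mono M)
  also have "\<dots> \<le> M\<^sup>2 * (norm h)\<^sup>2"
    unfolding sum_distrib_left[symmetric]
    by (intro mult_left_mono Bessel_inequality[OF a \<open>finite F\<close>]) auto
  finally show ?thesis by (simp add: power_mult_distrib)
qed

lemma summable: "summable (\<lambda>n. (c n * cinner h (a n)) *\<^sub>C b n)"
proof (rule orthosys_summable[OF b])
  obtain M where M: "M \<ge> 0" "\<And>n. cmod (c n) \<le> M" using bounded_coeff by blast
  show "summable (\<lambda>n. (cmod (c n * cinner h (a n)))\<^sup>2)"
    by (rule summableI_nonneg_bounded[where x = "(M * norm h)\<^sup>2"]) (auto intro!: coeff_sum_le M)
qed

lemma norm_suminf_le:
  assumes M: "\<And>n. cmod (c n) \<le> M"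
  shows "norm (\<Sum>n. (c n * cinner h (a n)) *\<^sub>C b n) \<le> M * norm h"
proof (rule LIMSEQ_le_const2)
  show "(\<lambda>N. norm (\<Sum>n<N. (c n * cinner h (a n)) *\<^sub>C b n)) \<longlonglongrightarrow>
      norm (\<Sum>n. (c n * cinner h (a n)) *\<^sub>C b n)"
    by (intro tendsto_norm summable_LIMSEQ summable)
  have "M \<ge> 0" using M[of 0] norm_ge_zero order_trans by blast
  have "norm (\<Sum>n<N. (c n * cinner h (a n)) *\<^sub>C b n) \<le> M * norm h" for N
  proof (rule power2_le_imp_le)
    show "(norm (\<Sum>n<N. (c n * cinner h (a n)) *\<^sub>C b n))\<^sup>2 \<le> (M * norm h)\<^sup>2"
      using orthosys_sum_norm_le[OF b, of "{..<N}"] coeff_sum_le[of "{..<N}" M h] M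
      by (meson finite_lessThan order_trans)
  qed (use \<open>M \<ge> 0\<close> in auto)
  then show "\<exists>N. \<forall>n\<ge>N. norm (\<Sum>n<n. (c n * cinner h (a n)) *\<^sub>C b n) \<le> M * norm h" by blast
qed

lemma bounded_linear: "bounded_linear (\<lambda>h. \<Sum>n. (c n * cinner h (a n)) *\<^sub>C b n)"
proof -
  obtain M where M: "M \<ge> 0" "\<And>n. cmod (c n) \<le> M" using bounded_coeff by blast
  show ?thesis
  proof (rule bounded_linear_intro)
    show "(\<Sum>n. (c n * cinner (x + y) (a n)) *\<^sub>C b n) =
        (\<Sum>n. (c n * cinner x (a n)) *\<^sub>C b n) + (\<Sum>n. (c n * cinner y (a n)) *\<^sub>C b n)" for x y
      by (simp add: suminf_add[OF summable summable] cinner_add_left scaleC_add_left ring_distribs)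
    show "(\<Sum>n. (c n * cinner (r *\<^sub>R x) (a n)) *\<^sub>C b n) =
        r *\<^sub>R (\<Sum>n. (c n * cinner x (a n)) *\<^sub>C b n)" for r x
      using bounded_linear.suminf[OF bounded_linear_scaleR_right summable, of r x]
      by (simp add: scaleR_scaleC scaleC_scaleC cinner_scaleC_left mult_ac)
    show "norm (\<Sum>n. (c n * cinner x (a n)) *\<^sub>C b n) \<le> norm x * M" for x
      using norm_suminf_le[OF M(2)] by (simp add: mult.commute)
  qed
qed

lemma apply_eq: "blinfun_apply (schmidt_op c a b) h = (\<Sum>n. (c n * cinner h (a n)) *\<^sub>C b n)"
  unfolding schmidt_op_def using bounded_linear by (simp add: bounded_linear_Blinfun_apply)

lemma norm_apply_le: "(\<And>n. cmod (c n) \<le> M) \<Longrightarrow> norm (blinfun_apply (schmidt_op c a b) h) \<le> M * norm h"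
  unfolding apply_eq by (rule norm_suminf_le)

lemma cinner_apply:
  "cinner (blinfun_apply (schmidt_op c a b) h) k = (\<Sum>n. c n * cinner h (a n) * cinner (b n) k)"
  unfolding apply_eq bounded_linear.suminf[OF bounded_linear_cinner_left summable]
  by (simp add: cinner_scaleC_left)

lemma cinner_apply_summable: "Series.summable (\<lambda>n. c n * cinner h (a n) * cinner (b n) k)"
  using bounded_linear.summable[OF bounded_linear_cinner_left[where y = k] summable, of h]
  by (simp add: cinner_scaleC_left)

lemma cinner_apply_system:
  "cinner (blinfun_apply (schmidt_op c a b) h) (b m) = c m * cinner h (a m) * cinner (b m) (b m)"
proof -
  have "(\<Sum>n. c n * cinner h (a n) * cinner (b n) (b m)) =
      (\<Sum>n\<in>{m}. c n * cinner h (a n) * cinner (b n) (b m))"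
    using b by (intro suminf_finite) (auto simp: orthosys_def)
  then show ?thesis by (simp add: cinner_apply)
qed

lemma apply_system: "blinfun_apply (schmidt_op c a b) (a m) = (c m * cinner (a m) (a m)) *\<^sub>C b m"
proof -
  have "(\<Sum>n. (c n * cinner (a m) (a n)) *\<^sub>C b n) = (\<Sum>n\<in>{m}. (c n * cinner (a m) (a n)) *\<^sub>C b n)"
    using a by (intro suminf_finite) (auto simp: orthosys_def)
  then show ?thesis by (simp add: apply_eq)
qed

lemma in_BH: "schmidt_op c a b \<in> carrier BH"
proof -
  have "blinfun_apply (schmidt_op c a b) (z *\<^sub>C h) = z *\<^sub>C blinfun_apply (schmidt_op c a b) h" for z h
    unfolding apply_eq bounded_linear.suminf[OF bounded_linear_scaleC_right summable]
    by (simp add: scaleC_scaleC cinner_scaleC_left mult_ac)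
  then show ?thesis by (simp add: BH_def)
qed

lemma adjoint_swap:
  "cinner (blinfun_apply (schmidt_op c a b) h) k =
     cinner h (blinfun_apply (schmidt_op (\<lambda>n. cnj (c n)) b a) k)"
proof -
  interpret s: schmidt "\<lambda>n. cnj (c n)" b a
  proof
    show "bounded (range (\<lambda>n. cnj (c n)))" using bdd by (auto simp: bounded_iff)
  qed (rule a b)+
  have "cinner h (blinfun_apply (schmidt_op (\<lambda>n. cnj (c n)) b a) k) =
      cnj (\<Sum>n. cnj (c n) * cinner k (b n) * cinner (a n) h)"
    by (subst cinner_commute) (simp add: s.cinner_apply)
  also have "\<dots> = (\<Sum>n. cnj (cnj (c n) * cinner k (b n) * cinner (a n) h))"
    by (rule bounded_linear.suminf[OF bounded_linear_cnj s.cinner_apply_summable])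
  also have "\<dots> = (\<Sum>n. c n * cinner h (a n) * cinner (b n) k)"
    by (intro suminf_cong) (metis (no_types, lifting) cinner_commute complex_cnj_cnj complex_cnj_mult mult.assoc mult.commute)
  finally show ?thesis by (simp add: cinner_apply)
qed

lemma adjoint_eq:
  "adjoint (blinfun_apply (schmidt_op c a b)) = blinfun_apply (schmidt_op (\<lambda>n. cnj (c n)) b a)"
  by (rule adjoint_cinner[OF in_BH adjoint_swap])

end

text \<open>Each \<open>q m\<close> meets at most the vector \<open>a m\<close>, so the double
  series collapses to its diagonal. In the applications the factor \<open>cinner (q n) (a n)\<close>
  is 1 for equal systems, 0 for orthogonal ones, or the squared norm of a left singular
  vector.\<close>

lemma schmidt_compose:
  assumes "schmidt c a b" "schmidt d p q" "\<And>m n. m \<noteq> n \<Longrightarrow> cinner (q m) (a n) = 0"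
  shows "schmidt_op c a b o\<^sub>L schmidt_op d p q = schmidt_op (\<lambda>n. c n * d n * cinner (q n) (a n)) p b"
proof (rule blinfun_eqI)
  fix h
  interpret s: schmidt c a b by fact
  interpret t: schmidt d p q by fact
  have "cinner (blinfun_apply (schmidt_op d p q) h) (a n) = d n * cinner h (p n) * cinner (q n) (a n)" for n
  proof -
    have "(\<Sum>m. d m * cinner h (p m) * cinner (q m) (a n)) =
        (\<Sum>m\<in>{n}. d m * cinner h (p m) * cinner (q m) (a n))"
      using assms(3) by (intro suminf_finite) auto
    then show ?thesis by (simp add: t.cinner_apply)
  qed
  then have "blinfun_apply (schmidt_op c a b o\<^sub>L schmidt_op d p q) h =
      (\<Sum>n. (c n * (d n * cinner h (p n) * cinner (q n) (a n))) *\<^sub>C b n)"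
    by (simp add: s.apply_eq)
  moreover have "schmidt (\<lambda>n. c n * d n * cinner (q n) (a n)) p b"
  proof
    obtain M where M: "M \<ge> 0" "\<And>n. cmod (c n) \<le> M" using s.bounded_coeff by blast
    obtain N where N: "N \<ge> 0" "\<And>n. cmod (d n) \<le> N" using t.bounded_coeff by blast
    have "cmod (c n * d n * cinner (q n) (a n)) \<le> M * N * 1" for n
    proof -
      have "norm (q n) * norm (a n) \<le> 1 * 1"
        using s.a t.b by (intro mult_mono) (auto simp: orthosys_def)
      then have "cmod (cinner (q n) (a n)) \<le> 1"
        using cmod_cinner_le[of "q n" "a n"] by simp
      then show ?thesis
        unfolding norm_mult using M N by (intro mult_mono) auto
    qed
    then show "bounded (range (\<lambda>n. c n * d n * cinner (q n) (a n)))"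
      unfolding bounded_iff by blast
  qed (rule s.b t.a)+
  ultimately show "blinfun_apply (schmidt_op c a b o\<^sub>L schmidt_op d p q) h =
      blinfun_apply (schmidt_op (\<lambda>n. c n * d n * cinner (q n) (a n)) p b) h"
    by (simp add: schmidt.apply_eq mult_ac)
qed

section \<open>Singular value decomposition of compact operators\<close>

text \<open>A homogeneous linear system with more unknowns than equations, solved by Gaussian
  elimination: induction on the equations, with a pivot unknown \<open>p\<close> removed in each
  step.\<close>

lemma nontrivial_solution:
  fixes M :: "'i \<Rightarrow> 'k \<Rightarrow> 'f::field"
  assumes "finite K" "finite I" "card K < card I"
  shows "\<exists>c. (\<exists>i\<in>I. c i \<noteq> 0) \<and> (\<forall>k\<in>K. (\<Sum>i\<in>I. c i * M i k) = 0)"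
  using assms
proof (induction K arbitrary: I M rule: finite_induct)
  case empty
  then obtain i where "i \<in> I" by (metis card.empty ex_in_conv less_irrefl)
  then show ?case by (intro exI[of _ "\<lambda>_. 1"]) auto
next
  case (insert k K)
  show ?case
  proof (cases "\<forall>i\<in>I. M i k = 0")
    case True
    obtain c where "\<exists>i\<in>I. c i \<noteq> 0" "\<forall>k\<in>K. (\<Sum>i\<in>I. c i * M i k) = 0"
      using insert.IH[of I M] insert.prems insert.hyps by auto
    then show ?thesis using True by (intro exI[of _ c]) auto
  next
    case False
    then obtain p where p: "p \<in> I" "M p k \<noteq> 0" by blast
    \<comment> \<open>Subtracting a multiple of the row of the pivot makes \<open>N i k\<close>
      vanish for all \<open>i\<close>, so that equation \<open>k\<close> is settled by the choice of
      \<open>d p\<close> below.\<close>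
    define N where "N i l = M i l - M i k / M p k * M p l" for i l
    obtain c where c: "\<exists>i\<in>I - {p}. c i \<noteq> 0" "\<forall>l\<in>K. (\<Sum>i\<in>I - {p}. c i * N i l) = 0"
      using insert.IH[of "I - {p}" N] insert.prems insert.hyps p(1) by (auto simp: less_diff_conv)
    define d where "d i = (if i = p then - (\<Sum>i\<in>I - {p}. c i * (M i k / M p k)) else c i)" for i
    have sum_d: "(\<Sum>i\<in>I. d i * M i l) = (\<Sum>i\<in>I - {p}. c i * N i l)" for l
    proof -
      have "(\<Sum>i\<in>I. d i * M i l) = d p * M p l + (\<Sum>i\<in>I - {p}. d i * M i l)"
        using insert.prems(1) p(1) by (simp add: sum.remove)
      also have "(\<Sum>i\<in>I - {p}. d i * M i l) = (\<Sum>i\<in>I - {p}. c i * M i l)"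
        by (intro sum.cong) (auto simp: d_def)
      also have "d p * M p l = - (\<Sum>i\<in>I - {p}. c i * (M i k / M p k * M p l))"
        by (simp add: d_def sum_distrib_right mult.assoc)
      finally show ?thesis
        by (simp add: N_def right_diff_distrib sum_subtractf)
    qed
    have "(\<Sum>i\<in>I. d i * M i l) = 0" if "l \<in> insert k K" for l
    proof (cases "l = k")
      case True
      have "N i k = 0" for i using p(2) by (simp add: N_def)
      with True show ?thesis by (simp add: sum_d)
    qed (use that c(2) sum_d in auto)
    moreover have "\<exists>i\<in>I. d i \<noteq> 0" using c(1) by (auto simp: d_def)
    ultimately show ?thesis by blast
  qed
qed

definition orthonormal_sys :: "(nat \<Rightarrow> 'h::complex_hilbert) \<Rightarrow> bool" where
  "orthonormal_sys a \<longleftrightarrow> (\<forall>i j. cinner (a i) (a j) = (if i = j then 1 else 0))"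

lemma orthonormal_sys_norm: "orthonormal_sys a \<Longrightarrow> norm (a i) = 1"
proof -
  assume "orthonormal_sys a"
  then have "cinner (a i) (a i) = 1" by (simp add: orthonormal_sys_def)
  then have "complex_of_real ((norm (a i))\<^sup>2) = complex_of_real 1"
    by (simp only: cinner_self of_real_1)
  then have "(norm (a i))\<^sup>2 = 1" by (simp only: of_real_eq_iff)
  then show ?thesis using power2_eq_iff_nonneg[of "norm (a i)" 1] by simp
qed

lemma orthonormal_sys_orthosys:
  assumes "orthonormal_sys a"
  shows "orthosys a"
  unfolding orthosys_def
  using assms orthonormal_sys_norm[OF assms] by (simp add: orthonormal_sys_def)

lemma norm_orthonormal_sum:
  assumes "orthonormal_sys a" "finite F"
  shows "(norm (\<Sum>n\<in>F. c n *\<^sub>C a n))\<^sup>2 = (\<Sum>n\<in>F. (cmod (c n))\<^sup>2)"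
  using orthosys_sum_norm[OF orthonormal_sys_orthosys[OF assms(1)] assms(2)]
  by (simp add: orthonormal_sys_norm[OF assms(1)])

lemma normalized_combination:
  assumes e: "orthonormal_sys e" and d: "\<exists>i\<in>{..n}. d i \<noteq> 0"
  obtains c where "norm (\<Sum>i\<le>n. c i *\<^sub>C e i) = 1"
    "\<And>g. (\<Sum>i\<le>n. d i * g i) = 0 \<Longrightarrow> (\<Sum>i\<le>n. c i * g i) = 0"
proof -
  define R where "R = norm (\<Sum>i\<le>n. d i *\<^sub>C e i)"
  have "R\<^sup>2 > 0" unfolding R_def norm_orthonormal_sum[OF e finite_atMost]
    using d by (auto intro!: sum_pos2)
  then have "R \<noteq> 0" by auto
  define c where "c i = d i / complex_of_real R" for i
  have "(\<Sum>i\<le>n. c i *\<^sub>C e i) = (1 / complex_of_real R) *\<^sub>C (\<Sum>i\<le>n. d i *\<^sub>C e i)"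
    by (simp add: c_def complex_vector.scale_sum_right scaleC_scaleC)
  then have "norm (\<Sum>i\<le>n. c i *\<^sub>C e i) = 1"
    using \<open>R \<noteq> 0\<close> by (simp add: norm_scaleC norm_divide R_def)
  moreover have "(\<Sum>i\<le>n. c i * g i) = 0" if "(\<Sum>i\<le>n. d i * g i) = 0" for g
    using that by (simp add: c_def sum_divide_distrib[symmetric])
  ultimately show ?thesis using that by blast
qed

text \<open>\<open>n\<close> linear conditions cannot exhaust a space of dimension
  \<open>n + 1\<close>. This dimension count keeps the choice of singular vectors going and later
  yields the min-max bound for diagonal operators that factor through each other.\<close>

lemma unit_vector_annihilated:
  assumes e: "orthonormal_sys e"
  obtains c where "norm (\<Sum>i\<le>n. c i *\<^sub>C e i) = 1" "\<And>k. k < n \<Longrightarrow> (\<Sum>i\<le>n. c i * M i k) = 0"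
proof -
  obtain d where d: "\<exists>i\<in>{..n}. d i \<noteq> 0" "\<forall>k\<in>{..<n}. (\<Sum>i\<in>{..n}. d i * M i k) = 0"
    using nontrivial_solution[of "{..<n}" "{..n}" M] by auto
  obtain c where "norm (\<Sum>i\<le>n. c i *\<^sub>C e i) = 1"
    "\<And>g. (\<Sum>i\<le>n. d i * g i) = 0 \<Longrightarrow> (\<Sum>i\<le>n. c i * g i) = 0"
    by (rule normalized_combination[OF e d(1)]) blast
  with d(2) show ?thesis by (intro that[of c]) auto
qed

lemma BH_scaleC: "X \<in> carrier BH \<Longrightarrow> blinfun_apply X (c *\<^sub>C h) = c *\<^sub>C blinfun_apply X h"
  by (simp add: BH_def)

lemma BH_sum_scaleC:
  "X \<in> carrier BH \<Longrightarrow> blinfun_apply X (\<Sum>i\<in>A. c i *\<^sub>C h i) = (\<Sum>i\<in>A. c i *\<^sub>C blinfun_apply X (h i))"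
  by (simp add: blinfun.sum_right BH_scaleC)

text \<open>\<open>C\<close> plays the role of a closed real subspace, and \<open>x\<^sub>0\<close>
  shows that it contains a unit vector. Compactness makes the images of a maximizing sequence
  converge along a subsequence; that the vectors themselves converge comes from the geometry of the
  unit ball.\<close>

lemma compact_operator_maximizer:
  fixes X :: "'h::complex_hilbert \<Rightarrow>\<^sub>L 'h"
  assumes X: "X \<in> compact_operators" and "closed C"
    and "\<And>x y. x \<in> C \<Longrightarrow> y \<in> C \<Longrightarrow> x + y \<in> C" and scale: "\<And>r x. x \<in> C \<Longrightarrow> r *\<^sub>R x \<in> C"
    and "x\<^sub>0 \<in> C" "norm x\<^sub>0 = 1"
  obtains v where "v \<in> C" "norm v = 1"
    "\<And>w. w \<in> C \<Longrightarrow> norm (blinfun_apply X w) \<le> norm (blinfun_apply X v) * norm w"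
proof -
  define f where "f = blinfun_apply X"
  define U where "U = (\<lambda>w. norm (f w)) ` {w \<in> C. norm w \<le> 1}"
  define K where "K = Sup U"
  have bdd: "bdd_above U"
    unfolding U_def f_def bdd_above_def
    by (auto intro!: exI[of _ "norm X"]
        intro: order_trans[OF norm_blinfun mult_left_le])
  have ne: "U \<noteq> {}" using assms(5,6) by (auto simp: U_def)
  have f_scale: "f (r *\<^sub>R x) = r *\<^sub>R f x" and f_add: "f (x + y) = f x + f y" for r x y
    by (simp_all add: f_def blinfun.scaleR_right blinfun.add_right)
  have le_K: "norm (f w) \<le> K * norm w" if "w \<in> C" for w
  proof (cases "w = 0")
    case False
    have "inverse (norm w) *\<^sub>R w \<in> {w \<in> C. norm w \<le> 1}" using that scale False by simp
    then have "norm (f (inverse (norm w) *\<^sub>R w)) \<in> U"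
      unfolding U_def by (rule imageI)
    then have "norm (f (inverse (norm w) *\<^sub>R w)) \<le> K"
      unfolding K_def by (rule cSup_upper) (rule bdd)
    then show ?thesis using False by (simp add: f_scale field_simps)
  qed (use f_scale[of 0 0] in auto)
  have "0 \<le> K" using order_trans[OF norm_ge_zero le_K[OF assms(5)]] assms(6) by simp
  have "\<exists>v\<in>C. norm v = 1 \<and> norm (f v) = K"
  proof (cases "K = 0")
    case True
    then show ?thesis using le_K[OF assms(5)] assms(5,6) by auto
  next
    case False
    then have "0 < K" using \<open>0 \<le> K\<close> by simp
    have "\<exists>h. h \<in> C \<and> norm h \<le> 1 \<and> K - 1 / real (Suc n) < norm (f h)" for n
      using less_cSupD[OF ne, of "K - 1 / real (Suc n)"] unfolding K_def[symmetric]
      by (auto simp: U_def)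
    then obtain h where h: "\<And>n. h n \<in> C" "\<And>n. norm (h n) \<le> 1"
      "\<And>n. K - 1 / real (Suc n) < norm (f (h n))" by metis
    have "compact (closure (f ` cball 0 1))"
      using X by (simp add: compact_operators_def f_def)
    moreover have "\<forall>n. f (h n) \<in> closure (f ` cball 0 1)"
      using h(2) by (intro allI subsetD[OF closure_subset] imageI) simp
    ultimately obtain y r where r: "strict_mono r" and lim: "((\<lambda>n. f (h n)) \<circ> r) \<longlonglongrightarrow> y"
      by (rule seq_compactE[OF compact_imp_seq_compact])
    have "norm y = K"
    proof (rule antisym)
      show "norm y \<le> K"
      proof (rule LIMSEQ_le_const2[OF tendsto_norm[OF lim]], intro exI allI impI)
        fix n show "norm (((\<lambda>n. f (h n)) \<circ> r) n) \<le> K"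
          using le_K[OF h(1)[of "r n"]] h(2)[of "r n"] \<open>0 \<le> K\<close>
          by (simp add: mult_left_le order_trans)
      qed
      have "(\<lambda>n. K - 1 / real (Suc (r n))) \<longlonglongrightarrow> K - 0"
        using LIMSEQ_subseq_LIMSEQ[OF lim_1_over_n[THEN LIMSEQ_Suc] r] 
        by (intro tendsto_intros) (simp add: o_def)
      moreover have "\<exists>N. \<forall>n\<ge>N. K - 1 / real (Suc (r n)) \<le> norm (((\<lambda>n. f (h n)) \<circ> r) n)"
        using h(3) by (auto intro!: less_imp_le)
      ultimately show "K \<le> norm y" using LIMSEQ_le[OF _ tendsto_norm[OF lim]] by simp
    qed
    txt \<open>Almost maximal vectors of the unit ball are close together by the parallelogram law.\<close>
    have "Cauchy (h \<circ> r)"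
    proof (rule metric_CauchyI)
      fix \<epsilon> :: real assume \<epsilon>: "0 < \<epsilon>"
      \<comment> \<open>The bound \<open>K\<close> keeps \<open>2 - 2 * (\<delta> / K)\<close>
        nonnegative, so that it may be squared; the bound with 16 gives
        \<open>8 * (\<delta> / K) \<le> \<epsilon>\<^sup>2 / 2\<close>, which leaves room for a
        strict inequality.\<close>
      define \<delta> where "\<delta> = min K (K * \<epsilon>\<^sup>2 / 16)"
      have "0 < \<delta>" using \<open>0 < K\<close> \<epsilon> by (simp add: \<delta>_def)
      then obtain N where N: "\<And>n. n \<ge> N \<Longrightarrow> norm (f (h (r n)) - y) < \<delta>"
        using LIMSEQ_D[OF lim] by (auto simp: o_def)
      show "\<exists>N. \<forall>m\<ge>N. \<forall>n\<ge>N. dist ((h \<circ> r) m) ((h \<circ> r) n) < \<epsilon>"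
      proof (intro exI allI impI)
        fix m n assume mn: "N \<le> m" "N \<le> n"
        define p q where "p = h (r m)" and "q = h (r n)"
        have "norm (2 *\<^sub>R y) \<le> norm (f (p + q)) + norm ((f p - y) + (f q - y))"
          unfolding f_add using norm_triangle_ineq4[of "f p + f q" "(f p - y) + (f q - y)"]
          by (simp add: algebra_simps scaleR_2)
        also have "norm ((f p - y) + (f q - y)) \<le> 2 * \<delta>"
          using norm_triangle_ineq[of "f p - y" "f q - y"] N[OF mn(1)] N[OF mn(2)]
          by (simp add: p_def q_def)
        finally have "2 * K - 2 * \<delta> \<le> K * norm (p + q)"
          using le_K[of "p + q"] assms(3) h(1) \<open>norm y = K\<close> by (simp add: p_def q_def)
        then have "2 - 2 * (\<delta> / K) \<le> norm (p + q)" using \<open>0 < K\<close> by (simp add: field_simps)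
        moreover have "0 \<le> 2 - 2 * (\<delta> / K)" using \<open>0 < K\<close> by (simp add: \<delta>_def field_simps)
        ultimately have "(2 - 2 * (\<delta> / K))\<^sup>2 \<le> (norm (p + q))\<^sup>2" by (intro power_mono)
        moreover have "(2 - 2 * (\<delta> / K))\<^sup>2 = 4 - 8 * (\<delta> / K) + 4 * (\<delta> / K)\<^sup>2"
          by (simp add: power2_eq_square algebra_simps)
        ultimately have 1: "4 - 8 * (\<delta> / K) \<le> (norm (p + q))\<^sup>2"
          using zero_le_power2[of "\<delta> / K"] by linarith
        have "(norm p)\<^sup>2 \<le> 1" "(norm q)\<^sup>2 \<le> 1"
          using h(2) by (simp_all add: p_def q_def power_le_one)
        moreover have "(norm (p - q))\<^sup>2 = 2 * (norm p)\<^sup>2 + 2 * (norm q)\<^sup>2 - (norm (p + q))\<^sup>2"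
          by (simp add: power2_norm_eq_inner inner_diff_left inner_diff_right inner_add_left
              inner_add_right inner_commute)
        moreover have "8 * (\<delta> / K) < \<epsilon>\<^sup>2"
        proof -
          have "\<delta> / K \<le> \<epsilon>\<^sup>2 / 16" using \<open>0 < K\<close> by (simp add: \<delta>_def min_def field_simps)
          then show ?thesis using zero_less_power[OF \<epsilon>, of 2] by linarith
        qed
        ultimately have "(norm (p - q))\<^sup>2 < \<epsilon>\<^sup>2" using 1 by linarith
        then show "dist ((h \<circ> r) m) ((h \<circ> r) n) < \<epsilon>"
          using \<epsilon> by (simp add: dist_norm p_def q_def power_less_imp_less_base)
      qed
    qed
    then obtain v where v: "(h \<circ> r) \<longlonglongrightarrow> v"
      using Cauchy_convergent convergent_def by blast
    have "v \<in> C" using closed_sequentially[OF \<open>closed C\<close> _ v] h(1) by simp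
    moreover have "(\<lambda>n. f ((h \<circ> r) n)) \<longlonglongrightarrow> f v"
      unfolding f_def by (intro blinfun.tendsto tendsto_const v)
    then have "f v = y" using lim LIMSEQ_unique by (auto simp: o_def)
    moreover have "norm v \<le> 1"
      by (rule LIMSEQ_le_const2[OF tendsto_norm[OF v]]) (use h(2) in auto)
    moreover have "1 \<le> norm v"
      using le_K[OF \<open>v \<in> C\<close>] \<open>f v = y\<close> \<open>norm y = K\<close> \<open>0 < K\<close> by simp
    ultimately show ?thesis using \<open>norm y = K\<close> by auto
  qed
  then show ?thesis using that le_K unfolding f_def by metis
qed

text \<open>First variation at a maximum: along \<open>v + c *\<^sub>C w\<close> the squared norm of
  the image has a term linear in \<open>c\<close>, whereas the squared norm of the vector changes
  only quadratically, because \<open>w\<close> is orthogonal to \<open>v\<close>. Hence the linear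
  coefficient \<open>z\<close> vanishes.\<close>

lemma maximizer_image_orthogonal:
  fixes X :: "'h::complex_hilbert \<Rightarrow>\<^sub>L 'h"
  assumes X: "X \<in> carrier BH" and v: "norm v = 1" and w: "cinner w v = 0"
    and max: "\<And>c. norm (blinfun_apply X (v + c *\<^sub>C w)) \<le> norm (blinfun_apply X v) * norm (v + c *\<^sub>C w)"
  shows "cinner (blinfun_apply X w) (blinfun_apply X v) = 0"
proof (rule ccontr)
  define z where "z = cinner (blinfun_apply X w) (blinfun_apply X v)"
  define s where "s = norm (blinfun_apply X v)"
  assume "\<not> ?thesis"
  then have z: "0 < (cmod z)\<^sup>2" by (simp add: z_def)
  have quad: "2 * t * (cmod z)\<^sup>2 \<le> s\<^sup>2 * (t\<^sup>2 * (cmod z)\<^sup>2 * (norm w)\<^sup>2)" if "t > 0" for t :: real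
  proof -
    \<comment> \<open>The factor \<open>cnj z\<close> aligns the phase: \<open>c * z\<close> becomes
      \<open>t\<close> times the squared modulus of \<open>z\<close>.\<close>
    define c where "c = complex_of_real t * cnj z"
    have c: "(cmod c)\<^sup>2 = t\<^sup>2 * (cmod z)\<^sup>2" by (simp add: c_def norm_mult power_mult_distrib)
    have norm_add: "(norm (x + y))\<^sup>2 = (norm x)\<^sup>2 + 2 * Re (cinner y x) + (norm y)\<^sup>2" for x y :: 'h
      by (simp add: power2_norm_eq_inner inner_eq_Re_cinner[symmetric] inner_add_left
          inner_add_right inner_commute[of x y])
    have "(norm (blinfun_apply X (v + c *\<^sub>C w)))\<^sup>2 = s\<^sup>2 + 2 * Re (c * z) + (cmod c)\<^sup>2 * (norm (blinfun_apply X w))\<^sup>2"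
      by (simp add: blinfun.add_right BH_scaleC[OF X] norm_add s_def z_def cinner_scaleC_left
          norm_scaleC power_mult_distrib)
    moreover have "c * z = complex_of_real (t * (cmod z)\<^sup>2)"
      by (simp add: c_def mult.assoc mult.commute[of "cnj z"] complex_norm_square del: of_real_power)
    then have "Re (c * z) = t * (cmod z)\<^sup>2" by simp
    moreover have "(norm (blinfun_apply X (v + c *\<^sub>C w)))\<^sup>2 \<le> s\<^sup>2 * (1 + (cmod c)\<^sup>2 * (norm w)\<^sup>2)"
    proof -
      have "(norm (blinfun_apply X (v + c *\<^sub>C w)))\<^sup>2 \<le> (s * norm (v + c *\<^sub>C w))\<^sup>2"
        unfolding s_def by (intro power_mono max) auto
      moreover have "(norm (v + c *\<^sub>C w))\<^sup>2 = 1 + (cmod c)\<^sup>2 * (norm w)\<^sup>2"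
        by (simp add: norm_add v cinner_scaleC_left w norm_scaleC power_mult_distrib)
      ultimately show ?thesis by (simp only: power_mult_distrib)
    qed
    moreover have "0 \<le> (cmod c)\<^sup>2 * (norm (blinfun_apply X w))\<^sup>2" by simp
    ultimately have "2 * (t * (cmod z)\<^sup>2) \<le> s\<^sup>2 * (1 + (cmod c)\<^sup>2 * (norm w)\<^sup>2) - s\<^sup>2"
      by linarith
    then show ?thesis unfolding c by (simp add: distrib_left mult.assoc)
  qed
  \<comment> \<open>With \<open>t = 1 / B\<close> the quadratic bound is at most half of the linear
    term that it has to dominate, which is impossible for nonzero \<open>z\<close>. The added 1
    makes \<open>B\<close> positive.\<close>
  define B where "B = s\<^sup>2 * (norm w)\<^sup>2 + 1"
  have "B > 0" by (simp add: B_def add_nonneg_pos)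
  have "2 * (1 / B) * (cmod z)\<^sup>2 \<le> (1 / B) * (cmod z)\<^sup>2 * ((1 / B) * (s\<^sup>2 * (norm w)\<^sup>2))"
    using quad[of "1 / B"] \<open>B > 0\<close> by (simp add: power2_eq_square mult_ac)
  also have "\<dots> \<le> (1 / B) * (cmod z)\<^sup>2 * 1"
    using \<open>B > 0\<close> by (intro mult_left_mono) (simp_all add: B_def)
  finally show False using \<open>B > 0\<close> z by (simp add: field_simps)
qed

text \<open>Greedy choice: \<open>v n\<close> maximizes the norm of the image among the unit vectors
  orthogonal to all earlier \<open>v m\<close>. The infinite system \<open>e\<close> guarantees that
  this orthogonal complement contains a unit vector at every stage.\<close>

lemma singular_vectors_exist:
  fixes X :: "'h::complex_hilbert \<Rightarrow>\<^sub>L 'h"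
  assumes X: "X \<in> compact_operators" and e: "orthonormal_sys (e :: nat \<Rightarrow> 'h)"
  obtains v where "orthonormal_sys v"
    "\<And>n w. (\<And>m. m < n \<Longrightarrow> cinner w (v m) = 0) \<Longrightarrow>
       norm (blinfun_apply X w) \<le> norm (blinfun_apply X (v n)) * norm w"
proof -
  define P where "P f n x \<longleftrightarrow> norm x = 1 \<and> (\<forall>m<n. cinner x (f m) = 0) \<and>
     (\<forall>w. (\<forall>m<n. cinner w (f m) = 0) \<longrightarrow>
        norm (blinfun_apply X w) \<le> norm (blinfun_apply X x) * norm w)" for f :: "nat \<Rightarrow> 'h" and n x
  \<comment> \<open>\<open>P f n\<close> looks at \<open>f\<close> only below \<open>n\<close>, so
    choice along the well-founded order of the naturals applies.\<close>
  have "\<exists>v. \<forall>n. P v n (v n)"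
  proof (rule dependent_wf_choice[OF wf_less])
    show "P f n x = P g n x" if "\<And>z. (z, n) \<in> {(x, y). x < y} \<Longrightarrow> f z = g z" for f g n x
      unfolding P_def using that by auto
    show "\<exists>x. P f n x" for n f
    proof -
      define C where "C = {w. \<forall>m<n. cinner w (f m) = 0}"
      have "closed ((\<lambda>w. cinner w (f m)) -` {0})" for m
        by (intro closed_vimage closed_singleton linear_continuous_on bounded_linear_cinner_left)
      moreover have "C = (\<Inter>m\<in>{..<n}. (\<lambda>w. cinner w (f m)) -` {0})" by (auto simp: C_def)
      ultimately have "closed C" by (metis closed_INT)
      obtain c where c: "norm (\<Sum>i\<le>n. c i *\<^sub>C e i) = 1"
        "\<And>k. k < n \<Longrightarrow> (\<Sum>i\<le>n. c i * cinner (e i) (f k)) = 0"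
        using unit_vector_annihilated[OF e, of n "\<lambda>i k. cinner (e i) (f k)"] by blast
      have "(\<Sum>i\<le>n. c i *\<^sub>C e i) \<in> C"
        using c(2) by (simp add: C_def cinner_sum_left cinner_scaleC_left)
      then obtain v where "v \<in> C" "norm v = 1"
        "\<And>w. w \<in> C \<Longrightarrow> norm (blinfun_apply X w) \<le> norm (blinfun_apply X v) * norm w"
        using compact_operator_maximizer[OF X \<open>closed C\<close> _ _ _ c(1)]
        by (auto simp: C_def cinner_add_left scaleR_scaleC cinner_scaleC_left)
      then show ?thesis by (auto simp: P_def C_def)
    qed
  qed
  then obtain v where v: "\<And>n. P v n (v n)" by blast
  have "cinner (v i) (v j) = (if i = j then 1 else 0)" for i j
  proof (cases i j rule: linorder_cases)
    case equal
    then show ?thesis using v[of i] by (simp add: P_def cinner_self)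
  next
    case less
    then have "cinner (v j) (v i) = 0" using v[of j] by (simp add: P_def)
    then show ?thesis using less by (simp add: cinner_eq_0_commute)
  next
    case greater
    then show ?thesis using v[of i] by (simp add: P_def)
  qed
  then have "orthonormal_sys v" by (simp add: orthonormal_sys_def)
  then show ?thesis using that v unfolding P_def by meson
qed

abbreviation real_schmidt ::
    "(nat \<Rightarrow> real) \<Rightarrow> (nat \<Rightarrow> 'h::complex_hilbert) \<Rightarrow> (nat \<Rightarrow> 'h) \<Rightarrow> 'h \<Rightarrow>\<^sub>L 'h" where
  "real_schmidt s a b \<equiv> schmidt_op (\<lambda>n. complex_of_real (s n)) a b"

text \<open>\<open>s n\<close> is the norm of the image of the greedily chosen \<open>v n\<close>,
  and \<open>u n\<close> is the direction of that image. The images of different \<open>v n\<close>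
  are orthogonal by the first variation, and compactness forces their norms to 0.\<close>

theorem singular_value_decomposition:
  fixes X :: "'h::complex_hilbert \<Rightarrow>\<^sub>L 'h"
  assumes X: "X \<in> compact_operators" and e: "orthonormal_sys (e :: nat \<Rightarrow> 'h)"
  obtains s v u where "s \<in> c0_star" "orthonormal_sys v" "orthosys u"
    "\<And>n. s n \<noteq> 0 \<Longrightarrow> cinner (u n) (u n) = 1" "X = real_schmidt s v u"
proof -
  obtain v where v: "orthonormal_sys v" and max: "\<And>n w. (\<And>m. m < n \<Longrightarrow> cinner w (v m) = 0) \<Longrightarrow>
       norm (blinfun_apply X w) \<le> norm (blinfun_apply X (v n)) * norm w"
    using singular_vectors_exist[OF X e] by metis
  have BH: "X \<in> carrier BH" and comp: "compact (closure (blinfun_apply X ` cball 0 1))"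
    using X by (auto simp: compact_operators_def)
  define s where "s n = norm (blinfun_apply X (v n))" for n
  \<comment> \<open>For \<open>s n = 0\<close> division by zero gives \<open>u n = 0\<close>; this
    is why \<open>u\<close> is only an \<open>orthosys\<close>, with unit vectors where
    \<open>s n \<noteq> 0\<close>.\<close>
  define u where "u n = complex_of_real (1 / s n) *\<^sub>C blinfun_apply X (v n)" for n
  have su: "complex_of_real (s n) *\<^sub>C u n = blinfun_apply X (v n)" for n
    by (cases "s n = 0") (auto simp: u_def scaleC_scaleC scaleR_scaleC[symmetric] s_def)
  have vv: "cinner (v i) (v j) = (if i = j then 1 else 0)" for i j
    using v by (simp add: orthonormal_sys_def)
  have orth_less: "cinner (blinfun_apply X (v n)) (blinfun_apply X (v m)) = 0" if "m < n" for m n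
  proof (rule maximizer_image_orthogonal[OF BH orthonormal_sys_norm[OF v]])
    show "cinner (v n) (v m) = 0" using that by (simp add: vv)
    show "norm (blinfun_apply X (v m + c *\<^sub>C v n)) \<le> norm (blinfun_apply X (v m)) * norm (v m + c *\<^sub>C v n)" for c
      by (rule max) (use that in \<open>simp add: vv cinner_add_left cinner_scaleC_left\<close>)
  qed
  have orth: "cinner (blinfun_apply X (v n)) (blinfun_apply X (v m)) = 0" if "m \<noteq> n" for m n
    using that orth_less by (metis cinner_eq_0_commute linorder_neqE_nat)
  have dec: "decseq s"
    unfolding decseq_Suc_iff
  proof
    fix n show "s (Suc n) \<le> s n"
      using max[of n "v (Suc n)"] by (simp add: vv orthonormal_sys_norm[OF v] s_def)
  qed
  have "s \<longlonglongrightarrow> 0"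
  proof -
    obtain L where L: "s \<longlonglongrightarrow> L" "\<And>n. L \<le> s n"
      using decseq_convergent[OF dec, of 0] by (auto simp: s_def)
    have "0 \<le> L" using L(1) by (rule LIMSEQ_le_const) (simp add: s_def)
    \<comment> \<open>Otherwise the images of the \<open>v n\<close> would be pairwise orthogonal
      vectors of norm at least \<open>L\<close>, hence at mutual distance at least \<open>L\<close>,
      and could not have a convergent subsequence.\<close>
    have "L \<le> 0"
    proof (rule ccontr)
      assume "\<not> L \<le> 0"
      then have "0 < L" by simp
      have "\<forall>n. blinfun_apply X (v n) \<in> closure (blinfun_apply X ` cball 0 1)"
        by (intro allI subsetD[OF closure_subset] imageI) (simp add: orthonormal_sys_norm[OF v])
      then obtain y r where r: "strict_mono r" and lim: "((\<lambda>n. blinfun_apply X (v n)) \<circ> r) \<longlonglongrightarrow> y"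
        by (rule seq_compactE[OF compact_imp_seq_compact[OF comp]])
      then obtain N where N: "\<And>m n. m \<ge> N \<Longrightarrow> n \<ge> N \<Longrightarrow>
          norm (blinfun_apply X (v (r m)) - blinfun_apply X (v (r n))) < L"
        using CauchyD[OF LIMSEQ_imp_Cauchy[OF lim] \<open>0 < L\<close>] by (auto simp: o_def)
      define x y where "x = blinfun_apply X (v (r N))" and "y = blinfun_apply X (v (r (Suc N)))"
      have "r N \<noteq> r (Suc N)" using r by (metis lessI less_not_refl strict_mono_less)
      then have "x \<bullet> y = 0" using orth by (simp add: x_def y_def inner_eq_Re_cinner)
      then have "(norm (x - y))\<^sup>2 = (norm x)\<^sup>2 + (norm y)\<^sup>2"
        by (simp add: power2_norm_eq_inner inner_diff_left inner_diff_right inner_commute)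
      moreover have "L\<^sup>2 \<le> (norm x)\<^sup>2"
        using L(2)[of "r N"] \<open>0 < L\<close> by (simp add: x_def s_def power_mono)
      ultimately have "L\<^sup>2 \<le> (norm (x - y))\<^sup>2" using zero_le_power2[of "norm y"] by linarith
      then have "L \<le> norm (x - y)" by (rule power2_le_imp_le) simp
      then show False using N[of N "Suc N"] by (simp add: x_def y_def)
    qed
    with \<open>0 \<le> L\<close> L(1) show ?thesis by simp
  qed
  with dec have s: "s \<in> c0_star" by (simp add: c0_star_def s_def)
  have unit_u: "cinner (u n) (u n) = 1" if "s n \<noteq> 0" for n
    using that by (simp add: u_def cinner_self norm_scaleC norm_divide s_def)
  have u: "orthosys u"
    unfolding orthosys_def
  proof (intro conjI allI impI)
    show "cinner (u m) (u n) = 0" if "m \<noteq> n" for m n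
      using orth[of n m] that by (simp add: u_def cinner_scaleC_left cinner_scaleC_right)
    show "norm (u n) \<le> 1" for n
      by (cases "s n = 0") (simp_all add: u_def norm_scaleC norm_divide, simp add: s_def)
  qed
  interpret schmidt "\<lambda>n. complex_of_real (s n)" v u
  proof
    have "\<bar>s n\<bar> \<le> s 0" for n using decseqD[OF dec, of 0 n] by (simp add: s_def)
    then show "bounded (range (\<lambda>n. complex_of_real (s n)))" by (auto simp: bounded_iff)
  qed (rule orthonormal_sys_orthosys[OF v] u)+
  have "X = real_schmidt s v u"
  proof (rule blinfun_eqI)
    fix h
    \<comment> \<open>Completeness of \<open>v\<close> is not at hand. Instead, the remainder is
      orthogonal to the first \<open>N\<close> vectors, so by maximality its image has norm at most
      \<open>s N * norm (r N)\<close>, which tends to 0.\<close>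
    define r where "r N = h - (\<Sum>n<N. cinner h (v n) *\<^sub>C v n)" for N
    have "norm (blinfun_apply X (r N)) \<le> s N * (2 * norm h)" for N
    proof -
      have "cinner (r N) (v m) = 0" if "m < N" for m
        using that by (simp add: r_def cinner_diff_left cinner_sum_left cinner_scaleC_left vv mult_delta_right)
      then have le: "norm (blinfun_apply X (r N)) \<le> s N * norm (r N)" unfolding s_def by (rule max)
      have "(norm (\<Sum>n<N. cinner h (v n) *\<^sub>C v n))\<^sup>2 \<le> (norm h)\<^sup>2"
        using orthosys_sum_norm_le[OF a finite_lessThan] Bessel_inequality[OF a finite_lessThan]
        by (rule order_trans)
      then have "norm (\<Sum>n<N. cinner h (v n) *\<^sub>C v n) \<le> norm h"
        by (rule power2_le_imp_le) simp
      then have "norm (r N) \<le> 2 * norm h"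
        unfolding r_def using norm_triangle_ineq4[of h "\<Sum>n<N. cinner h (v n) *\<^sub>C v n"] by simp
      then have "s N * norm (r N) \<le> s N * (2 * norm h)"
        by (rule mult_left_mono) (simp add: s_def)
      with le show ?thesis by (rule order_trans)
    qed
    moreover have "(\<lambda>N. s N * (2 * norm h)) \<longlonglongrightarrow> 0"
      using \<open>s \<longlonglongrightarrow> 0\<close> by (rule tendsto_mult_left_zero)
    ultimately have "(\<lambda>N. blinfun_apply X (r N)) \<longlonglongrightarrow> 0"
      by (rule Lim_null_comparison[OF always_eventually[OF allI]])
    then have "(\<lambda>N. blinfun_apply X h - blinfun_apply X (r N)) \<longlonglongrightarrow> blinfun_apply X h - 0"
      by (intro tendsto_intros)
    moreover have "blinfun_apply X h - blinfun_apply X (r N) =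
        (\<Sum>n<N. (complex_of_real (s n) * cinner h (v n)) *\<^sub>C u n)" for N
      by (simp add: r_def blinfun.diff_right BH_sum_scaleC[OF BH] su[symmetric] scaleC_scaleC mult.commute)
    ultimately have "(\<lambda>n. (complex_of_real (s n) * cinner h (v n)) *\<^sub>C u n) sums blinfun_apply X h"
      by (simp add: sums_def)
    then show "blinfun_apply X h = blinfun_apply (real_schmidt s v u) h"
      by (simp add: apply_eq sums_iff)
  qed
  with s v u unit_u show ?thesis using that by blast
qed

section \<open>Null sequences and the uniqueness of s-numbers\<close>

lemma c0_star_nonneg: "\<xi> \<in> c0_star \<Longrightarrow> 0 \<le> \<xi> n"
  and c0_star_decseq: "\<xi> \<in> c0_star \<Longrightarrow> decseq \<xi>"
  and c0_star_tendsto: "\<xi> \<in> c0_star \<Longrightarrow> \<xi> \<longlonglongrightarrow> 0"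
  by (auto simp: c0_star_def)

lemma c0_star_antimono: "\<xi> \<in> c0_star \<Longrightarrow> m \<le> n \<Longrightarrow> \<xi> n \<le> \<xi> m"
  by (auto simp: c0_star_def decseq_def)

lemma c0_star_bounded:
  assumes "\<xi> \<in> c0_star"
  shows "bounded (range (\<lambda>n. complex_of_real (\<xi> n)))"
  using c0_star_nonneg[OF assms] c0_star_antimono[OF assms, of 0] by (auto simp: bounded_iff)

lemma c0_star_level_finite:
  assumes "\<xi> \<in> c0_star" "0 < t"
  shows "finite {n. \<xi> n = t}"
proof -
  have "\<forall>\<^sub>F n in sequentially. \<xi> n < t"
    using c0_star_tendsto[OF assms(1)] assms(2) by (rule order_tendstoD)
  then obtain N where "\<And>n. n \<ge> N \<Longrightarrow> \<xi> n < t" by (auto simp: eventually_sequentially)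
  then have "n < N" if "\<xi> n = t" for n using that by (metis less_irrefl not_le_imp_less)
  then have "{n. \<xi> n = t} \<subseteq> {..<N}" by blast
  then show ?thesis by (rule finite_subset) simp
qed

text \<open>At the first index where the sequences differ, the larger of the two values occurs more
  often in its own sequence than in the other. This gives the uniqueness behind the description of
  \<open>s_numbers\<close> by multiplicities.\<close>

lemma c0_star_eqI:
  assumes "\<sigma> \<in> c0_star" "\<tau> \<in> c0_star" and cnt: "\<And>t. t > 0 \<Longrightarrow> card {n. \<sigma> n = t} = card {n. \<tau> n = t}"
  shows "\<sigma> = \<tau>"
proof -
  have aux: False if "\<sigma> \<in> c0_star" "\<tau> \<in> c0_star" and cnt: "\<And>t. t > 0 \<Longrightarrow> card {n. \<sigma> n = t} = card {n. \<tau> n = t}"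
    and eq: "\<And>k. k < n \<Longrightarrow> \<sigma> k = \<tau> k" and less: "\<tau> n < \<sigma> n" for n \<sigma> \<tau>
  proof -
    have pos: "0 < \<sigma> n" using c0_star_nonneg[OF that(2)] less by (rule le_less_trans)
    have "{k. \<tau> k = \<sigma> n} \<subset> {k. \<sigma> k = \<sigma> n}"
    proof (rule psubsetI)
      show "{k. \<tau> k = \<sigma> n} \<subseteq> {k. \<sigma> k = \<sigma> n}"
      proof
        fix k assume "k \<in> {k. \<tau> k = \<sigma> n}"
        then have k: "\<tau> k = \<sigma> n" by simp
        then have "k < n" using less c0_star_antimono[OF that(2), of n k] by (cases "k < n") auto
        then show "k \<in> {k. \<sigma> k = \<sigma> n}" using eq k by simp
      qed
      have "n \<in> {k. \<sigma> k = \<sigma> n}" "n \<notin> {k. \<tau> k = \<sigma> n}" using less by auto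
      then show "{k. \<tau> k = \<sigma> n} \<noteq> {k. \<sigma> k = \<sigma> n}" by blast
    qed
    then have "card {k. \<tau> k = \<sigma> n} < card {k. \<sigma> k = \<sigma> n}"
      by (intro psubset_card_mono c0_star_level_finite that pos)
    then show False using cnt[OF pos] by simp
  qed
  have "\<sigma> n = \<tau> n" for n
  proof (induction n rule: less_induct)
    case (less n)
    show ?case
      using aux[OF assms(1,2) cnt less.IH] aux[OF assms(2,1) cnt[symmetric] less.IH[symmetric]]
      by (meson linorder_neqE)
  qed
  then show ?thesis by blast
qed

lemma schmidt_c0_star: "\<xi> \<in> c0_star \<Longrightarrow> orthosys a \<Longrightarrow> orthosys b \<Longrightarrow> schmidt (\<lambda>n. complex_of_real (\<xi> n)) a b"
  by (simp add: schmidt_def c0_star_bounded)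

text \<open>The product of the adjoint with the operator is diagonal along \<open>v\<close>, with
  the squares of \<open>s\<close> as entries, and for \<open>t > 0\<close> its eigenspace at
  \<open>t\<^sup>2\<close> is spanned by the finitely many \<open>v n\<close> with
  \<open>s n = t\<close>.\<close>

theorem s_numbers_real_schmidt:
  assumes s: "s \<in> c0_star" and v: "orthonormal_sys v" and u: "orthosys u"
    and unit: "\<And>n. s n \<noteq> 0 \<Longrightarrow> cinner (u n) (u n) = 1"
  shows "s_numbers (real_schmidt s v u) = s"
proof -
  let ?X = "real_schmidt s v u"
  interpret X: schmidt "\<lambda>n. complex_of_real (s n)" v u
    by (rule schmidt_c0_star[OF s orthonormal_sys_orthosys[OF v] u])
  have vv: "cinner (v i) (v j) = (if i = j then 1 else 0)" for i j
    using v by (simp add: orthonormal_sys_def)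
  define T where "T = real_schmidt (\<lambda>n. (s n)\<^sup>2) v v"
  \<comment> \<open>Where \<open>s n = 0\<close>, nothing is known about the norm of
    \<open>u n\<close>, but both sides vanish.\<close>
  have weights: "complex_of_real (s n) * complex_of_real (s n) * cinner (u n) (u n) = complex_of_real ((s n)\<^sup>2)" for n
    using unit by (cases "s n = 0") (auto simp: power2_eq_square)
  have "real_schmidt s u v o\<^sub>L ?X =
      schmidt_op (\<lambda>n. complex_of_real (s n) * complex_of_real (s n) * cinner (u n) (u n)) v v"
    by (rule schmidt_compose[OF schmidt_c0_star[OF s u X.a] X.schmidt_axioms])
      (use u in \<open>simp add: orthosys_def\<close>)
  also have "\<dots> = T" by (simp only: weights T_def)
  finally have comp: "real_schmidt s u v o\<^sub>L ?X = T" .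
  have T: "adjoint (blinfun_apply ?X) (blinfun_apply ?X h) = blinfun_apply T h" for h
    by (simp add: X.adjoint_eq comp[symmetric])
  interpret T: schmidt "\<lambda>n. complex_of_real ((s n)\<^sup>2)" v v
  proof
    have "\<bar>(s n)\<^sup>2\<bar> \<le> (s 0)\<^sup>2" for n
      using c0_star_nonneg[OF s] c0_star_antimono[OF s, of 0 n] by (simp add: power_mono)
    then show "bounded (range (\<lambda>n. complex_of_real ((s n)\<^sup>2)))"
      unfolding bounded_iff by (intro exI[of _ "(s 0)\<^sup>2"]) (auto simp del: of_real_power)
  qed (rule X.a)+
  have card_dim: "card {n. s n = t} = complex_vector.dim {h. blinfun_apply T h = complex_of_real (t\<^sup>2) *\<^sub>C h}"
    if t: "0 < t" for t
  proof -
    let ?F = "{n. s n = t}"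
    have fin: "finite ?F" by (rule c0_star_level_finite[OF s t])
    have inj: "inj_on v ?F"
      by (rule inj_onI) (metis vv zero_neq_one)
    have "complex_vector.independent (v ` ?F)"
    proof (rule complex_vector.independent_if_scalars_zero)
      fix f x assume zero: "(\<Sum>x\<in>v ` ?F. f x *\<^sub>C x) = 0" and "x \<in> v ` ?F"
      then obtain n where n: "n \<in> ?F" "x = v n" by blast
      have "cinner (\<Sum>x\<in>v ` ?F. f x *\<^sub>C x) (v n) = (\<Sum>m\<in>?F. if m = n then f (v m) else 0)"
        by (subst sum.reindex[OF inj]) (simp add: cinner_sum_left cinner_scaleC_left vv if_distrib cong: if_cong)
      then show "f x = 0" using zero n fin by simp
    qed (simp add: fin)
    moreover have "complex_vector.span (v ` ?F) = {h. blinfun_apply T h = complex_of_real (t\<^sup>2) *\<^sub>C h}"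
    proof (intro equalityI subsetI)
      fix h assume "h \<in> complex_vector.span (v ` ?F)"
      moreover have "complex_vector.span (v ` ?F) \<subseteq> {h. blinfun_apply T h = complex_of_real (t\<^sup>2) *\<^sub>C h}"
      proof (rule complex_vector.span_minimal)
        show "v ` ?F \<subseteq> {h. blinfun_apply T h = complex_of_real (t\<^sup>2) *\<^sub>C h}"
          unfolding T_def by (auto simp: T.apply_system vv simp del: of_real_power)
        show "complex_vector.subspace {h. blinfun_apply T h = complex_of_real (t\<^sup>2) *\<^sub>C h}"
          unfolding complex_vector.subspace_def
          by (auto simp: BH_scaleC[OF T.in_BH, folded T_def] blinfun.add_right scaleC_add_right
              complex_vector.scale_left_commute simp del: of_real_power)
      qed
      ultimately show "h \<in> {h. blinfun_apply T h = complex_of_real (t\<^sup>2) *\<^sub>C h}" by blast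
    next
      fix h assume "h \<in> {h. blinfun_apply T h = complex_of_real (t\<^sup>2) *\<^sub>C h}"
      then have h: "blinfun_apply T h = complex_of_real (t\<^sup>2) *\<^sub>C h" by simp
      \<comment> \<open>An eigenvector is orthogonal to every \<open>v n\<close> of a different
        level. Thus \<open>T h\<close> is a finite sum, and division by \<open>t\<^sup>2\<close>
        shows that \<open>h\<close> itself lies in the span.\<close>
      have zero: "cinner h (v n) = 0" if "s n \<noteq> t" for n
      proof -
        have "complex_of_real ((s n)\<^sup>2) * cinner h (v n) = complex_of_real (t\<^sup>2) * cinner h (v n)"
          using T.cinner_apply_system[of h n] h
          unfolding T_def by (auto simp: vv cinner_scaleC_left simp del: of_real_power)
        moreover have "(s n)\<^sup>2 \<noteq> t\<^sup>2"
          using that t c0_star_nonneg[OF s, of n] by (simp add: power2_eq_iff_nonneg)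
        ultimately show ?thesis by (metis mult_right_cancel of_real_eq_iff)
      qed
      have "blinfun_apply T h = (\<Sum>n\<in>?F. (complex_of_real ((s n)\<^sup>2) * cinner h (v n)) *\<^sub>C v n)"
        unfolding T_def T.apply_eq by (intro suminf_finite fin) (simp add: zero)
      also have "\<dots> \<in> complex_vector.span (v ` ?F)"
        by (intro complex_vector.span_sum complex_vector.span_scale complex_vector.span_base) auto
      finally have "(1 / complex_of_real (t\<^sup>2)) *\<^sub>C complex_of_real (t\<^sup>2) *\<^sub>C h \<in> complex_vector.span (v ` ?F)"
        unfolding h by (rule complex_vector.span_scale)
      then show "h \<in> complex_vector.span (v ` ?F)" using t by (simp add: scaleC_scaleC)
    qed
    ultimately show ?thesis
      by (metis (no_types, lifting) card_image complex_vector.dim_span_eq_card_independent inj)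
  qed
  show ?thesis
    unfolding s_numbers_def T
  proof (rule the_equality)
    show "s \<in> c0_star \<and> (\<forall>t>0. card {n. s n = t} =
        complex_vector.dim {h. blinfun_apply T h = complex_of_real (t\<^sup>2) *\<^sub>C h})"
      using s card_dim by blast
    show "\<sigma> = s" if "\<sigma> \<in> c0_star \<and> (\<forall>t>0. card {n. \<sigma> n = t} =
        complex_vector.dim {h. blinfun_apply T h = complex_of_real (t\<^sup>2) *\<^sub>C h})" for \<sigma>
      using that s card_dim by (intro c0_star_eqI) auto
  qed
qed

section \<open>The Calkin correspondence\<close>

lemma BH_simps [simp]:
  "mult BH = (o\<^sub>L)" "one BH = id_blinfun" "zero BH = 0" "add BH = (+)"
  by (simp_all add: BH_def)

lemma BH_compose: "X \<in> carrier BH \<Longrightarrow> Y \<in> carrier BH \<Longrightarrow> X o\<^sub>L Y \<in> carrier BH"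
  and BH_add: "X \<in> carrier BH \<Longrightarrow> Y \<in> carrier BH \<Longrightarrow> X + Y \<in> carrier BH"
  and BH_uminus: "X \<in> carrier BH \<Longrightarrow> - X \<in> carrier BH"
  and BH_id: "id_blinfun \<in> carrier BH"
  by (auto simp: BH_def blinfun.add_left scaleC_add_right blinfun.minus_left
      complex_vector.scale_minus_right)

lemma blinfun_compose_sum:
  "(X + Y) o\<^sub>L Z = (X o\<^sub>L Z) + (Y o\<^sub>L Z)" "X o\<^sub>L (Y + Z) = (X o\<^sub>L Y) + (X o\<^sub>L Z)"
  "(X o\<^sub>L Y) o\<^sub>L Z = X o\<^sub>L (Y o\<^sub>L Z)" "X o\<^sub>L 0 = 0" "0 o\<^sub>L X = 0"
  by (auto intro!: blinfun_eqI simp: blinfun.add_left blinfun.add_right)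

lemma blinfun_compose_id: "id_blinfun o\<^sub>L X = X" "X o\<^sub>L id_blinfun = X"
  by (auto intro!: blinfun_eqI)

lemma compact_operators_BH: "X \<in> compact_operators \<Longrightarrow> X \<in> carrier BH"
  by (simp add: compact_operators_def)

lemma compact_operators_compose:
  assumes "X \<in> compact_operators" "A \<in> carrier BH" "B \<in> carrier BH"
  shows "A o\<^sub>L X o\<^sub>L B \<in> compact_operators"
proof -
  let ?K = "closure (blinfun_apply X ` cball 0 1)"
  have K: "compact ?K" using assms(1) by (simp add: compact_operators_def)
  \<comment> \<open>\<open>B\<close> maps the unit ball into the ball of radius \<open>M\<close>;
    the added 1 makes \<open>M\<close> positive even for \<open>B = 0\<close>, so that rescaling is
    possible.\<close>
  define M where "M = norm B + 1"
  have "M > 0" by (simp add: M_def add_nonneg_pos)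
  define T where "T = blinfun_apply A ` (\<lambda>x. M *\<^sub>R x) ` ?K"
  have "compact T"
    unfolding T_def
    by (intro compact_continuous_image[OF linear_continuous_on[OF blinfun.bounded_linear_right]]
        compact_scaling K)
  have "blinfun_apply (A o\<^sub>L X o\<^sub>L B) h \<in> T" if "h \<in> cball 0 1" for h
  proof -
    have "norm (blinfun_apply B h) \<le> norm B * 1"
      using that by (intro order_trans[OF norm_blinfun mult_left_mono]) auto
    then have "inverse M *\<^sub>R blinfun_apply B h \<in> cball 0 1"
      using \<open>M > 0\<close> by (simp add: M_def field_simps)
    then have "blinfun_apply X (inverse M *\<^sub>R blinfun_apply B h) \<in> ?K"
      by (intro subsetD[OF closure_subset] imageI)
    then have "blinfun_apply A (M *\<^sub>R blinfun_apply X (inverse M *\<^sub>R blinfun_apply B h)) \<in> T"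
      unfolding T_def by (intro imageI)
    then show ?thesis using \<open>M > 0\<close> by (simp add: blinfun.scaleR_right)
  qed
  then have "closure (blinfun_apply (A o\<^sub>L X o\<^sub>L B) ` cball 0 1) \<subseteq> T"
    by (intro closure_minimal compact_imp_closed \<open>compact T\<close>) auto
  then have "compact (closure (blinfun_apply (A o\<^sub>L X o\<^sub>L B) ` cball 0 1))"
    using compact_Int_closed[OF \<open>compact T\<close> closed_closure] by (metis Int_absorb1)
  then show ?thesis
    using assms by (simp add: compact_operators_def BH_compose)
qed

text \<open>The solid cones invariant under ampliation of the Calkin correspondence. Closure under
  positive multiples is contained in \<open>dominated\<close>, and \<open>n div 2\<close> is the
  ampliation \<open>D\<^sub>2\<close> for indices from 0. Its iterates are the ampliations by powers
  of 2, and by monotonicity these dominate all others.\<close>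

definition is_char_set :: "(nat \<Rightarrow> real) set \<Rightarrow> bool" where
  "is_char_set S \<longleftrightarrow> S \<subseteq> c0_star \<and> S \<noteq> {} \<and> (\<forall>\<xi>\<in>S. \<forall>\<eta>\<in>S. (\<lambda>n. \<xi> n + \<eta> n) \<in> S) \<and>
     (\<forall>\<xi>\<in>S. \<forall>\<eta>\<in>c0_star. dominated \<eta> \<xi> \<longrightarrow> \<eta> \<in> S) \<and> (\<forall>\<xi>\<in>S. (\<lambda>n. \<xi> (n div 2)) \<in> S)"

lemma is_char_setD:
  assumes "is_char_set S"
  shows "\<xi> \<in> S \<Longrightarrow> \<xi> \<in> c0_star"
    and "\<xi> \<in> S \<Longrightarrow> \<eta> \<in> S \<Longrightarrow> (\<lambda>n. \<xi> n + \<eta> n) \<in> S"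
    and "\<xi> \<in> S \<Longrightarrow> \<eta> \<in> c0_star \<Longrightarrow> dominated \<eta> \<xi> \<Longrightarrow> \<eta> \<in> S"
    and "\<xi> \<in> S \<Longrightarrow> (\<lambda>n. \<xi> (n div 2)) \<in> S"
  using assms by (auto simp: is_char_set_def)

lemma c0_star_add: "\<xi> \<in> c0_star \<Longrightarrow> \<eta> \<in> c0_star \<Longrightarrow> (\<lambda>n. \<xi> n + \<eta> n) \<in> c0_star"
  unfolding c0_star_def decseq_def using tendsto_add[of \<xi> 0 sequentially \<eta> 0]
  by (auto intro: add_mono)

lemma c0_star_zero: "(\<lambda>n. 0) \<in> c0_star"
  by (simp add: c0_star_def decseq_def)

lemma filterlim_div_sequentially: "(0::nat) < m \<Longrightarrow> filterlim (\<lambda>n. n div m) sequentially sequentially"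
  unfolding filterlim_at_top eventually_sequentially
  by (metis div_le_mono nonzero_mult_div_cancel_right not_gr_zero)

lemma c0_star_ampliation:
  assumes "\<xi> \<in> c0_star" "0 < m"
  shows "(\<lambda>n. \<xi> (n div m)) \<in> c0_star"
proof -
  have "(\<lambda>n. \<xi> (n div m)) \<longlonglongrightarrow> 0"
    using filterlim_compose[OF c0_star_tendsto[OF assms(1)] filterlim_div_sequentially[OF assms(2)]] .
  then show ?thesis
    using assms(1) by (auto simp: c0_star_def decseq_def div_le_mono)
qed

lemma char_set_zero:
  assumes "is_char_set S"
  shows "(\<lambda>n. 0) \<in> S"
proof -
  obtain \<xi> where "\<xi> \<in> S" using assms by (auto simp: is_char_set_def)
  then show ?thesis
    using is_char_setD(3)[OF assms _ c0_star_zero] unfolding dominated_def by (metis mult_zero_left order_refl)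
qed

text \<open>For \<open>m \<le> 2 ^ k\<close> and nonincreasing \<xi> one has
  \<open>\<xi> (n div m) \<le> \<xi> (n div 2 ^ k)\<close>, so powers of 2 describe the same set as
  arbitrary ampliations and match the generator \<open>n div 2\<close> in
  \<open>is_char_set\<close>.\<close>

definition principal_char_set :: "(nat \<Rightarrow> real) \<Rightarrow> (nat \<Rightarrow> real) set" where
  "principal_char_set \<xi> = {\<eta> \<in> c0_star. \<exists>k. dominated \<eta> (\<lambda>n. \<xi> (n div 2 ^ k))}"

lemma dominated_pos:
  assumes "dominated \<eta> \<xi>" "\<And>n. 0 \<le> \<xi> n"
  obtains M where "M > 0" "\<And>n. \<eta> n \<le> M * \<xi> n"
proof -
  obtain M where M: "\<And>n. \<eta> n \<le> M * \<xi> n" using assms(1) by (auto simp: dominated_def)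
  have "\<eta> n \<le> (\<bar>M\<bar> + 1) * \<xi> n" for n
    using M[of n] mult_right_mono[of M "\<bar>M\<bar> + 1" "\<xi> n"] assms(2)[of n] by linarith
  then show ?thesis using that[of "\<bar>M\<bar> + 1"] by auto
qed

lemma principal_char_set_self: "\<xi> \<in> c0_star \<Longrightarrow> \<xi> \<in> principal_char_set \<xi>"
  unfolding principal_char_set_def dominated_def
  by (intro CollectI conjI exI[of _ "0 :: nat"] exI[of _ "1 :: real"]) auto

lemma is_char_set_principal:
  assumes \<xi>: "\<xi> \<in> c0_star"
  shows "is_char_set (principal_char_set \<xi>)"
proof -
  have "(\<lambda>n. \<eta> n + \<zeta> n) \<in> principal_char_set \<xi>"
    if \<eta>: "\<eta> \<in> principal_char_set \<xi>" and \<zeta>: "\<zeta> \<in> principal_char_set \<xi>" for \<eta> \<zeta>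
  proof -
    obtain k where "dominated \<eta> (\<lambda>n. \<xi> (n div 2 ^ k))" using \<eta> by (auto simp: principal_char_set_def)
    then obtain M where M: "M > 0" "\<And>n. \<eta> n \<le> M * \<xi> (n div 2 ^ k)"
      by (rule dominated_pos) (use c0_star_nonneg[OF \<xi>] in blast)+
    obtain l where "dominated \<zeta> (\<lambda>n. \<xi> (n div 2 ^ l))" using \<zeta> by (auto simp: principal_char_set_def)
    then obtain N where N: "N > 0" "\<And>n. \<zeta> n \<le> N * \<xi> (n div 2 ^ l)"
      by (rule dominated_pos) (use c0_star_nonneg[OF \<xi>] in blast)+
    have "\<eta> n + \<zeta> n \<le> (M + N) * \<xi> (n div 2 ^ max k l)" for n
    proof -
      have "\<xi> (n div 2 ^ k) \<le> \<xi> (n div 2 ^ max k l)" "\<xi> (n div 2 ^ l) \<le> \<xi> (n div 2 ^ max k l)"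
        by (auto intro!: c0_star_antimono[OF \<xi>] div_le_mono2)
      then have "M * \<xi> (n div 2 ^ k) + N * \<xi> (n div 2 ^ l) \<le> M * \<xi> (n div 2 ^ max k l) + N * \<xi> (n div 2 ^ max k l)"
        using M(1) N(1) by (intro add_mono mult_left_mono) auto
      with M(2)[of n] N(2)[of n] show ?thesis by (simp add: distrib_right)
    qed
    then have "dominated (\<lambda>n. \<eta> n + \<zeta> n) (\<lambda>n. \<xi> (n div 2 ^ max k l))" by (auto simp: dominated_def)
    then show ?thesis using that by (auto simp: principal_char_set_def c0_star_add)
  qed
  moreover have "\<zeta> \<in> principal_char_set \<xi>"
    if \<eta>: "\<eta> \<in> principal_char_set \<xi>" and \<zeta>: "\<zeta> \<in> c0_star" "dominated \<zeta> \<eta>" for \<eta> \<zeta>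
  proof -
    obtain N where N: "N > 0" "\<And>n. \<zeta> n \<le> N * \<eta> n"
      using dominated_pos[OF \<zeta>(2)] c0_star_nonneg \<eta> by (auto simp: principal_char_set_def)
    obtain k M where M: "\<And>n. \<eta> n \<le> M * \<xi> (n div 2 ^ k)"
      using \<eta> by (auto simp: principal_char_set_def dominated_def)
    have "\<zeta> n \<le> N * M * \<xi> (n div 2 ^ k)" for n
      using order_trans[OF N(2) mult_left_mono[OF M]] N(1) by (simp add: mult.assoc)
    then show ?thesis using \<zeta>(1) by (auto simp: principal_char_set_def dominated_def)
  qed
  moreover have "(\<lambda>n. \<eta> (n div 2)) \<in> principal_char_set \<xi>" if \<eta>: "\<eta> \<in> principal_char_set \<xi>" for \<eta>
  proof -
    obtain k M where M: "\<And>n. \<eta> n \<le> M * \<xi> (n div 2 ^ k)"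
      using \<eta> by (auto simp: principal_char_set_def dominated_def)
    then have "\<eta> (n div 2) \<le> M * \<xi> (n div 2 ^ Suc k)" for n
      using M[of "n div 2"] by (simp add: div_mult2_eq)
    then have "dominated (\<lambda>n. \<eta> (n div 2)) (\<lambda>n. \<xi> (n div 2 ^ Suc k))" by (auto simp: dominated_def)
    moreover have "(\<lambda>n. \<eta> (n div 2)) \<in> c0_star"
      using \<eta> by (intro c0_star_ampliation) (auto simp: principal_char_set_def)
    ultimately show ?thesis unfolding principal_char_set_def by blast
  qed
  ultimately show ?thesis
    using principal_char_set_self[OF \<xi>] unfolding is_char_set_def
    by (auto simp: principal_char_set_def)
qed

lemma char_set_ampliation:
  assumes "is_char_set S" "\<xi> \<in> S"
  shows "(\<lambda>n. \<xi> (n div 2 ^ k)) \<in> S"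
proof (induction k)
  case (Suc k)
  then show ?case
    using is_char_setD(4)[OF assms(1) Suc] by (simp add: div_mult2_eq)
qed (simp add: assms)

lemma principal_char_set_least:
  assumes "is_char_set S" "\<xi> \<in> c0_star"
  shows "principal_char_set \<xi> \<subseteq> S \<longleftrightarrow> \<xi> \<in> S"
  using is_char_setD(3)[OF assms(1) char_set_ampliation[OF assms(1)]] principal_char_set_self[OF assms(2)]
  unfolding principal_char_set_def by blast

section \<open>Diagonal operators and the ideals they generate\<close>

context
  fixes e :: "nat \<Rightarrow> 'h::complex_hilbert"
  assumes e: "orthonormal_sys e"
begin

lemma ee: "cinner (e i) (e j) = (if i = j then 1 else 0)"
  using e by (simp add: orthonormal_sys_def)

lemma schmidt_subsystem:
  assumes "bounded (range c)" "inj f" "inj g"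
  shows "schmidt c (\<lambda>n. e (f n)) (\<lambda>n. e (g n))"
  using assms by (auto simp: schmidt_def orthosys_def ee inj_eq orthonormal_sys_norm[OF e])

lemma diag_eq: "diag e \<xi> = real_schmidt \<xi> e e"
  by (simp add: diag_def schmidt_op_def)

lemma schmidt_diag: "\<xi> \<in> c0_star \<Longrightarrow> schmidt (\<lambda>n. complex_of_real (\<xi> n)) e e"
  by (intro schmidt_c0_star orthonormal_sys_orthosys e)

lemma diag_BH: "\<xi> \<in> c0_star \<Longrightarrow> diag e \<xi> \<in> carrier BH"
  unfolding diag_eq by (rule schmidt.in_BH[OF schmidt_diag])

lemma s_numbers_diag: "\<xi> \<in> c0_star \<Longrightarrow> s_numbers (diag e \<xi>) = \<xi>"
  unfolding diag_eq by (rule s_numbers_real_schmidt[OF _ e orthonormal_sys_orthosys[OF e]]) (auto simp: ee)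

text \<open>The head of the series ranges over a compact box in finitely many dimensions, and the
  tail is uniformly small since \<xi> tends to 0; hence the image of the unit ball is totally
  bounded.\<close>

lemma diag_compact:
  assumes \<xi>: "\<xi> \<in> c0_star"
  shows "diag e \<xi> \<in> compact_operators"
proof -
  interpret schmidt "\<lambda>n. complex_of_real (\<xi> n)" e e by (rule schmidt_diag[OF \<xi>])
  define P where "P N = {\<Sum>n<N. c n *\<^sub>C e n | c. \<forall>n<N. cmod (c n) \<le> \<xi> 0}" for N
  have compact_P: "compact (P N)" for N
  proof (induction N)
    case 0
    have "P 0 = {0}" by (auto simp: P_def)
    then show ?case by simp
  next
    case (Suc N)
    define Q where "Q = (\<lambda>z. z *\<^sub>C e N) ` cball 0 (\<xi> 0)"
    have "compact Q"
      unfolding Q_def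
      by (intro compact_continuous_image linear_continuous_on[OF bounded_linear_scaleC_left] compact_cball)
    then have "compact {x + y | x y. x \<in> P N \<and> y \<in> Q}" using Suc by (intro compact_sums)
    moreover have "P (Suc N) = {x + y | x y. x \<in> P N \<and> y \<in> Q}"
    proof (intro equalityI subsetI)
      fix z assume "z \<in> P (Suc N)"
      then obtain c where c: "\<forall>n<Suc N. cmod (c n) \<le> \<xi> 0" "z = (\<Sum>n<N. c n *\<^sub>C e n) + c N *\<^sub>C e N"
        by (auto simp: P_def)
      then have "(\<Sum>n<N. c n *\<^sub>C e n) \<in> P N" "c N *\<^sub>C e N \<in> Q" by (auto simp: P_def Q_def)
      with c(2) show "z \<in> {x + y | x y. x \<in> P N \<and> y \<in> Q}" by blast
    next
      fix z assume "z \<in> {x + y | x y. x \<in> P N \<and> y \<in> Q}"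
      then obtain c d where c: "\<forall>n<N. cmod (c n) \<le> \<xi> 0" "cmod d \<le> \<xi> 0" "z = (\<Sum>n<N. c n *\<^sub>C e n) + d *\<^sub>C e N"
        by (auto simp: P_def Q_def)
      then show "z \<in> P (Suc N)"
        unfolding P_def by (intro CollectI exI[of _ "c(N := d)"]) (auto simp: less_Suc_eq)
    qed
    ultimately show ?case by simp
  qed
  let ?T = "blinfun_apply (real_schmidt \<xi> e e) ` cball 0 1"
  have "\<exists>k. finite k \<and> closure ?T \<subseteq> (\<Union>x\<in>k. ball x \<epsilon>)" if \<epsilon>: "0 < \<epsilon>" for \<epsilon>
  proof -
    have "\<forall>\<^sub>F n in sequentially. \<xi> n < \<epsilon> / 4"
      using c0_star_tendsto[OF \<xi>] \<epsilon> by (intro order_tendstoD(2)) auto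
    then obtain N where N: "\<xi> N < \<epsilon> / 4" by (auto simp: eventually_sequentially)
    obtain k where k: "finite k" "P N \<subseteq> (\<Union>x\<in>k. ball x (\<epsilon> / 2))"
      using compact_P[of N] \<epsilon> unfolding compact_eq_totally_bounded by (meson half_gt_zero)
    have near: "\<exists>p\<in>P N. norm (blinfun_apply (real_schmidt \<xi> e e) h - p) \<le> \<epsilon> / 4" if h: "h \<in> cball 0 1" for h
    proof -
      define p where "p = (\<Sum>n<N. (complex_of_real (\<xi> n) * cinner h (e n)) *\<^sub>C e n)"
      have "cmod (complex_of_real (\<xi> n) * cinner h (e n)) \<le> \<xi> 0" for n
      proof -
        have "cmod (cinner h (e n)) \<le> 1"
          using cmod_cinner_le[of h "e n"] h by (simp add: orthonormal_sys_norm[OF e])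
        then have "\<xi> n * cmod (cinner h (e n)) \<le> \<xi> 0 * 1"
          using c0_star_nonneg[OF \<xi>] c0_star_antimono[OF \<xi>, of 0 n] by (intro mult_mono) auto
        then show ?thesis using c0_star_nonneg[OF \<xi>] by (simp add: norm_mult)
      qed
      then have "p \<in> P N"
        unfolding P_def p_def by (intro CollectI exI[of _ "\<lambda>n. complex_of_real (\<xi> n) * cinner h (e n)"]) simp
      moreover have "norm (blinfun_apply (real_schmidt \<xi> e e) h - p) \<le> \<epsilon> / 4"
      proof -
        define r where "r n = (if n < N then 0 else complex_of_real (\<xi> n))" for n
        have r: "cmod (r n) \<le> \<epsilon> / 4" for n
          using N \<epsilon> c0_star_nonneg[OF \<xi>, of n] c0_star_antimono[OF \<xi>, of N n] by (auto simp: r_def)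
        then have "bounded (range r)" unfolding bounded_iff by blast
        then interpret r: schmidt r e e
          by unfold_locales (auto intro: orthonormal_sys_orthosys e)
        have "(\<lambda>n. (r n * cinner h (e n)) *\<^sub>C e n) sums (blinfun_apply (real_schmidt \<xi> e e) h - p)"
        proof -
          have "(\<lambda>n. if n \<in> {..<N} then (complex_of_real (\<xi> n) * cinner h (e n)) *\<^sub>C e n else 0) sums p"
            unfolding p_def by (rule sums_If_finite_set) simp
          with summable_sums[OF summable[of h]]
          have "(\<lambda>n. (complex_of_real (\<xi> n) * cinner h (e n)) *\<^sub>C e n -
              (if n \<in> {..<N} then (complex_of_real (\<xi> n) * cinner h (e n)) *\<^sub>C e n else 0)) sums
              (blinfun_apply (real_schmidt \<xi> e e) h - p)"
            unfolding apply_eq by (rule sums_diff)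
          then show ?thesis by (rule sums_cong[THEN iffD1, rotated]) (auto simp: r_def)
        qed
        then have "blinfun_apply (real_schmidt \<xi> e e) h - p = blinfun_apply (schmidt_op r e e) h"
          by (simp add: r.apply_eq sums_iff)
        moreover have "norm (blinfun_apply (schmidt_op r e e) h) \<le> \<epsilon> / 4 * norm h"
          by (rule r.norm_apply_le[OF r])
        moreover have "\<epsilon> / 4 * norm h \<le> \<epsilon> / 4 * 1" using h \<epsilon> by (intro mult_left_mono) auto
        ultimately show ?thesis by simp
      qed
      ultimately show ?thesis by blast
    qed
    \<comment> \<open>The radius is \<epsilon>/2 from the net of \<open>P N\<close> plus
      \<epsilon>/4 from the tail. The slack up to \<epsilon> allows closed balls, whose finite union
      is closed and therefore contains the closure of \<open>?T\<close>.\<close>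
    have "closure ?T \<subseteq> (\<Union>x\<in>k. cball x (3 * \<epsilon> / 4))"
    proof (rule closure_minimal)
      show "closed (\<Union>x\<in>k. cball x (3 * \<epsilon> / 4))" using k(1) by (intro closed_UN) auto
      show "?T \<subseteq> (\<Union>x\<in>k. cball x (3 * \<epsilon> / 4))"
      proof
        fix y assume "y \<in> ?T"
        then obtain p where p: "p \<in> P N" "norm (y - p) \<le> \<epsilon> / 4" using near by blast
        then obtain x where "x \<in> k" "dist x p < \<epsilon> / 2" using k(2) by auto
        then have "dist x y \<le> 3 * \<epsilon> / 4"
          using p(2) dist_triangle[of x y p] by (simp add: dist_norm norm_minus_commute)
        then show "y \<in> (\<Union>x\<in>k. cball x (3 * \<epsilon> / 4))" using \<open>x \<in> k\<close> by auto
      qed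
    qed
    also have "\<dots> \<subseteq> (\<Union>x\<in>k. ball x \<epsilon>)" using \<epsilon> by force
    finally show ?thesis using k(1) by blast
  qed
  then have "compact (closure ?T)"
    unfolding compact_eq_totally_bounded by (simp add: complete_eq_closed)
  then show ?thesis by (simp add: compact_operators_def diag_eq in_BH)
qed

lemma diag_add:
  assumes "\<xi> \<in> c0_star" "\<eta> \<in> c0_star"
  shows "diag e (\<lambda>n. \<xi> n + \<eta> n) = diag e \<xi> + diag e \<eta>"
proof (rule blinfun_eqI)
  fix h
  interpret x: schmidt "\<lambda>n. complex_of_real (\<xi> n)" e e by (rule schmidt_diag[OF assms(1)])
  interpret y: schmidt "\<lambda>n. complex_of_real (\<eta> n)" e e by (rule schmidt_diag[OF assms(2)])
  interpret s: schmidt "\<lambda>n. complex_of_real (\<xi> n + \<eta> n)" e e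
    by (rule schmidt_diag[OF c0_star_add[OF assms]])
  show "blinfun_apply (diag e (\<lambda>n. \<xi> n + \<eta> n)) h = blinfun_apply (diag e \<xi> + diag e \<eta>) h"
    unfolding diag_eq blinfun.add_left x.apply_eq y.apply_eq s.apply_eq
      suminf_add[OF x.summable y.summable]
    by (simp add: scaleC_add_left ring_distribs)
qed

lemma diag_dominated:
  assumes \<xi>: "\<xi> \<in> c0_star" and \<eta>: "\<eta> \<in> c0_star" "dominated \<eta> \<xi>"
  obtains W where "W \<in> carrier BH" "diag e \<eta> = W o\<^sub>L diag e \<xi>"
proof -
  obtain M where M: "M > 0" "\<And>n. \<eta> n \<le> M * \<xi> n"
    using dominated_pos[OF \<eta>(2)] c0_star_nonneg[OF \<xi>] by metis
  \<comment> \<open>Domination forces \<open>\<eta> n = 0\<close> wherever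
    \<open>\<xi> n = 0\<close>; there the quotient is 0 by convention, so \<open>w\<close> is
    bounded by \<open>M\<close> and \<open>w n * \<xi> n = \<eta> n\<close> holds
    everywhere.\<close>
  define w where "w n = \<eta> n / \<xi> n" for n
  have w: "\<bar>w n\<bar> \<le> M" for n
    using M(2)[of n] M(1) c0_star_nonneg[OF \<xi>, of n] c0_star_nonneg[OF \<eta>(1), of n]
    by (cases "\<xi> n = 0") (auto simp: w_def divide_le_eq)
  have eq: "complex_of_real (w n) * complex_of_real (\<xi> n) * cinner (e n) (e n) = complex_of_real (\<eta> n)" for n
    using M(2)[of n] c0_star_nonneg[OF \<eta>(1), of n] by (cases "\<xi> n = 0") (auto simp: w_def ee)
  interpret w: schmidt "\<lambda>n. complex_of_real (w n)" e e
    using w by unfold_locales (auto simp: bounded_iff intro: orthonormal_sys_orthosys e)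
  have "real_schmidt w e e o\<^sub>L diag e \<xi> =
      schmidt_op (\<lambda>n. complex_of_real (w n) * complex_of_real (\<xi> n) * cinner (e n) (e n)) e e"
    unfolding diag_eq by (rule schmidt_compose[OF w.schmidt_axioms schmidt_diag[OF \<xi>]]) (simp add: ee)
  also have "\<dots> = diag e \<eta>" by (simp only: eq diag_eq)
  finally show ?thesis using that[OF w.in_BH] by simp
qed

text \<open>The partial isometries that exchange the singular systems \<open>v\<close> and
  \<open>u\<close> with the fixed system \<open>e\<close> carry \<open>X\<close> into the diagonal
  of its s-numbers and back. Hence every ideal containing one of these operators contains the
  other.\<close>

lemma compact_factorization:
  assumes X: "X \<in> compact_operators"
  obtains A B A' B' where "s_numbers X \<in> c0_star"
    "A \<in> carrier BH" "B \<in> carrier BH" "A' \<in> carrier BH" "B' \<in> carrier BH"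
    "X = A o\<^sub>L diag e (s_numbers X) o\<^sub>L B" "diag e (s_numbers X) = A' o\<^sub>L X o\<^sub>L B'"
proof -
  obtain s v u where s: "s \<in> c0_star" and v: "orthonormal_sys v" and u: "orthosys u"
    and unit: "\<And>n. s n \<noteq> 0 \<Longrightarrow> cinner (u n) (u n) = 1" and X_eq: "X = real_schmidt s v u"
    using singular_value_decomposition[OF X e] by metis
  have eq: "s_numbers X = s" unfolding X_eq by (rule s_numbers_real_schmidt[OF s v u unit])
  have one: "schmidt (\<lambda>n. 1) a b" if "orthosys a" "orthosys b" for a b :: "nat \<Rightarrow> 'h"
    using that by (auto simp: schmidt_def bounded_iff)
  note sys = orthonormal_sys_orthosys[OF e] orthonormal_sys_orthosys[OF v] u
  have vv: "cinner (v i) (v j) = (if i = j then 1 else 0)" for i j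
    using v by (simp add: orthonormal_sys_def)
  have uu: "cinner (u i) (u j) = 0" if "i \<noteq> j" for i j using u that by (simp add: orthosys_def)
  define A B A' B' where "A = schmidt_op (\<lambda>n. 1) e u" and "B = schmidt_op (\<lambda>n. 1) v e"
    and "A' = schmidt_op (\<lambda>n. 1) u e" and "B' = schmidt_op (\<lambda>n. 1) e v"
  have "A o\<^sub>L diag e s = schmidt_op (\<lambda>n. 1 * complex_of_real (s n) * cinner (e n) (e n)) e u"
    unfolding A_def diag_eq by (rule schmidt_compose[OF one schmidt_diag]) (simp_all add: sys s ee)
  then have "A o\<^sub>L diag e s = real_schmidt s e u" by (simp add: ee)
  moreover have "real_schmidt s e u o\<^sub>L B = schmidt_op (\<lambda>n. complex_of_real (s n) * 1 * cinner (e n) (e n)) v u"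
    unfolding B_def by (rule schmidt_compose[OF schmidt_c0_star one]) (simp_all add: sys s ee)
  then have "real_schmidt s e u o\<^sub>L B = X" by (simp add: ee X_eq)
  ultimately have 1: "X = A o\<^sub>L diag e s o\<^sub>L B" by simp
  have "A' o\<^sub>L X = schmidt_op (\<lambda>n. 1 * complex_of_real (s n) * cinner (u n) (u n)) v e"
    unfolding A'_def X_eq by (rule schmidt_compose[OF one schmidt_c0_star]) (simp_all add: sys s uu)
  moreover have "1 * complex_of_real (s n) * cinner (u n) (u n) = complex_of_real (s n)" for n
    using unit[of n] by (cases "s n = 0") auto
  ultimately have "A' o\<^sub>L X = real_schmidt s v e" by (simp only:)
  moreover have "real_schmidt s v e o\<^sub>L B' = schmidt_op (\<lambda>n. complex_of_real (s n) * 1 * cinner (v n) (v n)) e e"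
    unfolding B'_def by (rule schmidt_compose[OF schmidt_c0_star one]) (simp_all add: sys s vv)
  then have "real_schmidt s v e o\<^sub>L B' = diag e s" by (simp add: vv diag_eq)
  ultimately have 2: "diag e s = A' o\<^sub>L X o\<^sub>L B'" by simp
  have BH: "A \<in> carrier BH" "B \<in> carrier BH" "A' \<in> carrier BH" "B' \<in> carrier BH"
    unfolding A_def B_def A'_def B'_def by (intro schmidt.in_BH one sys)+
  show ?thesis by (rule that[unfolded eq, OF s BH 1 2])
qed

text \<open>A min-max argument. The span of the first \<open>n + 1\<close> vectors of
  \<open>e\<close> contains a unit vector \<open>h\<close> whose image under \<open>B\<close> is
  orthogonal to the first \<open>n\<close> of them. On \<open>h\<close> the diagonal of \<sigma>
  stretches by at least \<open>\<sigma> n\<close>, while on the image the diagonal of \<xi>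
  stretches by at most \<open>\<xi> n\<close>.\<close>

lemma diag_factor_dominated:
  assumes \<sigma>: "\<sigma> \<in> c0_star" and \<xi>: "\<xi> \<in> c0_star" and B: "B \<in> carrier BH"
    and eq: "diag e \<sigma> = A o\<^sub>L diag e \<xi> o\<^sub>L B"
  shows "dominated \<sigma> \<xi>"
proof -
  interpret \<sigma>: schmidt "\<lambda>n. complex_of_real (\<sigma> n)" e e by (rule schmidt_diag[OF \<sigma>])
  interpret \<xi>: schmidt "\<lambda>n. complex_of_real (\<xi> n)" e e by (rule schmidt_diag[OF \<xi>])
  have "\<sigma> n \<le> norm A * norm B * \<xi> n" for n
  proof -
    define f where "f = blinfun_apply B"
    obtain c where c: "norm (\<Sum>i\<le>n. c i *\<^sub>C e i) = 1"
      "\<And>k. k < n \<Longrightarrow> (\<Sum>i\<le>n. c i * cinner (f (e i)) (e k)) = 0"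
      using unit_vector_annihilated[OF e, of n "\<lambda>i k. cinner (f (e i)) (e k)"] by blast
    define h where "h = (\<Sum>i\<le>n. c i *\<^sub>C e i)"
    have he: "cinner h (e m) = (if m \<le> n then c m else 0)" for m
      by (simp add: h_def cinner_sum_left cinner_scaleC_left ee mult_delta_right)
    have "(\<sigma> n)\<^sup>2 = (\<sigma> n)\<^sup>2 * (\<Sum>m\<le>n. (cmod (c m))\<^sup>2)"
      using norm_orthonormal_sum[OF e, of "{..n}" c] c(1) by simp
    also have "\<dots> \<le> (\<Sum>m\<le>n. (cmod (complex_of_real (\<sigma> m) * c m))\<^sup>2)"
      unfolding sum_distrib_left
      by (intro sum_mono) (auto simp: norm_mult power_mult_distrib intro!: mult_right_mono power_mono
          c0_star_antimono[OF \<sigma>] c0_star_nonneg[OF \<sigma>])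
    also have "\<dots> = (norm (\<Sum>m\<le>n. (complex_of_real (\<sigma> m) * c m) *\<^sub>C e m))\<^sup>2"
      by (simp add: norm_orthonormal_sum[OF e])
    also have "(\<Sum>m\<le>n. (complex_of_real (\<sigma> m) * c m) *\<^sub>C e m) = blinfun_apply (diag e \<sigma>) h"
      unfolding diag_eq \<sigma>.apply_eq
      by (subst suminf_finite[of "{..n}"]) (auto simp: he)
    finally have "(\<sigma> n)\<^sup>2 \<le> (norm (blinfun_apply (diag e \<sigma>) h))\<^sup>2" .
    then have low: "\<sigma> n \<le> norm (blinfun_apply (diag e \<sigma>) h)" by (rule power2_le_imp_le) simp
    have fh: "cinner (f h) (e k) = 0" if "k < n" for k
      using c(2)[OF that] by (simp add: f_def h_def BH_sum_scaleC[OF B] cinner_sum_left cinner_scaleC_left)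
    have "norm (blinfun_apply (diag e \<xi>) (f h)) \<le> \<xi> n * norm (f h)"
    proof -
      define r where "r k = (if k < n then 0 else complex_of_real (\<xi> k))" for k
      have r: "cmod (r k) \<le> \<xi> n" for k
        using c0_star_nonneg[OF \<xi>] c0_star_antimono[OF \<xi>, of n k] by (auto simp: r_def)
      then interpret r: schmidt r e e
        by unfold_locales (auto simp: bounded_iff intro: orthonormal_sys_orthosys e)
      have "blinfun_apply (diag e \<xi>) (f h) = blinfun_apply (schmidt_op r e e) (f h)"
        unfolding diag_eq \<xi>.apply_eq r.apply_eq by (intro suminf_cong) (auto simp: r_def fh)
      then show ?thesis using r.norm_apply_le[OF r, of "f h"] by simp
    qed
    moreover have "norm (f h) \<le> norm B" using norm_blinfun[of B h] c(1) by (simp add: f_def h_def)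
    ultimately have "norm (blinfun_apply (diag e \<xi>) (f h)) \<le> \<xi> n * norm B"
      using c0_star_nonneg[OF \<xi>, of n] by (meson mult_left_mono order_trans)
    then have "norm A * norm (blinfun_apply (diag e \<xi>) (f h)) \<le> norm A * (\<xi> n * norm B)"
      by (intro mult_left_mono) auto
    moreover have "norm (blinfun_apply (diag e \<sigma>) h) \<le> norm A * norm (blinfun_apply (diag e \<xi>) (f h))"
      unfolding eq f_def by (simp add: norm_blinfun)
    ultimately show ?thesis using low by (simp add: mult_ac)
  qed
  then show ?thesis by (auto simp: dominated_def)
qed

lemma diag_ampliation_split:
  assumes \<xi>: "\<xi> \<in> c0_star"
  shows "diag e (\<lambda>n. \<xi> (n div 2)) =
     real_schmidt \<xi> (\<lambda>n. e (2 * n)) (\<lambda>n. e (2 * n)) +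
     real_schmidt \<xi> (\<lambda>n. e (Suc (2 * n))) (\<lambda>n. e (Suc (2 * n)))" (is "_ = ?E + ?O")
proof (rule blinfun_eqI)
  fix h
  have inj: "inj (\<lambda>n::nat. 2 * n)" "inj (\<lambda>n::nat. Suc (2 * n))" by (auto simp: inj_on_def)
  interpret d: schmidt "\<lambda>n. complex_of_real (\<xi> (n div 2))" e e
    using schmidt_diag[OF c0_star_ampliation[OF \<xi>, of 2]] by simp
  interpret E: schmidt "\<lambda>n. complex_of_real (\<xi> n)" "\<lambda>n. e (2 * n)" "\<lambda>n. e (2 * n)"
    by (rule schmidt_subsystem[OF c0_star_bounded[OF \<xi>] inj(1) inj(1)])
  interpret O: schmidt "\<lambda>n. complex_of_real (\<xi> n)" "\<lambda>n. e (Suc (2 * n))" "\<lambda>n. e (Suc (2 * n))"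
    by (rule schmidt_subsystem[OF c0_star_bounded[OF \<xi>] inj(2) inj(2)])
  define t where "t n = (complex_of_real (\<xi> (n div 2)) * cinner h (e n)) *\<^sub>C e n" for n
  have "(\<lambda>N. \<Sum>n<N. t n) \<longlonglongrightarrow> blinfun_apply (diag e (\<lambda>n. \<xi> (n div 2))) h"
    using summable_LIMSEQ[OF d.summable[of h]] by (simp add: t_def diag_eq d.apply_eq)
  \<comment> \<open>The series need not converge absolutely, so even and odd terms are separated
    along partial sums of even length.\<close>
  then have "(\<lambda>N. \<Sum>n<2 * N. t n) \<longlonglongrightarrow> blinfun_apply (diag e (\<lambda>n. \<xi> (n div 2))) h"
    using LIMSEQ_subseq_LIMSEQ[of "\<lambda>N. \<Sum>n<N. t n" _ "\<lambda>N. 2 * N"] by (simp add: o_def strict_mono_def)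
  moreover have "(\<Sum>n<2 * N. t n) =
      (\<Sum>n<N. (complex_of_real (\<xi> n) * cinner h (e (2 * n))) *\<^sub>C e (2 * n)) +
      (\<Sum>n<N. (complex_of_real (\<xi> n) * cinner h (e (Suc (2 * n)))) *\<^sub>C e (Suc (2 * n)))" for N
    by (induction N) (simp_all add: t_def)
  then have "(\<lambda>N. \<Sum>n<2 * N. t n) \<longlonglongrightarrow> blinfun_apply ?E h + blinfun_apply ?O h"
    unfolding E.apply_eq O.apply_eq
    by (simp only:) (intro tendsto_add summable_LIMSEQ E.summable O.summable)
  ultimately show "blinfun_apply (diag e (\<lambda>n. \<xi> (n div 2))) h = blinfun_apply (?E + ?O) h"
    by (simp add: LIMSEQ_unique blinfun.add_left)
qed

text \<open>
  Even- and odd-indexed basis vectors give two orthogonal copies of the space; the sum of two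
  operators factors through the diagonal operator of the ampliation.
\<close>

lemma diag_ampliation_factor:
  assumes \<xi>: "\<xi> \<in> c0_star"
  obtains U V P Q where
    "U \<in> carrier BH" "V \<in> carrier BH" "P \<in> carrier BH" "Q \<in> carrier BH"
    "diag e (\<lambda>n. \<xi> (n div 2)) = (U o\<^sub>L diag e \<xi> o\<^sub>L P) + (V o\<^sub>L diag e \<xi> o\<^sub>L Q)"
    "P o\<^sub>L diag e (\<lambda>n. \<xi> (n div 2)) o\<^sub>L U = diag e \<xi>" "P o\<^sub>L diag e (\<lambda>n. \<xi> (n div 2)) o\<^sub>L V = 0"
    "Q o\<^sub>L diag e (\<lambda>n. \<xi> (n div 2)) o\<^sub>L U = 0" "Q o\<^sub>L diag e (\<lambda>n. \<xi> (n div 2)) o\<^sub>L V = diag e \<xi>"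
proof -
  define f g :: "nat \<Rightarrow> nat" where "f n = 2 * n" and "g n = Suc (2 * n)" for n
  have inj: "inj f" "inj g" "inj (\<lambda>n. n)" by (auto simp: inj_on_def f_def g_def)
  have fg: "f m \<noteq> g n" "g n \<noteq> f m" for m n by (simp_all add: f_def g_def) presburger+
  have one: "bounded (range (\<lambda>n. 1 :: complex))" by (simp add: bounded_iff exI[of _ 1])
  note bd = c0_star_bounded[OF \<xi>]
  have mid: "real_schmidt \<xi> (\<lambda>n. e (p n)) (\<lambda>n. e (q n)) =
      schmidt_op (\<lambda>n. 1) (\<lambda>n. e n) (\<lambda>n. e (q n)) o\<^sub>L diag e \<xi> o\<^sub>L schmidt_op (\<lambda>n. 1) (\<lambda>n. e (p n)) (\<lambda>n. e n)"
    if "inj p" "inj q" for p q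
    using schmidt_compose[OF schmidt_subsystem[OF one inj(3) that(2)] schmidt_subsystem[OF bd inj(3) inj(3)]]
      schmidt_compose[OF schmidt_subsystem[OF bd inj(3) that(2)] schmidt_subsystem[OF one that(1) inj(3)]]
    by (simp add: diag_eq ee)
  have same: "schmidt_op (\<lambda>n. 1) (\<lambda>n. e (p n)) (\<lambda>n. e n) o\<^sub>L
      (real_schmidt \<xi> (\<lambda>n. e (p n)) (\<lambda>n. e (p n)) o\<^sub>L schmidt_op (\<lambda>n. 1) (\<lambda>n. e n) (\<lambda>n. e (p n))) = diag e \<xi>"
    if "inj p" for p
    using schmidt_compose[OF schmidt_subsystem[OF bd that that] schmidt_subsystem[OF one inj(3) that]]
      schmidt_compose[OF schmidt_subsystem[OF one that inj(3)] schmidt_subsystem[OF bd inj(3) that]] that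
    by (simp add: diag_eq ee inj_eq)
  have zero: "schmidt_op (\<lambda>n. 0) a b = 0" for a b :: "nat \<Rightarrow> 'h"
    by (simp add: schmidt_op_def zero_blinfun_def)
  have diff: "schmidt_op c (\<lambda>n. e (q n)) b o\<^sub>L schmidt_op d a (\<lambda>n. e (p n)) = 0"
    if "bounded (range c)" "bounded (range d)" "inj p" "inj q" "\<And>m n. p m \<noteq> q n" "orthosys a" "orthosys b"
    for p q c d a b
    using schmidt_compose[of c "\<lambda>n. e (q n)" b d a "\<lambda>n. e (p n)"] that
      schmidt_subsystem[OF that(1) that(4) that(4)] schmidt_subsystem[OF that(1) that(3) that(3)]
    by (simp add: schmidt_def ee zero)
  have orth: "orthosys (\<lambda>n. e (p n))" if "inj p" for p
    using schmidt_subsystem[OF one that that] by (simp add: schmidt_def)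
  define U V P Q where "U = schmidt_op (\<lambda>n. 1) (\<lambda>n. e n) (\<lambda>n. e (f n))"
    and "V = schmidt_op (\<lambda>n. 1) (\<lambda>n. e n) (\<lambda>n. e (g n))"
    and "P = schmidt_op (\<lambda>n. 1) (\<lambda>n. e (f n)) (\<lambda>n. e n)"
    and "Q = schmidt_op (\<lambda>n. 1) (\<lambda>n. e (g n)) (\<lambda>n. e n)"
  define E F where "E = real_schmidt \<xi> (\<lambda>n. e (f n)) (\<lambda>n. e (f n))"
    and "F = real_schmidt \<xi> (\<lambda>n. e (g n)) (\<lambda>n. e (g n))"
  have split: "diag e (\<lambda>n. \<xi> (n div 2)) = E + F"
    using diag_ampliation_split[OF \<xi>] by (simp add: E_def F_def f_def g_def)
  have BH: "U \<in> carrier BH" "V \<in> carrier BH" "P \<in> carrier BH" "Q \<in> carrier BH"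
    unfolding U_def V_def P_def Q_def by (intro schmidt.in_BH schmidt_subsystem one inj)+
  have mid': "E = U o\<^sub>L diag e \<xi> o\<^sub>L P" "F = V o\<^sub>L diag e \<xi> o\<^sub>L Q"
    unfolding E_def F_def U_def V_def P_def Q_def by (rule mid; rule inj)+
  have same': "P o\<^sub>L (E o\<^sub>L U) = diag e \<xi>" "Q o\<^sub>L (F o\<^sub>L V) = diag e \<xi>"
    unfolding E_def F_def U_def V_def P_def Q_def by (rule same; rule inj)+
  have zero': "F o\<^sub>L U = 0" "E o\<^sub>L V = 0" "P o\<^sub>L F = 0" "Q o\<^sub>L E = 0"
    unfolding E_def F_def U_def V_def P_def Q_def by (rule diff one bd inj fg orth)+
  have zero'': "P o\<^sub>L (F o\<^sub>L Z) = 0" "Q o\<^sub>L (E o\<^sub>L Z) = 0" for Z :: "'h \<Rightarrow>\<^sub>L 'h"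
    by (simp_all only: blinfun_compose_sum(3)[symmetric] zero' blinfun_compose_sum(5))
  show ?thesis
    by (rule that[OF BH])
      (simp_all only: split blinfun_compose_sum same' zero' zero'', simp_all add: mid' blinfun_compose_sum)
qed

text \<open>A single factorization through a diagonal operator instead of a sum of such: sums are
  absorbed by the ampliation, and the s-numbers of a member can be compared directly with one
  sequence of \<open>S\<close>.\<close>

definition ideal_of :: "(nat \<Rightarrow> real) set \<Rightarrow> ('h \<Rightarrow>\<^sub>L 'h) set" where
  "ideal_of S = {A o\<^sub>L diag e \<xi> o\<^sub>L B | A \<xi> B. \<xi> \<in> S \<and> A \<in> carrier BH \<and> B \<in> carrier BH}"

lemma ideal_ofI: "\<xi> \<in> S \<Longrightarrow> A \<in> carrier BH \<Longrightarrow> B \<in> carrier BH \<Longrightarrow> A o\<^sub>L diag e \<xi> o\<^sub>L B \<in> ideal_of S"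
  by (auto simp: ideal_of_def)

lemma diag_in_ideal_of: "\<xi> \<in> S \<Longrightarrow> diag e \<xi> \<in> ideal_of S"
  using ideal_ofI[of \<xi> S id_blinfun id_blinfun] by (simp add: BH_id blinfun_compose_id)

lemma diag_dominated_left:
  assumes \<xi>: "\<xi> \<in> c0_star" and \<zeta>: "\<zeta> \<in> c0_star" "dominated \<xi> \<zeta>"
    and A: "A \<in> carrier BH"
  obtains A' where "A' \<in> carrier BH" "A o\<^sub>L diag e \<xi> = A' o\<^sub>L diag e \<zeta>"
proof -
  obtain W where "W \<in> carrier BH" "diag e \<xi> = W o\<^sub>L diag e \<zeta>"
    by (rule diag_dominated[OF \<zeta>(1) \<xi> \<zeta>(2)])
  then show ?thesis using that[of "A o\<^sub>L W"] A by (simp add: BH_compose blinfun_compose_sum(3))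
qed

text \<open>Both diagonals factor through that of \<zeta>, and two copies of the latter sit inside
  the diagonal of its ampliation. \<open>U\<close>, \<open>V\<close>, \<open>P\<close>,
  \<open>Q\<close> lead into and out of the two copies, and the cross terms vanish.\<close>

lemma ideal_of_add:
  assumes S: "is_char_set S" and "X \<in> ideal_of S" "Y \<in> ideal_of S"
  shows "X + Y \<in> ideal_of S"
proof -
  obtain A \<xi> B where X: "X = A o\<^sub>L diag e \<xi> o\<^sub>L B" "\<xi> \<in> S" "A \<in> carrier BH" "B \<in> carrier BH"
    using assms(2) by (auto simp: ideal_of_def)
  obtain C \<eta> D where Y: "Y = C o\<^sub>L diag e \<eta> o\<^sub>L D" "\<eta> \<in> S" "C \<in> carrier BH" "D \<in> carrier BH"
    using assms(3) by (auto simp: ideal_of_def)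
  define \<zeta> where "\<zeta> n = \<xi> n + \<eta> n" for n
  have "\<zeta> \<in> S" unfolding \<zeta>_def by (rule is_char_setD(2)[OF S X(2) Y(2)])
  note c0 = is_char_setD(1)[OF S X(2)] is_char_setD(1)[OF S Y(2)] is_char_setD(1)[OF S \<open>\<zeta> \<in> S\<close>]
  have "dominated \<xi> \<zeta>" "dominated \<eta> \<zeta>"
    using c0_star_nonneg[OF c0(1)] c0_star_nonneg[OF c0(2)]
    by (auto simp: dominated_def \<zeta>_def intro!: exI[of _ 1])
  then obtain A' C' where A': "A' \<in> carrier BH" "A o\<^sub>L diag e \<xi> = A' o\<^sub>L diag e \<zeta>"
    and C': "C' \<in> carrier BH" "C o\<^sub>L diag e \<eta> = C' o\<^sub>L diag e \<zeta>"
    using diag_dominated_left[OF c0(1) c0(3) _ X(3)] diag_dominated_left[OF c0(2) c0(3) _ Y(3)] by metis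
  let ?d = "diag e (\<lambda>n. \<zeta> (n div 2))"
  obtain U V P Q where BH: "U \<in> carrier BH" "V \<in> carrier BH" "P \<in> carrier BH" "Q \<in> carrier BH"
    and pq: "P o\<^sub>L ?d o\<^sub>L U = diag e \<zeta>" "P o\<^sub>L ?d o\<^sub>L V = 0" "Q o\<^sub>L ?d o\<^sub>L U = 0" "Q o\<^sub>L ?d o\<^sub>L V = diag e \<zeta>"
    by (rule diag_ampliation_factor[OF c0(3)])
  have PQ: "P o\<^sub>L (?d o\<^sub>L (U o\<^sub>L Z)) = diag e \<zeta> o\<^sub>L Z" "P o\<^sub>L (?d o\<^sub>L (V o\<^sub>L Z)) = 0"
      "Q o\<^sub>L (?d o\<^sub>L (U o\<^sub>L Z)) = 0" "Q o\<^sub>L (?d o\<^sub>L (V o\<^sub>L Z)) = diag e \<zeta> o\<^sub>L Z" for Z :: "'h \<Rightarrow>\<^sub>L 'h"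
    by (simp_all only: blinfun_compose_sum(3)[symmetric] pq blinfun_compose_sum(5))
  \<comment> \<open>Since \<open>o\<^sub>L\<close> binds more weakly than \<open>+\<close>, this is
    a product whose outer factors are sums.\<close>
  have "(A' o\<^sub>L P) + (C' o\<^sub>L Q) o\<^sub>L ?d o\<^sub>L ((U o\<^sub>L B) + (V o\<^sub>L D)) \<in> ideal_of S"
    by (intro ideal_ofI is_char_setD(4)[OF S \<open>\<zeta> \<in> S\<close>] BH_add BH_compose BH A'(1) C'(1) X(4) Y(4))
  also have "(A' o\<^sub>L P) + (C' o\<^sub>L Q) o\<^sub>L ?d o\<^sub>L ((U o\<^sub>L B) + (V o\<^sub>L D)) = X + Y"
    unfolding X(1) Y(1) A'(2) C'(2) by (simp add: blinfun_compose_sum PQ)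
  finally show ?thesis .
qed

lemma ideal_of_compose:
  assumes "X \<in> ideal_of S" "Z \<in> carrier BH"
  shows "Z o\<^sub>L X \<in> ideal_of S" "X o\<^sub>L Z \<in> ideal_of S"
proof -
  obtain A \<xi> B where X: "X = A o\<^sub>L diag e \<xi> o\<^sub>L B" "\<xi> \<in> S" "A \<in> carrier BH" "B \<in> carrier BH"
    using assms(1) by (auto simp: ideal_of_def)
  show "Z o\<^sub>L X \<in> ideal_of S"
    using ideal_ofI[OF X(2) BH_compose[OF assms(2) X(3)] X(4)] by (simp add: X(1) blinfun_compose_sum(3))
  show "X o\<^sub>L Z \<in> ideal_of S"
    using ideal_ofI[OF X(2,3) BH_compose[OF X(4) assms(2)]] by (simp add: X(1) blinfun_compose_sum(3))
qed

lemma BH_inv_eq: "X \<in> carrier BH \<Longrightarrow> inv\<^bsub>add_monoid BH\<^esub> X = - (X :: 'h \<Rightarrow>\<^sub>L 'h)"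
proof -
  interpret ring "BH :: ('h \<Rightarrow>\<^sub>L 'h) ring" by (rule ring_BH)
  assume "X \<in> carrier BH"
  then show "inv\<^bsub>add_monoid BH\<^esub> X = - X"
    by (intro group.inv_equality[OF a_group]) (simp_all add: BH_uminus)
qed

theorem op_ideal_ideal_of:
  assumes S: "is_char_set S"
  shows "op_ideal (ideal_of S)"
  unfolding op_ideal_def
proof
  have sub: "diag e \<xi> \<in> compact_operators" if "\<xi> \<in> S" for \<xi>
    by (rule diag_compact[OF is_char_setD(1)[OF S that]])
  then show comp: "ideal_of S \<subseteq> compact_operators"
    by (auto simp: ideal_of_def intro: compact_operators_compose)
  show "ideal (ideal_of S) BH"
  proof (rule idealI[OF ring_BH])
    interpret ring "BH :: ('h \<Rightarrow>\<^sub>L 'h) ring" by (rule ring_BH)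
    show "subgroup (ideal_of S) (add_monoid BH)"
    proof (rule group.subgroupI[OF a_group])
      show "ideal_of S \<subseteq> carrier (add_monoid BH)" using comp compact_operators_BH by auto
      show "ideal_of S \<noteq> {}" using diag_in_ideal_of[OF char_set_zero[OF S]] by blast
      show "X \<otimes>\<^bsub>add_monoid BH\<^esub> Y \<in> ideal_of S" if "X \<in> ideal_of S" "Y \<in> ideal_of S" for X Y
        using ideal_of_add[OF S that] by simp
      show "inv\<^bsub>add_monoid BH\<^esub> X \<in> ideal_of S" if X: "X \<in> ideal_of S" for X
      proof -
        have "X \<in> carrier BH" using X comp compact_operators_BH by blast
        moreover have "(- id_blinfun) o\<^sub>L X = - X" by (intro blinfun_eqI) (simp add: blinfun.minus_left)
        ultimately show ?thesis
          using ideal_of_compose(1)[OF X BH_uminus[OF BH_id]] by (simp only: BH_inv_eq)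
      qed
    qed
  qed (simp_all add: ideal_of_compose)
qed

theorem char_set_ideal_of:
  assumes S: "is_char_set S"
  shows "char_set (ideal_of S) = S"
proof (intro equalityI subsetI)
  fix \<sigma> assume "\<sigma> \<in> char_set (ideal_of S)"
  then obtain X where X: "X \<in> ideal_of S" "\<sigma> = s_numbers X" by (auto simp: char_set_def)
  have "X \<in> compact_operators" using op_ideal_ideal_of[OF S] X(1) by (auto simp: op_ideal_def)
  then obtain A B where \<sigma>: "\<sigma> \<in> c0_star" "diag e \<sigma> = A o\<^sub>L X o\<^sub>L B" "A \<in> carrier BH" "B \<in> carrier BH"
    unfolding X(2) using compact_factorization by metis
  obtain C \<xi> D where C: "X = C o\<^sub>L diag e \<xi> o\<^sub>L D" "\<xi> \<in> S" "D \<in> carrier BH"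
    using X(1) by (auto simp: ideal_of_def)
  have "dominated \<sigma> \<xi>"
    by (rule diag_factor_dominated[OF \<sigma>(1) is_char_setD(1)[OF S C(2)] BH_compose[OF C(3) \<sigma>(4)], of "A o\<^sub>L C"])
      (simp add: \<sigma>(2) C(1) blinfun_compose_sum(3))
  then show "\<sigma> \<in> S" using is_char_setD(3)[OF S C(2) \<sigma>(1)] by simp
next
  fix \<xi> assume "\<xi> \<in> S"
  then show "\<xi> \<in> char_set (ideal_of S)"
    using s_numbers_diag[OF is_char_setD(1)[OF S]] diag_in_ideal_of unfolding char_set_def by (metis image_eqI)
qed

section \<open>Ideals are determined by their characteristic sets\<close>

lemma op_ideal_compose:
  assumes "op_ideal J" "X \<in> J" "A \<in> carrier BH" "B \<in> carrier BH"
  shows "A o\<^sub>L X o\<^sub>L (B :: 'h \<Rightarrow>\<^sub>L 'h) \<in> J"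
  using ideal.I_l_closed[of J BH] ideal.I_r_closed[of J BH] assms unfolding op_ideal_def by fastforce

text \<open>Both directions come from \<open>compact_factorization\<close>. This is the uniqueness
  half of the Calkin correspondence: an ideal is known once its diagonal operators are known, which
  makes \<open>ideal_of_char_set\<close> well defined.\<close>

lemma op_ideal_mem_iff:
  assumes J: "op_ideal J"
  shows "X \<in> J \<longleftrightarrow> X \<in> compact_operators \<and> diag e (s_numbers X) \<in> J"
proof (cases "X \<in> compact_operators")
  case True
  obtain A B A' B' where "A \<in> carrier BH" "B \<in> carrier BH" "A' \<in> carrier BH" "B' \<in> carrier BH"
    "X = A o\<^sub>L diag e (s_numbers X) o\<^sub>L B" "diag e (s_numbers X) = A' o\<^sub>L X o\<^sub>L B'"
    by (rule compact_factorization[OF True])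
  then show ?thesis using True op_ideal_compose[OF J] by metis
qed (use J in \<open>auto simp: op_ideal_def\<close>)

lemma char_set_eq:
  assumes J: "op_ideal J"
  shows "char_set J = {\<xi> \<in> c0_star. diag e \<xi> \<in> J}"
proof (intro equalityI subsetI)
  fix \<xi> assume "\<xi> \<in> char_set J"
  then obtain X where X: "X \<in> J" "\<xi> = s_numbers X" by (auto simp: char_set_def)
  then have "X \<in> compact_operators" using J by (auto simp: op_ideal_def)
  then have "s_numbers X \<in> c0_star" by (rule compact_factorization)
  then show "\<xi> \<in> {\<xi> \<in> c0_star. diag e \<xi> \<in> J}" using X op_ideal_mem_iff[OF J] by blast
next
  fix \<xi> assume "\<xi> \<in> {\<xi> \<in> c0_star. diag e \<xi> \<in> J}"
  then show "\<xi> \<in> char_set J" using s_numbers_diag[of \<xi>] unfolding char_set_def by (intro image_eqI[of _ _ "diag e \<xi>"]) auto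
qed

lemma op_ideal_subset_iff:
  fixes I J :: "('h \<Rightarrow>\<^sub>L 'h) set"
  assumes "op_ideal I" "op_ideal J"
  shows "I \<subseteq> J \<longleftrightarrow> char_set I \<subseteq> char_set J"
proof
  show "I \<subseteq> J \<Longrightarrow> char_set I \<subseteq> char_set J" by (auto simp: char_set_def)
next
  assume sub: "char_set I \<subseteq> char_set J"
  show "I \<subseteq> J"
  proof
    fix X assume X: "X \<in> I"
    then have "s_numbers X \<in> char_set J" using sub by (auto simp: char_set_def)
    moreover have "X \<in> compact_operators" using X assms(1) by (auto simp: op_ideal_def)
    ultimately show "X \<in> J"
      by (subst op_ideal_mem_iff[OF assms(2)]) (simp add: char_set_eq[OF assms(2)])
  qed
qed

lemma op_ideal_eq_iff:
  fixes I J :: "('h \<Rightarrow>\<^sub>L 'h) set"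
  assumes "op_ideal I" "op_ideal J"
  shows "I = J \<longleftrightarrow> char_set I = char_set J"
  using op_ideal_subset_iff[OF assms] op_ideal_subset_iff[OF assms(2,1)] by blast

text \<open>Solidity comes from multiplication by a bounded diagonal operator, closure under
  ampliation from the splitting of \<open>e\<close> into even- and odd-indexed vectors.\<close>

theorem is_char_set_char_set:
  fixes J :: "('h \<Rightarrow>\<^sub>L 'h) set"
  assumes J: "op_ideal J"
  shows "is_char_set (char_set J)"
proof -
  interpret ideal J "BH :: ('h \<Rightarrow>\<^sub>L 'h) ring" using J by (simp add: op_ideal_def)
  note mem = char_set_eq[OF J]
  note add = additive_subgroup.a_closed[OF additive_subgroup_axioms, simplified]
  have "0 \<in> J" using additive_subgroup.zero_closed[OF additive_subgroup_axioms] by simp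
  then have "diag e (\<lambda>n. 0) \<in> J" by (simp add: diag_def zero_blinfun_def)
  then have ne: "(\<lambda>n. 0) \<in> char_set J" by (simp add: mem c0_star_zero)
  have sum: "diag e (\<lambda>n. \<xi> n + \<eta> n) \<in> J" if "\<xi> \<in> char_set J" "\<eta> \<in> char_set J" for \<xi> \<eta>
    using add[of "diag e \<xi>" "diag e \<eta>"] that by (simp add: mem diag_add)
  have dominated: "diag e \<eta> \<in> J" if dom: "\<xi> \<in> char_set J" "\<eta> \<in> c0_star" "dominated \<eta> \<xi>" for \<xi> \<eta>
  proof -
    obtain W where "W \<in> carrier BH" "diag e \<eta> = W o\<^sub>L diag e \<xi>"
      by (rule diag_dominated[of \<xi> \<eta>]) (use dom in \<open>auto simp: mem\<close>)
    then show ?thesis using I_l_closed[of "diag e \<xi>" W] dom(1) by (simp add: mem)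
  qed
  have ampliation: "diag e (\<lambda>n. \<xi> (n div 2)) \<in> J" if \<xi>: "\<xi> \<in> char_set J" for \<xi>
  proof -
    have "\<xi> \<in> c0_star" "diag e \<xi> \<in> J" using \<xi> by (auto simp: mem)
    then obtain U V P Q where "U \<in> carrier BH" "V \<in> carrier BH" "P \<in> carrier BH" "Q \<in> carrier BH"
      "diag e (\<lambda>n. \<xi> (n div 2)) = (U o\<^sub>L diag e \<xi> o\<^sub>L P) + (V o\<^sub>L diag e \<xi> o\<^sub>L Q)"
      using diag_ampliation_factor by metis
    then show ?thesis by (simp only:) (intro add op_ideal_compose[OF J \<open>diag e \<xi> \<in> J\<close>])
  qed
  have sub: "\<xi> \<in> c0_star" if "\<xi> \<in> char_set J" for \<xi> using that by (simp add: mem)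
  show ?thesis
    unfolding is_char_set_def
  proof (intro conjI ballI impI)
    show "char_set J \<subseteq> c0_star" "char_set J \<noteq> {}" using ne sub by blast+
    show "(\<lambda>n. \<xi> n + \<eta> n) \<in> char_set J" if "\<xi> \<in> char_set J" "\<eta> \<in> char_set J" for \<xi> \<eta>
      using sum[OF that] c0_star_add[OF sub[OF that(1)] sub[OF that(2)]] by (simp add: mem)
    show "\<eta> \<in> char_set J" if "\<xi> \<in> char_set J" "\<eta> \<in> c0_star" "dominated \<eta> \<xi>" for \<xi> \<eta>
      using dominated[OF that] that(2) by (simp add: mem)
    show "(\<lambda>n. \<xi> (n div 2)) \<in> char_set J" if "\<xi> \<in> char_set J" for \<xi>
      using ampliation[OF that] c0_star_ampliation[OF sub[OF that], of 2] by (simp add: mem)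
  qed
qed

lemma ideal_of_char_set_eq: "is_char_set S \<Longrightarrow> ideal_of_char_set S = ideal_of S"
  unfolding ideal_of_char_set_def
proof (rule the_equality)
  assume S: "is_char_set S"
  then show "op_ideal (ideal_of S) \<and> char_set (ideal_of S) = S"
    using op_ideal_ideal_of char_set_ideal_of by blast
  show "I = ideal_of S" if "op_ideal I \<and> char_set I = S" for I
    using that op_ideal_eq_iff[OF _ op_ideal_ideal_of[OF S]] char_set_ideal_of[OF S] by blast
qed

lemma ideal_of_char_set:
  assumes "is_char_set S"
  shows "op_ideal (ideal_of_char_set S :: ('h \<Rightarrow>\<^sub>L 'h) set)"
    and "char_set (ideal_of_char_set S :: ('h \<Rightarrow>\<^sub>L 'h) set) = S"
  using op_ideal_ideal_of[OF assms] char_set_ideal_of[OF assms] by (simp_all add: ideal_of_char_set_eq[OF assms])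

text \<open>One inclusion is minimality of the generated ideal, compared with
  \<open>ideal_of\<close>; the other is minimality of the principal characteristic set.\<close>

theorem principal_ideal:
  assumes \<xi>: "\<xi> \<in> c0_star"
  shows "op_ideal (principal_ideal e \<xi>)" and "char_set (principal_ideal e \<xi>) = principal_char_set \<xi>"
proof -
  interpret ring "BH :: ('h \<Rightarrow>\<^sub>L 'h) ring" by (rule ring_BH)
  note P = is_char_set_principal[OF \<xi>]
  have sub: "principal_ideal e \<xi> \<subseteq> ideal_of (principal_char_set \<xi>)"
    unfolding principal_ideal_def
    using op_ideal_ideal_of[OF P] diag_in_ideal_of[OF principal_char_set_self[OF \<xi>]]
    by (intro genideal_minimal) (auto simp: op_ideal_def)
  then show op: "op_ideal (principal_ideal e \<xi>)"
    using op_ideal_ideal_of[OF P] genideal_ideal[of "{diag e \<xi>}"] diag_BH[OF \<xi>]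
    by (auto simp: op_ideal_def principal_ideal_def)
  have "diag e \<xi> \<in> principal_ideal e \<xi>"
    unfolding principal_ideal_def by (rule genideal_self'[OF diag_BH[OF \<xi>]])
  then have "\<xi> \<in> char_set (principal_ideal e \<xi>)" by (simp add: char_set_eq[OF op] \<xi>)
  then have "principal_char_set \<xi> \<subseteq> char_set (principal_ideal e \<xi>)"
    using principal_char_set_least[OF is_char_set_char_set[OF op] \<xi>] by simp
  moreover have "char_set (principal_ideal e \<xi>) \<subseteq> principal_char_set \<xi>"
    using op_ideal_subset_iff[OF op op_ideal_ideal_of[OF P]] sub char_set_ideal_of[OF P] by simp
  ultimately show "char_set (principal_ideal e \<xi>) = principal_char_set \<xi>" by simp
qed

end

section \<open>Arithmetic means of sequences\<close>

text \<open>The name refers to \<open>(n + 1) * \<kappa> n\<close>, not to \<kappa>: a nondecreasing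
  function whose quotient by its argument is nonincreasing is called quasiconcave in interpolation
  theory, and it is equivalent to a concave one.\<close>

definition quasiconcave :: "(nat \<Rightarrow> real) \<Rightarrow> bool" where
  "quasiconcave \<kappa> \<longleftrightarrow> \<kappa> \<in> c0_star \<and> mono (\<lambda>n. real (Suc n) * \<kappa> n)"

lemma quasiconcave_le:
  assumes "quasiconcave \<kappa>" "m \<le> n"
  shows "real (Suc m) * \<kappa> m \<le> real (Suc n) * \<kappa> n"
  using assms monoD[of "\<lambda>n. real (Suc n) * \<kappa> n" m n] unfolding quasiconcave_def by blast

lemma Suc_le_ampliation: "Suc n \<le> 2 ^ k * Suc (n div 2 ^ k)"
proof -
  have "n mod 2 ^ k < (2 :: nat) ^ k" by simp
  moreover have "n = 2 ^ k * (n div 2 ^ k) + n mod 2 ^ k" by simp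
  ultimately show ?thesis by (metis add_less_le_mono add_mult_distrib2 Suc_leI mult_Suc_right nat_add_left_cancel_less add.commute)
qed

lemma real_Suc_le_ampliation: "real (Suc n) \<le> 2 ^ k * real (Suc (n div 2 ^ k))"
proof -
  have "real (Suc n) \<le> real (2 ^ k * Suc (n div 2 ^ k))"
    by (rule of_nat_mono[OF Suc_le_ampliation])
  then show ?thesis by (simp only: of_nat_mult of_nat_power of_nat_numeral)
qed

text \<open>Passing from \<open>n div 2 ^ k\<close> to \<open>n\<close> does not decrease
  \<open>(n + 1) * \<kappa> n\<close>, while \<open>n + 1\<close> grows at most by the factor
  \<open>2 ^ k\<close>. This is why ampliations can be absorbed into constants on the side of
  ordinary means.\<close>

lemma quasiconcave_ampliation_le:
  assumes "quasiconcave \<kappa>"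
  shows "\<kappa> (n div 2 ^ k) \<le> 2 ^ k * \<kappa> n"
proof -
  let ?m = "n div 2 ^ k"
  have "\<kappa> n \<ge> 0" using assms c0_star_nonneg by (auto simp: quasiconcave_def)
  have "real (Suc ?m) * \<kappa> ?m \<le> real (Suc n) * \<kappa> n"
    by (rule quasiconcave_le[OF assms]) simp
  also have "\<dots> \<le> (2 ^ k * real (Suc ?m)) * \<kappa> n"
    by (rule mult_right_mono[OF real_Suc_le_ampliation \<open>\<kappa> n \<ge> 0\<close>])
  finally have "real (Suc ?m) * \<kappa> ?m \<le> real (Suc ?m) * (2 ^ k * \<kappa> n)" by (simp only: mult_ac)
  then show ?thesis by (rule mult_left_le_imp_le) simp
qed

lemma am_seq_mult: "real (Suc n) * am_seq \<xi> n = (\<Sum>j\<le>n. \<xi> j)"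
  by (simp add: am_seq_def)

lemma am_seq_add: "am_seq (\<lambda>n. \<xi> n + \<eta> n) n = am_seq \<xi> n + am_seq \<eta> n"
  by (simp add: am_seq_def sum.distrib add_divide_distrib)

lemma am_seq_mono_mult: "(\<And>n. \<xi> n \<le> M * \<eta> n) \<Longrightarrow> am_seq \<xi> n \<le> M * am_seq \<eta> n"
  by (simp add: am_seq_def divide_right_mono sum_distrib_left sum_mono)

lemma am_seq_ge:
  assumes "decseq \<xi>"
  shows "\<xi> n \<le> am_seq \<xi> n"
proof -
  have "(\<Sum>j\<le>n. \<xi> n) \<le> (\<Sum>j\<le>n. \<xi> j)"
    using assms by (intro sum_mono) (simp add: decseq_def)
  then show ?thesis by (simp add: am_seq_def field_simps)
qed

lemma am_seq_quasiconcave: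
  assumes \<xi>: "\<xi> \<in> c0_star"
  shows "quasiconcave (am_seq \<xi>)"
proof -
  have nn: "0 \<le> am_seq \<xi> n" for n
    unfolding am_seq_def using c0_star_nonneg[OF \<xi>] by (intro divide_nonneg_nonneg sum_nonneg) auto
  have dec: "am_seq \<xi> (Suc n) \<le> am_seq \<xi> n" for n
  proof -
    have "\<xi> (Suc n) \<le> am_seq \<xi> n"
      using c0_star_antimono[OF \<xi>, of n "Suc n"] am_seq_ge[OF c0_star_decseq[OF \<xi>], of n] by simp
    then have "real (Suc n) * am_seq \<xi> n + \<xi> (Suc n) \<le> real (Suc (Suc n)) * am_seq \<xi> n"
      by (simp add: algebra_simps)
    then have "real (Suc (Suc n)) * am_seq \<xi> (Suc n) \<le> real (Suc (Suc n)) * am_seq \<xi> n"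
      by (simp only: am_seq_mult sum.atMost_Suc)
    then show ?thesis by (rule mult_left_le_imp_le) simp
  qed
  have "am_seq \<xi> \<longlonglongrightarrow> 0"
  proof (rule LIMSEQ_I)
    fix r :: real assume r: "0 < r"
    then have "\<forall>\<^sub>F n in sequentially. \<xi> n < r / 2"
      using c0_star_tendsto[OF \<xi>] by (intro order_tendstoD(2)) auto
    then obtain N where N: "\<And>n. n \<ge> N \<Longrightarrow> \<xi> n < r / 2" by (auto simp: eventually_sequentially)
    define C where "C = (\<Sum>j<N. \<xi> j)"
    obtain N' where N': "C < real N' * (r / 2)" using reals_Archimedean3[of "r / 2"] r by auto
    show "\<exists>N. \<forall>n\<ge>N. norm (am_seq \<xi> n - 0) < r"
    proof (intro exI allI impI)
      fix n assume n: "max N N' \<le> n"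
      have "(\<Sum>j\<le>n. \<xi> j) = (\<Sum>j<N. \<xi> j) + (\<Sum>j=N..n. \<xi> j)"
        using n by (subst sum.union_disjoint[symmetric]) (auto intro!: sum.cong)
      also have "(\<Sum>j=N..n. \<xi> j) \<le> (\<Sum>j=N..n. r / 2)"
        using N by (intro sum_mono less_imp_le) auto
      also have "\<dots> \<le> real (Suc n) * (r / 2)" using r by (simp add: mult_right_mono)
      finally have "real (Suc n) * am_seq \<xi> n \<le> C + real (Suc n) * (r / 2)"
        by (simp only: am_seq_mult C_def)
      moreover have "real N' * (r / 2) \<le> real (Suc n) * (r / 2)"
        using n r by (intro mult_right_mono) auto
      ultimately have "real (Suc n) * am_seq \<xi> n < real (Suc n) * (r / 2) + real (Suc n) * (r / 2)"
        using N' by linarith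
      also have "\<dots> = real (Suc n) * r" by (simp only: distrib_left[symmetric] field_sum_of_halves)
      finally have "real (Suc n) * am_seq \<xi> n < real (Suc n) * r" .
      then have "am_seq \<xi> n < r" by (rule mult_left_less_imp_less) simp
      then show "norm (am_seq \<xi> n - 0) < r" using nn[of n] by simp
    qed
  qed
  moreover have "mono (\<lambda>n. real (Suc n) * am_seq \<xi> n)"
    unfolding am_seq_mult mono_iff_le_Suc using c0_star_nonneg[OF \<xi>] by simp
  ultimately show ?thesis
    using nn dec by (simp add: quasiconcave_def c0_star_def decseq_Suc_iff)
qed

lemma am_seq_c0_star: "\<xi> \<in> c0_star \<Longrightarrow> am_seq \<xi> \<in> c0_star"
  using am_seq_quasiconcave by (simp add: quasiconcave_def)

lemma sum_ampliation: "(\<Sum>j<2 * n. \<xi> (j div 2)) = 2 * (\<Sum>i<n. \<xi> i :: real)" for n :: nat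
  by (induction n) simp_all

lemma am_seq_ampliation_le:
  assumes \<xi>: "\<xi> \<in> c0_star"
  shows "am_seq (\<lambda>n. \<xi> (n div 2)) n \<le> 2 * am_seq \<xi> (n div 2)"
proof -
  have "(\<Sum>j\<le>n. \<xi> (j div 2)) \<le> (\<Sum>j<2 * Suc (n div 2). \<xi> (j div 2))"
    using c0_star_nonneg[OF \<xi>] by (intro sum_mono2) auto
  also have "\<dots> = 2 * (\<Sum>i\<le>n div 2. \<xi> i)"
    unfolding sum_ampliation by (simp only: lessThan_Suc_atMost)
  finally have "(\<Sum>j\<le>n. \<xi> (j div 2)) \<le> 2 * (\<Sum>i\<le>n div 2. \<xi> i)" .
  then have "(\<Sum>j\<le>n. \<xi> (j div 2)) / real (Suc n) \<le> 2 * (\<Sum>i\<le>n div 2. \<xi> i) / real (Suc (n div 2))"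
    using c0_star_nonneg[OF \<xi>] by (intro frac_le) (auto intro!: sum_nonneg)
  then show ?thesis by (simp add: am_seq_def)
qed

lemma quasiconcave_equiv_am_seq:
  assumes \<kappa>: "quasiconcave \<kappa>"
  obtains \<eta> where "\<eta> \<in> c0_star" "\<And>n. \<kappa> n \<le> am_seq \<eta> n" "\<And>n. am_seq \<eta> n \<le> 2 * \<kappa> n"
proof -
  txt \<open>The increments of a concave function within a factor 2 of \<open>(n + 1) \<kappa> n\<close>.\<close>
  define \<phi> where "\<phi> m = real (Suc m) * \<kappa> m" for m
  have \<kappa>0: "\<kappa> \<in> c0_star" using \<kappa> by (simp add: quasiconcave_def)
  have \<phi>0: "0 \<le> \<phi> m" for m using c0_star_nonneg[OF \<kappa>0] by (simp add: \<phi>_def)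
  \<comment> \<open>Each \<open>m\<close> contributes an affine function of \<open>n\<close> that
    majorizes \<phi>: for \<open>n \<le> m\<close> because \<phi> increases, for
    \<open>n > m\<close> because \<kappa> decreases. An infimum of affine functions is concave, and
    \<open>m = n\<close> gives the factor 2.\<close>
  define F where "F n = (INF m. \<phi> m * (1 + real (Suc n) / real (Suc m)))" for n
  have bdd: "bdd_below (range (\<lambda>m. \<phi> m * (1 + real (Suc n) / real (Suc m))))" for n
    by (rule bdd_belowI[of _ 0]) (auto intro!: mult_nonneg_nonneg \<phi>0)
  have F_le: "F n \<le> \<phi> m * (1 + real (Suc n) / real (Suc m))" for m n
    unfolding F_def by (rule cINF_lower[OF bdd]) simp
  have F_ge: "c \<le> F n" if "\<And>m. c \<le> \<phi> m * (1 + real (Suc n) / real (Suc m))" for c n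
    unfolding F_def by (rule cINF_greatest) (use that in auto)
  have low: "\<phi> n \<le> F n" for n
  proof (rule F_ge)
    fix m show "\<phi> n \<le> \<phi> m * (1 + real (Suc n) / real (Suc m))"
    proof (cases "n \<le> m")
      case True
      have "\<phi> n \<le> \<phi> m * 1" using quasiconcave_le[OF \<kappa> True] by (simp add: \<phi>_def)
      also have "\<dots> \<le> \<phi> m * (1 + real (Suc n) / real (Suc m))" by (rule mult_left_mono[OF _ \<phi>0]) simp
      finally show ?thesis .
    next
      case False
      have "\<phi> n \<le> real (Suc n) * \<kappa> m"
        using c0_star_antimono[OF \<kappa>0, of m n] False by (simp add: \<phi>_def mult_left_mono)
      also have "\<dots> = \<phi> m * (real (Suc n) / real (Suc m))" by (simp add: \<phi>_def)
      also have "\<dots> \<le> \<phi> m * (1 + real (Suc n) / real (Suc m))" by (rule mult_left_mono[OF _ \<phi>0]) simp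
      finally show ?thesis .
    qed
  qed
  have upp: "F n \<le> 2 * \<phi> n" for n using F_le[of n n] by simp
  define \<eta> where "\<eta> n = (case n of 0 \<Rightarrow> F 0 | Suc k \<Rightarrow> F (Suc k) - F k)" for n
  have sum_\<eta>: "(\<Sum>j\<le>n. \<eta> j) = F n" for n by (induction n) (simp_all add: \<eta>_def)
  have F_mono: "F n \<le> F (Suc n)" for n
  proof (rule F_ge)
    fix m
    have "F n \<le> \<phi> m * (1 + real (Suc n) / real (Suc m))" by (rule F_le)
    also have "\<dots> \<le> \<phi> m * (1 + real (Suc (Suc n)) / real (Suc m))"
      by (intro mult_left_mono \<phi>0 add_left_mono divide_right_mono) auto
    finally show "F n \<le> \<phi> m * (1 + real (Suc (Suc n)) / real (Suc m))" .
  qed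
  have "0 \<le> \<eta> n" for n
    using F_mono order_trans[OF \<phi>0 low] by (cases n) (simp_all add: \<eta>_def)
  moreover have dec: "decseq \<eta>"
    unfolding decseq_Suc_iff
  proof
    fix n show "\<eta> (Suc n) \<le> \<eta> n"
    proof (cases n)
      \<comment> \<open>The first increment is \<open>F 0\<close> itself, so the claim is
        \<open>F 1 \<le> 2 * F 0\<close>: concavity at 0 of the extension of \<open>F\<close> by the
        value 0 on the left.\<close>
      case 0
      have "F 1 / 2 \<le> F 0"
      proof (rule F_ge)
        fix m
        have "\<phi> m * (1 + real (Suc 1) / real (Suc m)) \<le> \<phi> m * (2 * (1 + real (Suc 0) / real (Suc m)))"
          by (intro mult_left_mono \<phi>0) simp
        then show "F 1 / 2 \<le> \<phi> m * (1 + real (Suc 0) / real (Suc m))"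
          using F_le[of 1 m] unfolding mult.left_commute[of "\<phi> m" 2] by linarith
      qed
      then show ?thesis by (simp add: 0 \<eta>_def)
    next
      case (Suc k)
      have "(F (Suc (Suc k)) + F k) / 2 \<le> F (Suc k)"
      proof (rule F_ge)
        fix m
        have "\<phi> m * (1 + real (Suc (Suc (Suc k))) / real (Suc m)) + \<phi> m * (1 + real (Suc k) / real (Suc m))
            = 2 * (\<phi> m * (1 + real (Suc (Suc k)) / real (Suc m)))"
          unfolding divide_inverse of_nat_Suc by (simp add: algebra_simps)
        then show "(F (Suc (Suc k)) + F k) / 2 \<le> \<phi> m * (1 + real (Suc (Suc k)) / real (Suc m))"
          using F_le[of "Suc (Suc k)" m] F_le[of k m] by simp
      qed
      then show ?thesis by (simp add: Suc \<eta>_def)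
    qed
  qed
  moreover have am: "am_seq \<eta> n = F n / real (Suc n)" for n by (simp only: am_seq_def sum_\<eta>)
  have 1: "\<kappa> n \<le> am_seq \<eta> n" and 2: "am_seq \<eta> n \<le> 2 * \<kappa> n" for n
    using low[of n] upp[of n] unfolding am by (simp_all add: \<phi>_def field_simps)
  \<comment> \<open>The terms of a nonincreasing sequence lie below their means, here below
    \<open>2 * \<kappa> n\<close>.\<close>
  moreover have "\<eta> \<longlonglongrightarrow> 0"
  proof (rule tendsto_sandwich[of "\<lambda>_. 0" _ _ "\<lambda>n. 2 * \<kappa> n"])
    show "\<forall>\<^sub>F n in sequentially. \<eta> n \<le> 2 * \<kappa> n"
      using am_seq_ge[OF dec] 2 order_trans by (intro always_eventually allI) blast
    show "(\<lambda>n. 2 * \<kappa> n) \<longlonglongrightarrow> 0" using tendsto_mult_right_zero[OF c0_star_tendsto[OF \<kappa>0]] .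
  qed (use calculation(1) in auto)
  ultimately show ?thesis using that[of \<eta>] by (simp add: c0_star_def)
qed

section \<open>Mean operations on characteristic sets\<close>

definition pre_am_set :: "(nat \<Rightarrow> real) set \<Rightarrow> (nat \<Rightarrow> real) set" where
  "pre_am_set S = {\<xi> \<in> c0_star. am_seq \<xi> \<in> S}"

definition am_set :: "(nat \<Rightarrow> real) set \<Rightarrow> (nat \<Rightarrow> real) set" where
  "am_set S = {\<xi> \<in> c0_star. \<exists>\<eta>\<in>S. dominated \<xi> (am_seq \<eta>)}"

text \<open>The characteristic set of the am-interior, with means replaced by the equivalent
  quasiconcave sequences, for which monotone envelopes can be formed.\<close>

definition interior_set :: "(nat \<Rightarrow> real) set \<Rightarrow> (nat \<Rightarrow> real) set" where
  "interior_set S = {\<xi> \<in> c0_star. \<exists>\<kappa>\<in>S. quasiconcave \<kappa> \<and> dominated \<xi> \<kappa>}"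

lemma is_char_setI:
  assumes "\<And>\<xi>. \<xi> \<in> S \<Longrightarrow> \<xi> \<in> c0_star" "\<xi>\<^sub>0 \<in> S"
    "\<And>\<xi> \<eta>. \<xi> \<in> S \<Longrightarrow> \<eta> \<in> S \<Longrightarrow> (\<lambda>n. \<xi> n + \<eta> n) \<in> S"
    "\<And>\<xi> \<eta>. \<xi> \<in> S \<Longrightarrow> \<eta> \<in> c0_star \<Longrightarrow> dominated \<eta> \<xi> \<Longrightarrow> \<eta> \<in> S"
    "\<And>\<xi>. \<xi> \<in> S \<Longrightarrow> (\<lambda>n. \<xi> (n div 2)) \<in> S"
  shows "is_char_set S"
  unfolding is_char_set_def using assms by blast

lemma dominated_refl: "dominated \<xi> \<xi>"
  unfolding dominated_def by (rule exI[of _ 1]) simp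

lemma dominatedI: "(\<And>n. \<xi> n \<le> M * \<eta> n) \<Longrightarrow> dominated \<xi> \<eta>"
  by (auto simp: dominated_def)

lemma dominated_trans:
  assumes "dominated \<xi> \<eta>" "dominated \<eta> \<zeta>" "\<And>n. 0 \<le> \<eta> n"
  shows "dominated \<xi> \<zeta>"
proof -
  obtain M where M: "M > 0" "\<And>n. \<xi> n \<le> M * \<eta> n" using dominated_pos[OF assms(1,3)] by metis
  obtain N where N: "\<And>n. \<eta> n \<le> N * \<zeta> n" using assms(2) by (auto simp: dominated_def)
  show ?thesis
    by (rule dominatedI[of _ "M * N"])
      (use order_trans[OF M(2) mult_left_mono[OF N]] M(1) in \<open>simp add: mult.assoc\<close>)
qed

lemma dominated_add:
  assumes "dominated \<xi> \<zeta>" "dominated \<eta> \<theta>" "\<And>n. 0 \<le> \<zeta> n" "\<And>n. 0 \<le> \<theta> n"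
  shows "dominated (\<lambda>n. \<xi> n + \<eta> n) (\<lambda>n. \<zeta> n + \<theta> n)"
proof -
  obtain M where M: "M > 0" "\<And>n. \<xi> n \<le> M * \<zeta> n" using dominated_pos[OF assms(1,3)] by metis
  obtain N where N: "N > 0" "\<And>n. \<eta> n \<le> N * \<theta> n" using dominated_pos[OF assms(2,4)] by metis
  show ?thesis
  proof (rule dominatedI)
    fix n
    have "M * \<zeta> n \<le> (M + N) * \<zeta> n" "N * \<theta> n \<le> (M + N) * \<theta> n"
      using M(1) N(1) assms(3,4) by (auto intro!: mult_right_mono)
    with M(2)[of n] N(2)[of n] show "\<xi> n + \<eta> n \<le> (M + N) * (\<zeta> n + \<theta> n)"
      by (simp add: distrib_left)
  qed
qed

lemma is_char_set_pre_am_set: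
  assumes S: "is_char_set S"
  shows "is_char_set (pre_am_set S)"
proof (rule is_char_setI)
  show "(\<lambda>n. 0) \<in> pre_am_set S"
    using char_set_zero[OF S] by (simp add: pre_am_set_def c0_star_zero am_seq_def[abs_def])
  show "(\<lambda>n. \<xi> n + \<eta> n) \<in> pre_am_set S" if "\<xi> \<in> pre_am_set S" "\<eta> \<in> pre_am_set S" for \<xi> \<eta>
    using that is_char_setD(2)[OF S, of "am_seq \<xi>" "am_seq \<eta>"]
    by (simp add: pre_am_set_def c0_star_add am_seq_add[abs_def])
  show "\<eta> \<in> pre_am_set S" if "\<xi> \<in> pre_am_set S" "\<eta> \<in> c0_star" "dominated \<eta> \<xi>" for \<xi> \<eta>
  proof -
    have "dominated (am_seq \<eta>) (am_seq \<xi>)"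
      using that(3) unfolding dominated_def by (metis am_seq_mono_mult)
    then show ?thesis
      using that is_char_setD(3)[OF S _ am_seq_c0_star] by (auto simp: pre_am_set_def)
  qed
  show "(\<lambda>n. \<xi> (n div 2)) \<in> pre_am_set S" if "\<xi> \<in> pre_am_set S" for \<xi>
  proof -
    have \<xi>: "\<xi> \<in> c0_star" "am_seq \<xi> \<in> S" using that by (auto simp: pre_am_set_def)
    have D: "(\<lambda>n. \<xi> (n div 2)) \<in> c0_star" by (rule c0_star_ampliation[OF \<xi>(1)]) simp
    have "dominated (am_seq (\<lambda>n. \<xi> (n div 2))) (\<lambda>n. am_seq \<xi> (n div 2))"
      by (rule dominatedI[OF am_seq_ampliation_le[OF \<xi>(1)]])
    then show ?thesis
      using is_char_setD(3)[OF S is_char_setD(4)[OF S \<xi>(2)] am_seq_c0_star[OF D]] D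
      by (simp add: pre_am_set_def)
  qed
qed (simp add: pre_am_set_def)

lemma is_char_set_am_set:
  assumes S: "is_char_set S"
  shows "is_char_set (am_set S)"
proof (rule is_char_setI)
  have nn: "0 \<le> am_seq \<zeta> n" if "\<zeta> \<in> S" for \<zeta> n
    by (rule c0_star_nonneg[OF am_seq_c0_star[OF is_char_setD(1)[OF S that]]])
  show "(\<lambda>n. 0) \<in> am_set S"
    using char_set_zero[OF S] by (auto simp: am_set_def c0_star_zero dominated_def intro!: exI[of _ 0])
  show "(\<lambda>n. \<xi> n + \<eta> n) \<in> am_set S" if mem: "\<xi> \<in> am_set S" "\<eta> \<in> am_set S" for \<xi> \<eta>
  proof -
    obtain \<zeta> \<theta> where z: "\<zeta> \<in> S" "dominated \<xi> (am_seq \<zeta>)" "\<theta> \<in> S" "dominated \<eta> (am_seq \<theta>)"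
      using mem by (auto simp: am_set_def)
    have "dominated (\<lambda>n. \<xi> n + \<eta> n) (am_seq (\<lambda>n. \<zeta> n + \<theta> n))"
      using dominated_add[OF z(2,4) nn[OF z(1)] nn[OF z(3)]] by (simp add: am_seq_add[abs_def])
    then show ?thesis using mem is_char_setD(2)[OF S z(1,3)] by (auto simp: am_set_def c0_star_add)
  qed
  show "\<eta> \<in> am_set S" if "\<xi> \<in> am_set S" "\<eta> \<in> c0_star" "dominated \<eta> \<xi>" for \<xi> \<eta>
    using that dominated_trans[OF that(3)] c0_star_nonneg by (fastforce simp: am_set_def)
  show "(\<lambda>n. \<xi> (n div 2)) \<in> am_set S" if mem: "\<xi> \<in> am_set S" for \<xi>
  proof -
    obtain \<zeta> where \<zeta>: "\<zeta> \<in> S" "dominated \<xi> (am_seq \<zeta>)" using mem by (auto simp: am_set_def)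
    obtain M where M: "M > 0" "\<And>n. \<xi> n \<le> M * am_seq \<zeta> n" using dominated_pos[OF \<zeta>(2) nn[OF \<zeta>(1)]] by metis
    have "\<xi> (n div 2) \<le> (M * 2) * am_seq \<zeta> n" for n
    proof -
      have "am_seq \<zeta> (n div 2) \<le> 2 * am_seq \<zeta> n"
        using quasiconcave_ampliation_le[OF am_seq_quasiconcave[OF is_char_setD(1)[OF S \<zeta>(1)]], of n 1] by simp
      then have "M * am_seq \<zeta> (n div 2) \<le> M * (2 * am_seq \<zeta> n)"
        using M(1) by (intro mult_left_mono) auto
      then show ?thesis using M(2)[of "n div 2"] by (simp add: mult.assoc)
    qed
    then have "dominated (\<lambda>n. \<xi> (n div 2)) (am_seq \<zeta>)" by (rule dominatedI)
    then show ?thesis using mem \<zeta>(1) by (auto simp: am_set_def c0_star_ampliation)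
  qed
qed (simp add: am_set_def)

text \<open>Means are quasiconcave; conversely, a quasiconcave sequence lies between constant
  multiples of a mean by \<open>quasiconcave_equiv_am_seq\<close>.\<close>

theorem am_set_pre_am_set:
  assumes S: "is_char_set S"
  shows "am_set (pre_am_set S) = interior_set S"
proof (intro equalityI subsetI)
  fix \<xi> assume "\<xi> \<in> am_set (pre_am_set S)"
  then show "\<xi> \<in> interior_set S"
    using am_seq_quasiconcave by (auto simp: am_set_def pre_am_set_def interior_set_def)
next
  fix \<xi> assume "\<xi> \<in> interior_set S"
  then obtain \<kappa> where \<kappa>: "\<xi> \<in> c0_star" "\<kappa> \<in> S" "quasiconcave \<kappa>" "dominated \<xi> \<kappa>"
    by (auto simp: interior_set_def)
  obtain \<eta> where \<eta>: "\<eta> \<in> c0_star" "\<And>n. \<kappa> n \<le> am_seq \<eta> n" "\<And>n. am_seq \<eta> n \<le> 2 * \<kappa> n"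
    by (rule quasiconcave_equiv_am_seq[OF \<kappa>(3)]) blast
  have "am_seq \<eta> \<in> S"
    by (rule is_char_setD(3)[OF S \<kappa>(2) am_seq_c0_star[OF \<eta>(1)] dominatedI[OF \<eta>(3)]])
  moreover have "dominated \<kappa> (am_seq \<eta>)" using \<eta>(2) by (intro dominatedI[of _ 1]) simp
  then have "dominated \<xi> (am_seq \<eta>)"
    using dominated_trans[OF \<kappa>(4)] c0_star_nonneg[OF is_char_setD(1)[OF S \<kappa>(2)]] by blast
  ultimately show "\<xi> \<in> am_set (pre_am_set S)" using \<kappa>(1) \<eta>(1) by (auto simp: am_set_def pre_am_set_def)
qed

section \<open>Arithmetic means at infinity of sequences\<close>

text \<open>Modelled on tails: \<open>(n + 1) * am_inf_seq \<xi> n\<close> is the sum of the terms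
  of \<xi> after \<open>n\<close>, so it decreases to 0. The limit condition excludes
  \<open>omega\<close>, for which the product is constantly 1.\<close>

definition quasiconvex :: "(nat \<Rightarrow> real) \<Rightarrow> bool" where
  "quasiconvex \<kappa> \<longleftrightarrow> \<kappa> \<in> c0_star \<and> decseq (\<lambda>n. real (Suc n) * \<kappa> n) \<and> (\<lambda>n. real (Suc n) * \<kappa> n) \<longlonglongrightarrow> 0"

lemma quasiconvex_le:
  assumes "quasiconvex \<kappa>" "m \<le> n"
  shows "real (Suc n) * \<kappa> n \<le> real (Suc m) * \<kappa> m"
  using assms decseqD[of "\<lambda>n. real (Suc n) * \<kappa> n" m n] unfolding quasiconvex_def by blast

lemma quasiconvexI:
  assumes "\<And>n. 0 \<le> \<phi> n" "decseq \<phi>" "\<phi> \<longlonglongrightarrow> 0"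
  shows "quasiconvex (\<lambda>n. \<phi> n / real (Suc n))"
proof -
  have dec: "decseq (\<lambda>n. \<phi> n / real (Suc n))"
    unfolding decseq_def using assms(1,2) by (auto simp: decseq_def intro!: frac_le)
  have "(\<lambda>n. \<phi> n / real (Suc n)) \<longlonglongrightarrow> 0"
  proof (rule tendsto_sandwich[of "\<lambda>_. 0" _ _ \<phi>])
    show "\<forall>\<^sub>F n in sequentially. \<phi> n / real (Suc n) \<le> \<phi> n"
      using mult_left_mono[of 1 "real (Suc _)", OF _ assms(1)]
      by (intro always_eventually allI) (simp add: divide_le_eq)
  qed (use assms in auto)
  then show ?thesis
    using dec assms by (simp add: quasiconvex_def c0_star_def)
qed

definition tail :: "(nat \<Rightarrow> real) \<Rightarrow> nat \<Rightarrow> real" where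
  "tail \<xi> n = (\<Sum>j. \<xi> (j + n))"

lemma am_inf_seq_tail: "am_inf_seq \<xi> n = tail \<xi> (Suc n) / real (Suc n)"
  by (simp add: am_inf_seq_def tail_def)

lemma l1_starD: "\<xi> \<in> l1_star \<Longrightarrow> \<xi> \<in> c0_star" "\<xi> \<in> l1_star \<Longrightarrow> summable \<xi>"
  by (auto simp: l1_star_def)

lemma tail_nonneg: "\<xi> \<in> l1_star \<Longrightarrow> 0 \<le> tail \<xi> n"
  unfolding tail_def
  by (intro suminf_nonneg summable_ignore_initial_segment l1_starD c0_star_nonneg)

lemma tail_Suc:
  assumes "\<xi> \<in> l1_star"
  shows "tail \<xi> n = \<xi> n + tail \<xi> (Suc n)"
  using suminf_split_head[OF summable_ignore_initial_segment[OF l1_starD(2)[OF assms]], of n]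
  by (simp add: tail_def)

lemma tail_decseq:
  assumes "\<xi> \<in> l1_star"
  shows "decseq (tail \<xi>)"
  unfolding decseq_Suc_iff
proof
  show "tail \<xi> (Suc n) \<le> tail \<xi> n" for n
    using tail_Suc[OF assms, of n] c0_star_nonneg[OF l1_starD(1)[OF assms], of n] by linarith
qed

lemma tail_antimono: "\<xi> \<in> l1_star \<Longrightarrow> m \<le> n \<Longrightarrow> tail \<xi> n \<le> tail \<xi> m"
  using tail_decseq by (simp add: decseq_def)

lemma tail_tendsto:
  assumes "\<xi> \<in> l1_star"
  shows "tail \<xi> \<longlonglongrightarrow> 0"
proof -
  have "tail \<xi> n = suminf \<xi> - (\<Sum>j<n. \<xi> j)" for n
    using suminf_minus_initial_segment[OF l1_starD(2)[OF assms], of n] by (simp add: tail_def)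
  then have "tail \<xi> = (\<lambda>n. suminf \<xi> - (\<Sum>j<n. \<xi> j))" by (rule ext)
  moreover have "(\<lambda>n. suminf \<xi> - (\<Sum>j<n. \<xi> j)) \<longlonglongrightarrow> suminf \<xi> - suminf \<xi>"
    by (intro tendsto_diff tendsto_const summable_LIMSEQ l1_starD(2)[OF assms])
  ultimately show ?thesis by (simp only: diff_self)
qed

lemma am_inf_seq_quasiconvex:
  assumes "\<xi> \<in> l1_star"
  shows "quasiconvex (am_inf_seq \<xi>)"
  unfolding am_inf_seq_tail[abs_def]
  using tail_nonneg[OF assms] tail_decseq[OF assms] LIMSEQ_Suc[OF tail_tendsto[OF assms]]
  by (intro quasiconvexI) (simp_all add: decseq_Suc_iff)

lemma am_inf_seq_c0_star: "\<xi> \<in> l1_star \<Longrightarrow> am_inf_seq \<xi> \<in> c0_star"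
  using am_inf_seq_quasiconvex by (simp add: quasiconvex_def)

lemma sums_ampliation:
  fixes f :: "nat \<Rightarrow> real"
  assumes f: "\<And>n. 0 \<le> f n" "summable f"
  shows "(\<lambda>j. f (j div 2)) sums (2 * suminf f)"
proof -
  have "summable (\<lambda>j. f (j div 2))"
  proof (rule summableI_nonneg_bounded[where x = "2 * suminf f"])
    fix n
    have "(\<Sum>j<n. f (j div 2)) \<le> (\<Sum>j<2 * n. f (j div 2))" using f(1) by (intro sum_mono2) auto
    also have "\<dots> \<le> 2 * suminf f" unfolding sum_ampliation using sum_le_suminf[OF f(2), of "{..<n}"] f(1) by simp
    finally show "(\<Sum>j<n. f (j div 2)) \<le> 2 * suminf f" .
  qed (use f(1) in simp)
  then have sums: "(\<lambda>j. f (j div 2)) sums (\<Sum>j. f (j div 2))" by (rule summable_sums)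
  then have "(\<lambda>n. \<Sum>j<2 * n. f (j div 2)) \<longlonglongrightarrow> (\<Sum>j. f (j div 2))"
    unfolding sums_def using LIMSEQ_subseq_LIMSEQ[of "\<lambda>N. \<Sum>n<N. f (n div 2)" _ "\<lambda>N. 2 * N"]
    by (simp add: o_def strict_mono_def)
  moreover have "(\<lambda>n. \<Sum>j<2 * n. f (j div 2)) \<longlonglongrightarrow> 2 * suminf f"
    unfolding sum_ampliation by (intro tendsto_mult tendsto_const summable_LIMSEQ f(2))
  ultimately show ?thesis using sums LIMSEQ_unique by metis
qed

lemma l1_star_ampliation:
  assumes "\<xi> \<in> l1_star"
  shows "(\<lambda>n. \<xi> (n div 2)) \<in> l1_star"
  using sums_ampliation[OF c0_star_nonneg[OF l1_starD(1)[OF assms]] l1_starD(2)[OF assms]]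
    c0_star_ampliation[OF l1_starD(1)[OF assms], of 2]
  by (simp add: l1_star_def sums_iff)

lemma tail_ampliation:
  assumes "\<xi> \<in> l1_star"
  shows "tail (\<lambda>n. \<xi> (n div 2)) (2 * k) = 2 * tail \<xi> k"
proof -
  have "(\<lambda>j. \<xi> (j div 2 + k)) sums (2 * tail \<xi> k)"
    unfolding tail_def
    by (rule sums_ampliation)
      (intro c0_star_nonneg[OF l1_starD(1)[OF assms]] summable_ignore_initial_segment[OF l1_starD(2)[OF assms]])+
  then show ?thesis by (simp add: tail_def sums_iff add.commute[of k])
qed

lemma l1_star_add: "\<xi> \<in> l1_star \<Longrightarrow> \<eta> \<in> l1_star \<Longrightarrow> (\<lambda>n. \<xi> n + \<eta> n) \<in> l1_star"
  by (simp add: l1_star_def c0_star_add summable_add)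

lemma am_inf_seq_add:
  assumes "\<xi> \<in> l1_star" "\<eta> \<in> l1_star"
  shows "am_inf_seq (\<lambda>n. \<xi> n + \<eta> n) n = am_inf_seq \<xi> n + am_inf_seq \<eta> n"
  using suminf_add[OF summable_ignore_initial_segment[OF l1_starD(2)[OF assms(1)], of "Suc n"]
      summable_ignore_initial_segment[OF l1_starD(2)[OF assms(2)], of "Suc n"]]
  by (simp only: am_inf_seq_def add_divide_distrib[symmetric])

lemma l1_star_dominated:
  assumes "\<xi> \<in> l1_star" "\<eta> \<in> c0_star" "dominated \<eta> \<xi>"
  shows "\<eta> \<in> l1_star"
proof -
  obtain M where M: "\<And>n. \<eta> n \<le> M * \<xi> n" using assms(3) by (auto simp: dominated_def)
  have "summable \<eta>"
    by (rule summable_comparison_test'[OF summable_mult[OF l1_starD(2)[OF assms(1)], of M], of 0])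
      (use M c0_star_nonneg[OF assms(2)] in simp)
  then show ?thesis using assms(2) by (simp add: l1_star_def)
qed

lemma am_inf_seq_mono_mult:
  assumes "\<xi> \<in> l1_star" "\<eta> \<in> l1_star" "\<And>n. \<eta> n \<le> M * \<xi> n"
  shows "am_inf_seq \<eta> n \<le> M * am_inf_seq \<xi> n"
proof -
  have "tail \<eta> (Suc n) \<le> (\<Sum>j. M * \<xi> (j + Suc n))"
    unfolding tail_def
    by (intro suminf_le assms(3) summable_mult summable_ignore_initial_segment l1_starD assms(1,2))
  also have "\<dots> = M * tail \<xi> (Suc n)"
    unfolding tail_def by (intro suminf_mult summable_ignore_initial_segment l1_starD assms(1))
  finally show ?thesis by (simp add: am_inf_seq_tail divide_right_mono del: of_nat_Suc)
qed

lemma quasiconvex_equiv_am_inf_seq: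
  assumes \<kappa>: "quasiconvex \<kappa>"
  obtains \<eta> where "\<eta> \<in> l1_star" "\<And>n. \<kappa> n \<le> 2 * am_inf_seq \<eta> n" "\<And>n. am_inf_seq \<eta> n \<le> \<kappa> (n div 2)"
proof -
  txt \<open>The decrements of a convex function comparable, after an ampliation, to \<open>(n + 1) \<kappa> n\<close>.\<close>
  define \<phi> where "\<phi> m = real (Suc m) * \<kappa> m" for m
  have \<kappa>0: "\<kappa> \<in> c0_star" using \<kappa> by (simp add: quasiconvex_def)
  have \<phi>0: "0 \<le> \<phi> m" for m using c0_star_nonneg[OF \<kappa>0] by (simp add: \<phi>_def)
  have \<phi>_dec: "\<phi> n \<le> \<phi> m" if "m \<le> n" for m n
    using quasiconvex_le[OF \<kappa> that] by (simp add: \<phi>_def)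
  have \<phi>_lim: "\<phi> \<longlonglongrightarrow> 0" using \<kappa> by (simp add: quasiconvex_def \<phi>_def[abs_def])
  \<comment> \<open>Convex and nonincreasing in \<open>n\<close>, equal to 1/2 at
    \<open>n = m + 1\<close> and to 0 from \<open>2 * (m + 1)\<close> on. The first value gives the
    factor 2 in the lower bound, the second the ampliation in the upper bound; a supremum of convex
    functions is convex.\<close>
  define w where "w m n = max 0 (1 - real n / (2 * real (Suc m)))" for m n
  have w0: "0 \<le> w m n" and w1: "w m n \<le> 1" for m n by (auto simp: w_def)
  define G where "G n = (SUP m. \<phi> m * w m n)" for n
  have term_le: "\<phi> m * w m n \<le> \<phi> 0" for m n
  proof -
    have "\<phi> m * w m n \<le> \<phi> m * 1" by (rule mult_left_mono[OF w1 \<phi>0])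
    also have "\<dots> \<le> \<phi> 0" using \<phi>_dec[of 0 m] by simp
    finally show ?thesis .
  qed
  have bdd: "bdd_above (range (\<lambda>m. \<phi> m * w m n))" for n
    by (rule bdd_aboveI[of _ "\<phi> 0"]) (auto intro: term_le)
  have G_ge: "\<phi> m * w m n \<le> G n" for m n
    unfolding G_def by (rule cSUP_upper[OF _ bdd]) simp
  have G_le: "G n \<le> c" if "\<And>m. \<phi> m * w m n \<le> c" for c n
    unfolding G_def by (rule cSUP_least) (use that in auto)
  have low: "\<phi> n \<le> 2 * G (Suc n)" for n
  proof -
    have "real (Suc n) / (2 * real (Suc n)) = 1 / 2" by (simp del: of_nat_Suc)
    then have "w n (Suc n) = 1 / 2" by (simp only: w_def)
    then have "\<phi> n * (1 / 2) \<le> G (Suc n)" using G_ge[of n "Suc n"] by (simp only:)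
    then show ?thesis by simp
  qed
  have upp: "G (Suc n) \<le> \<phi> (n div 2)" for n
  proof (rule G_le)
    fix m show "\<phi> m * w m (Suc n) \<le> \<phi> (n div 2)"
    proof (cases "n div 2 \<le> m")
      case True
      have "\<phi> m * w m (Suc n) \<le> \<phi> m * 1" by (rule mult_left_mono[OF w1 \<phi>0])
      also have "\<dots> \<le> \<phi> (n div 2)" using \<phi>_dec[OF True] by simp
      finally show ?thesis .
    next
      case False
      then have "2 * Suc m \<le> Suc n" by presburger
      then have "2 * real (Suc m) \<le> real (Suc n)" by linarith
      then have "w m (Suc n) = 0" by (simp add: w_def)
      then show ?thesis using \<phi>0 by simp
    qed
  qed
  have G0: "0 \<le> G n" for n using order_trans[OF mult_nonneg_nonneg[OF \<phi>0 w0] G_ge] .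
  have "(\<lambda>n. G (Suc n)) \<longlonglongrightarrow> 0"
  proof (rule tendsto_sandwich[of "\<lambda>_. 0" _ _ "\<lambda>n. \<phi> (n div 2)"])
    show "(\<lambda>n. \<phi> (n div 2)) \<longlonglongrightarrow> 0"
      using filterlim_compose[OF \<phi>_lim filterlim_div_sequentially[of 2]] by simp
  qed (use G0 upp in auto)
  then have G_lim: "G \<longlonglongrightarrow> 0" by (rule LIMSEQ_imp_Suc)
  have w_dec: "w m (Suc n) \<le> w m n" for m n
    unfolding w_def by (intro max.mono diff_left_mono divide_right_mono) auto
  have G_dec: "G (Suc n) \<le> G n" for n
    by (rule G_le) (rule order_trans[OF mult_left_mono[OF w_dec \<phi>0] G_ge])
  have w_convex: "2 * w m (Suc n) \<le> w m n + w m (Suc (Suc n))" for m n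
  proof -
    define a where "a = 1 / (2 * real (Suc m))"
    have "w m n = max 0 (1 - real n * a)" for n by (simp add: w_def a_def)
    then show ?thesis by (simp add: algebra_simps max_def)
  qed
  have G_convex: "2 * G (Suc n) \<le> G n + G (Suc (Suc n))" for n
  proof -
    have "G (Suc n) \<le> (G n + G (Suc (Suc n))) / 2"
    proof (rule G_le)
      fix m
      have "\<phi> m * (2 * w m (Suc n)) \<le> \<phi> m * (w m n + w m (Suc (Suc n)))"
        by (rule mult_left_mono[OF w_convex \<phi>0])
      then show "\<phi> m * w m (Suc n) \<le> (G n + G (Suc (Suc n))) / 2"
        using G_ge[of m n] G_ge[of m "Suc (Suc n)"] by (simp add: distrib_left)
    qed
    then show ?thesis by simp
  qed
  \<comment> \<open>By telescoping, \<open>G n\<close> is the tail of \<eta> from \<open>n\<close>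
    on; convexity of \<open>G\<close> makes \<eta> nonincreasing.\<close>
  define \<eta> where "\<eta> n = G n - G (Suc n)" for n
  have sums: "(\<lambda>j. \<eta> (j + n)) sums G n" for n
    using telescope_sums'[OF LIMSEQ_ignore_initial_segment[OF G_lim, of n]] by (simp add: \<eta>_def)
  have "\<eta> \<longlonglongrightarrow> 0" using summable_LIMSEQ_zero[OF sums_summable[OF sums[of 0]]] by simp
  moreover have "decseq \<eta>"
    unfolding decseq_Suc_iff
  proof
    show "\<eta> (Suc n) \<le> \<eta> n" for n using G_convex[of n] by (simp add: \<eta>_def)
  qed
  moreover have "0 \<le> \<eta> n" for n using G_dec by (simp add: \<eta>_def)
  moreover have "summable \<eta>" using sums_summable[OF sums[of 0]] by simp
  ultimately have \<eta>: "\<eta> \<in> l1_star" by (simp add: l1_star_def c0_star_def)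
  have am: "am_inf_seq \<eta> n = G (Suc n) / real (Suc n)" for n
    using sums[of "Suc n"] by (simp add: am_inf_seq_def sums_iff)
  show ?thesis
  proof (rule that[OF \<eta>])
    fix n
    show "\<kappa> n \<le> 2 * am_inf_seq \<eta> n" using low[of n] by (simp add: am \<phi>_def field_simps)
    have "am_inf_seq \<eta> n \<le> real (Suc (n div 2)) * \<kappa> (n div 2) / real (Suc n)"
      using upp[of n] unfolding am \<phi>_def by (intro divide_right_mono) auto
    also have "\<dots> \<le> real (Suc n) * \<kappa> (n div 2) / real (Suc n)"
      using c0_star_nonneg[OF \<kappa>0] by (intro divide_right_mono mult_right_mono) auto
    finally show "am_inf_seq \<eta> n \<le> \<kappa> (n div 2)" by simp
  qed
qed

section \<open>Mean operations at infinity on characteristic sets\<close>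

definition pre_am_inf_set :: "(nat \<Rightarrow> real) set \<Rightarrow> (nat \<Rightarrow> real) set" where
  "pre_am_inf_set S = {\<xi> \<in> l1_star. am_inf_seq \<xi> \<in> S}"

definition am_inf_set :: "(nat \<Rightarrow> real) set \<Rightarrow> (nat \<Rightarrow> real) set" where
  "am_inf_set S = {\<xi> \<in> c0_star. \<exists>\<eta>\<in>S \<inter> l1_star. dominated \<xi> (am_inf_seq \<eta>)}"

definition interior_inf_set :: "(nat \<Rightarrow> real) set \<Rightarrow> (nat \<Rightarrow> real) set" where
  "interior_inf_set S = {\<xi> \<in> c0_star. \<exists>\<kappa>\<in>S. quasiconvex \<kappa> \<and> dominated \<xi> \<kappa>}"

text \<open>A generator of the finite rank operators, hence in every nonzero characteristic set. It
  controls the first term of a sequence, which \<open>am_inf_seq\<close> does not see.\<close>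

definition delta0 :: "nat \<Rightarrow> real" where
  "delta0 n = (if n = 0 then 1 else 0)"

lemma delta0_quasiconvex: "quasiconvex delta0"
proof -
  have lim: "(\<lambda>n. if n = 0 then 1 else 0 :: real) \<longlonglongrightarrow> 0"
    by (rule LIMSEQ_imp_Suc) simp
  have "quasiconvex (\<lambda>n. (if n = 0 then 1 else 0) / real (Suc n))"
    by (rule quasiconvexI[OF _ _ lim]) (auto simp: decseq_def)
  moreover have "(\<lambda>n. (if n = 0 then 1 else 0) / real (Suc n)) = delta0" by (auto simp: delta0_def)
  ultimately show ?thesis by simp
qed

lemma delta0_c0_star: "delta0 \<in> c0_star"
  using delta0_quasiconvex by (simp add: quasiconvex_def)

lemma delta0_in_char_set:
  assumes S: "is_char_set S" and "S \<noteq> {\<lambda>n. 0}"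
  shows "delta0 \<in> S"
proof -
  obtain \<xi> where \<xi>: "\<xi> \<in> S" "\<xi> \<noteq> (\<lambda>n. 0)" using assms(2) char_set_zero[OF S] by blast
  then have c0: "\<xi> \<in> c0_star" using is_char_setD(1)[OF S] by blast
  have "\<xi> 0 \<noteq> 0"
  proof
    assume "\<xi> 0 = 0"
    then have "\<xi> n = 0" for n using c0_star_nonneg[OF c0, of n] c0_star_antimono[OF c0, of 0 n] by simp
    then show False using \<xi>(2) by auto
  qed
  then have "dominated delta0 \<xi>"
    using c0_star_nonneg[OF c0] by (intro dominatedI[of _ "1 / \<xi> 0"]) (simp add: delta0_def)
  then show ?thesis by (rule is_char_setD(3)[OF S \<xi>(1) delta0_c0_star])
qed

lemma l1_star_zero: "(\<lambda>n. 0) \<in> l1_star"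
  by (simp add: l1_star_def c0_star_zero)

text \<open>At index 0 the tail of the ampliated sequence still contains \<open>\<xi> 0\<close>,
  which \<open>am_inf_seq \<xi>\<close> omits; hence \<open>0 < n\<close>. The index
  \<open>n div 4\<close> instead of \<open>n div 2\<close> pays for the shift by one in the start of
  the tails.\<close>

lemma am_inf_seq_ampliation_le:
  assumes \<xi>: "\<xi> \<in> l1_star" and "0 < n"
  shows "am_inf_seq (\<lambda>n. \<xi> (n div 2)) n \<le> 2 * am_inf_seq \<xi> (n div 4)"
proof -
  define k where "k = Suc n div 2"
  have "tail (\<lambda>n. \<xi> (n div 2)) (Suc n) \<le> tail (\<lambda>n. \<xi> (n div 2)) (2 * k)"
    by (rule tail_antimono[OF l1_star_ampliation[OF \<xi>]]) (simp add: k_def)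
  also have "\<dots> = 2 * tail \<xi> k" by (rule tail_ampliation[OF \<xi>])
  also have "\<dots> \<le> 2 * tail \<xi> (Suc (n div 4))"
    using \<open>0 < n\<close> by (intro mult_left_mono tail_antimono[OF \<xi>]) (auto simp: k_def)
  finally have "tail (\<lambda>n. \<xi> (n div 2)) (Suc n) / real (Suc n) \<le>
      2 * tail \<xi> (Suc (n div 4)) / real (Suc (n div 4))"
    using tail_nonneg[OF \<xi>] by (intro frac_le) auto
  then show ?thesis by (simp only: am_inf_seq_tail times_divide_eq_right)
qed

text \<open>
  The hypothesis that \<open>S\<close> is nonzero provides the first term of the ampliation, which need not be
  controlled by \<open>am_inf_seq \<xi>\<close>.
\<close>

lemma is_char_set_pre_am_inf_set:
  assumes S: "is_char_set S" "S \<noteq> {\<lambda>n. 0}"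
  shows "is_char_set (pre_am_inf_set S)"
proof (rule is_char_setI)
  show "\<xi> \<in> c0_star" if "\<xi> \<in> pre_am_inf_set S" for \<xi> using that by (simp add: pre_am_inf_set_def l1_star_def)
  show "(\<lambda>n. 0) \<in> pre_am_inf_set S"
    using char_set_zero[OF S(1)] by (simp add: pre_am_inf_set_def l1_star_zero am_inf_seq_def[abs_def])
  show "(\<lambda>n. \<xi> n + \<eta> n) \<in> pre_am_inf_set S" if "\<xi> \<in> pre_am_inf_set S" "\<eta> \<in> pre_am_inf_set S" for \<xi> \<eta>
  proof -
    have l1: "\<xi> \<in> l1_star" "\<eta> \<in> l1_star" and S': "am_inf_seq \<xi> \<in> S" "am_inf_seq \<eta> \<in> S"
      using that by (auto simp: pre_am_inf_set_def)
    have "am_inf_seq (\<lambda>n. \<xi> n + \<eta> n) = (\<lambda>n. am_inf_seq \<xi> n + am_inf_seq \<eta> n)"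
      by (rule ext) (rule am_inf_seq_add[OF l1])
    then show ?thesis
      using is_char_setD(2)[OF S(1) S'] l1_star_add[OF l1] by (simp add: pre_am_inf_set_def)
  qed
  show "\<eta> \<in> pre_am_inf_set S" if "\<xi> \<in> pre_am_inf_set S" "\<eta> \<in> c0_star" "dominated \<eta> \<xi>" for \<xi> \<eta>
  proof -
    have \<xi>: "\<xi> \<in> l1_star" "am_inf_seq \<xi> \<in> S" using that by (auto simp: pre_am_inf_set_def)
    have \<eta>: "\<eta> \<in> l1_star" by (rule l1_star_dominated[OF \<xi>(1) that(2,3)])
    have "dominated (am_inf_seq \<eta>) (am_inf_seq \<xi>)"
      using that(3) am_inf_seq_mono_mult[OF \<xi>(1) \<eta>] unfolding dominated_def by metis
    then show ?thesis
      using is_char_setD(3)[OF S(1) \<xi>(2) am_inf_seq_c0_star[OF \<eta>]] \<eta> by (simp add: pre_am_inf_set_def)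
  qed
  show "(\<lambda>n. \<xi> (n div 2)) \<in> pre_am_inf_set S" if "\<xi> \<in> pre_am_inf_set S" for \<xi>
  proof -
    have \<xi>: "\<xi> \<in> l1_star" "am_inf_seq \<xi> \<in> S" using that by (auto simp: pre_am_inf_set_def)
    define \<theta> where "\<theta> = am_inf_seq (\<lambda>n. \<xi> (n div 2))"
    have \<theta>: "\<theta> \<in> c0_star" unfolding \<theta>_def by (rule am_inf_seq_c0_star[OF l1_star_ampliation[OF \<xi>(1)]])
    have 4: "(\<lambda>n. am_inf_seq \<xi> (n div 4)) \<in> S"
      using char_set_ampliation[OF S(1) \<xi>(2), of 2] by simp
    have nn: "0 \<le> am_inf_seq \<xi> n" for n by (rule c0_star_nonneg[OF am_inf_seq_c0_star[OF \<xi>(1)]])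
    have "\<theta> n \<le> (2 + \<theta> 0) * (am_inf_seq \<xi> (n div 4) + delta0 n)" for n
    proof (cases "n = 0")
      case True
      have "(2 + \<theta> 0) * 1 \<le> (2 + \<theta> 0) * (am_inf_seq \<xi> 0 + 1)"
        using nn[of 0] c0_star_nonneg[OF \<theta>, of 0] by (intro mult_left_mono) auto
      then show ?thesis by (simp add: True delta0_def)
    next
      case False
      have "\<theta> n \<le> 2 * am_inf_seq \<xi> (n div 4)"
        unfolding \<theta>_def using am_inf_seq_ampliation_le[OF \<xi>(1)] False by simp
      also have "\<dots> \<le> (2 + \<theta> 0) * am_inf_seq \<xi> (n div 4)"
        using c0_star_nonneg[OF \<theta>, of 0] by (intro mult_right_mono nn) simp
      finally show ?thesis using False by (simp add: delta0_def)
    qed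
    then have "dominated \<theta> (\<lambda>n. am_inf_seq \<xi> (n div 4) + delta0 n)" by (rule dominatedI)
    then have "\<theta> \<in> S"
      by (rule is_char_setD(3)[OF S(1) is_char_setD(2)[OF S(1) 4 delta0_in_char_set[OF S]] \<theta>])
    then show ?thesis using l1_star_ampliation[OF \<xi>(1)] by (simp add: pre_am_inf_set_def \<theta>_def)
  qed
qed

lemma is_char_set_am_inf_set:
  assumes S: "is_char_set S"
  shows "is_char_set (am_inf_set S)"
proof (rule is_char_setI)
  have nn: "0 \<le> am_inf_seq \<zeta> n" if "\<zeta> \<in> l1_star" for \<zeta> n
    by (rule c0_star_nonneg[OF am_inf_seq_c0_star[OF that]])
  show "(\<lambda>n. 0) \<in> am_inf_set S"
    using char_set_zero[OF S] l1_star_zero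
    by (auto simp: am_inf_set_def c0_star_zero dominated_def intro!: exI[of _ 0])
  show "(\<lambda>n. \<xi> n + \<eta> n) \<in> am_inf_set S" if mem: "\<xi> \<in> am_inf_set S" "\<eta> \<in> am_inf_set S" for \<xi> \<eta>
  proof -
    obtain \<zeta> \<theta> where z: "\<zeta> \<in> S" "\<zeta> \<in> l1_star" "dominated \<xi> (am_inf_seq \<zeta>)"
      and t: "\<theta> \<in> S" "\<theta> \<in> l1_star" "dominated \<eta> (am_inf_seq \<theta>)"
      using mem by (auto simp: am_inf_set_def)
    have "dominated (\<lambda>n. \<xi> n + \<eta> n) (am_inf_seq (\<lambda>n. \<zeta> n + \<theta> n))"
      using dominated_add[OF z(3) t(3) nn[OF z(2)] nn[OF t(2)]]
      by (simp add: am_inf_seq_add[OF z(2) t(2), abs_def])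
    then show ?thesis
      using mem is_char_setD(2)[OF S z(1) t(1)] l1_star_add[OF z(2) t(2)]
      by (auto simp: am_inf_set_def c0_star_add)
  qed
  show "\<eta> \<in> am_inf_set S" if "\<xi> \<in> am_inf_set S" "\<eta> \<in> c0_star" "dominated \<eta> \<xi>" for \<xi> \<eta>
    using that dominated_trans[OF that(3)] c0_star_nonneg by (fastforce simp: am_inf_set_def)
  show "(\<lambda>n. \<xi> (n div 2)) \<in> am_inf_set S" if mem: "\<xi> \<in> am_inf_set S" for \<xi>
  proof -
    obtain \<zeta> where \<zeta>: "\<zeta> \<in> S" "\<zeta> \<in> l1_star" "dominated \<xi> (am_inf_seq \<zeta>)"
      using mem by (auto simp: am_inf_set_def)
    obtain M where M: "M > 0" "\<And>n. \<xi> n \<le> M * am_inf_seq \<zeta> n"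
      using dominated_pos[OF \<zeta>(3) nn[OF \<zeta>(2)]] by metis
    \<comment> \<open>A mean at infinity need not absorb an ampliation, so the witness \<zeta> is
      ampliated instead. Its tail doubles exactly, which pays for the doubled denominator.\<close>
    let ?\<theta> = "\<lambda>n. \<zeta> (n div 2)"
    have "\<xi> (n div 2) \<le> M * am_inf_seq ?\<theta> n" for n
    proof -
      define m where "m = n div 2"
      have "real (Suc n) \<le> 2 * real (Suc m)" using real_Suc_le_ampliation[of n 1] by (simp add: m_def)
      then have "tail \<zeta> (Suc m) * real (Suc n) \<le> tail \<zeta> (Suc m) * (2 * real (Suc m))"
        by (rule mult_left_mono[OF _ tail_nonneg[OF \<zeta>(2)]])
      then have "tail \<zeta> (Suc m) / real (Suc m) \<le> 2 * tail \<zeta> (Suc m) / real (Suc n)"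
        by (simp add: field_simps del: of_nat_Suc)
      also have "2 * tail \<zeta> (Suc m) = tail ?\<theta> (2 * Suc m)" by (rule tail_ampliation[OF \<zeta>(2), symmetric])
      also have "\<dots> / real (Suc n) \<le> tail ?\<theta> (Suc n) / real (Suc n)"
        by (intro divide_right_mono tail_antimono[OF l1_star_ampliation[OF \<zeta>(2)]]) (auto simp: m_def)
      finally have "am_inf_seq \<zeta> m \<le> am_inf_seq ?\<theta> n" by (simp only: am_inf_seq_tail)
      then have "M * am_inf_seq \<zeta> m \<le> M * am_inf_seq ?\<theta> n" using M(1) by (intro mult_left_mono) auto
      then show ?thesis using M(2)[of m] by (simp add: m_def)
    qed
    then have "dominated (\<lambda>n. \<xi> (n div 2)) (am_inf_seq ?\<theta>)" by (rule dominatedI)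
    moreover have "(\<lambda>n. \<xi> (n div 2)) \<in> c0_star"
      using mem by (intro c0_star_ampliation) (auto simp: am_inf_set_def)
    ultimately show ?thesis
      using is_char_setD(4)[OF S \<zeta>(1)] l1_star_ampliation[OF \<zeta>(2)] unfolding am_inf_set_def by blast
  qed
qed (simp add: am_inf_set_def)

text \<open>As for ordinary means, except that the mean comparable to \<kappa> is bounded above only
  by an ampliation of \<kappa>; this still lies in \<open>S\<close>.\<close>

theorem am_inf_set_pre_am_inf_set:
  assumes S: "is_char_set S"
  shows "am_inf_set (pre_am_inf_set S) = interior_inf_set S"
proof (intro equalityI subsetI)
  fix \<xi> assume "\<xi> \<in> am_inf_set (pre_am_inf_set S)"
  then show "\<xi> \<in> interior_inf_set S"
    using am_inf_seq_quasiconvex by (auto simp: am_inf_set_def pre_am_inf_set_def interior_inf_set_def)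
next
  fix \<xi> assume "\<xi> \<in> interior_inf_set S"
  then obtain \<kappa> where \<kappa>: "\<xi> \<in> c0_star" "\<kappa> \<in> S" "quasiconvex \<kappa>" "dominated \<xi> \<kappa>"
    by (auto simp: interior_inf_set_def)
  obtain \<eta> where \<eta>: "\<eta> \<in> l1_star" "\<And>n. \<kappa> n \<le> 2 * am_inf_seq \<eta> n" "\<And>n. am_inf_seq \<eta> n \<le> \<kappa> (n div 2)"
    by (rule quasiconvex_equiv_am_inf_seq[OF \<kappa>(3)]) blast
  have "dominated (am_inf_seq \<eta>) (\<lambda>n. \<kappa> (n div 2))" using \<eta>(3) by (intro dominatedI[of _ 1]) simp
  then have "am_inf_seq \<eta> \<in> S"
    by (rule is_char_setD(3)[OF S is_char_setD(4)[OF S \<kappa>(2)] am_inf_seq_c0_star[OF \<eta>(1)]])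
  moreover have "dominated \<xi> (am_inf_seq \<eta>)"
    using dominated_trans[OF \<kappa>(4) dominatedI[OF \<eta>(2)]] c0_star_nonneg[OF is_char_setD(1)[OF S \<kappa>(2)]] by blast
  ultimately show "\<xi> \<in> am_inf_set (pre_am_inf_set S)"
    using \<kappa>(1) \<eta>(1) by (auto simp: am_inf_set_def pre_am_inf_set_def)
qed

section \<open>Principal characteristic sets and their interiors\<close>

lemma quasiconcave_c0_star: "quasiconcave \<kappa> \<Longrightarrow> \<kappa> \<in> c0_star"
  by (simp add: quasiconcave_def)

lemma quasiconvex_c0_star: "quasiconvex \<kappa> \<Longrightarrow> \<kappa> \<in> c0_star"
  by (simp add: quasiconvex_def)

lemma principal_char_set_subset_iff:
  "\<xi> \<in> c0_star \<Longrightarrow> \<eta> \<in> c0_star \<Longrightarrow> principal_char_set \<xi> \<subseteq> principal_char_set \<eta> \<longleftrightarrow> \<xi> \<in> principal_char_set \<eta>"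
  by (rule principal_char_set_least[OF is_char_set_principal])

lemma principal_char_set_eqI:
  assumes "\<xi> \<in> c0_star" "\<eta> \<in> c0_star" "\<xi> \<in> principal_char_set \<eta>" "\<eta> \<in> principal_char_set \<xi>"
  shows "principal_char_set \<xi> = principal_char_set \<eta>"
  using principal_char_set_subset_iff[OF assms(1,2)] principal_char_set_subset_iff[OF assms(2,1)] assms(3,4)
  by blast

lemma in_principal_char_setD:
  assumes "\<eta> \<in> principal_char_set \<xi>" "\<xi> \<in> c0_star"
  obtains k M where "M > 0" "\<And>n. \<eta> n \<le> M * \<xi> (n div 2 ^ k)"
proof -
  obtain k where "dominated \<eta> (\<lambda>n. \<xi> (n div 2 ^ k))" using assms(1) by (auto simp: principal_char_set_def)
  then obtain M where "M > 0" "\<And>n. \<eta> n \<le> M * \<xi> (n div 2 ^ k)"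
    by (rule dominated_pos[OF _ c0_star_nonneg[OF assms(2)]]) blast
  then show ?thesis by (rule that)
qed

lemma in_principal_char_setI:
  "\<eta> \<in> c0_star \<Longrightarrow> (\<And>n. \<eta> n \<le> M * \<xi> (n div 2 ^ k)) \<Longrightarrow> \<eta> \<in> principal_char_set \<xi>"
  unfolding principal_char_set_def dominated_def by blast

lemma dominated_in_principal_char_set: "\<eta> \<in> c0_star \<Longrightarrow> dominated \<eta> \<xi> \<Longrightarrow> \<eta> \<in> principal_char_set \<xi>"
  using in_principal_char_setI[of \<eta> _ \<xi> 0] by (auto simp: dominated_def)

lemma interior_set_subset:
  assumes "is_char_set S"
  shows "interior_set S \<subseteq> S"
  using is_char_setD(3)[OF assms] by (auto simp: interior_set_def)

lemma interior_setI: "is_char_set S \<Longrightarrow> \<kappa> \<in> S \<Longrightarrow> quasiconcave \<kappa> \<Longrightarrow> \<kappa> \<in> interior_set S"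
  using dominated_refl by (auto simp: interior_set_def quasiconcave_def)

lemma is_char_set_interior_set: "is_char_set S \<Longrightarrow> is_char_set (interior_set S)"
  using is_char_set_am_set[OF is_char_set_pre_am_set] am_set_pre_am_set by metis

lemma interior_set_idem:
  assumes S: "is_char_set S"
  shows "interior_set (interior_set S) = interior_set S"
proof
  show "interior_set (interior_set S) \<subseteq> interior_set S"
    by (rule interior_set_subset[OF is_char_set_interior_set[OF S]])
  show "interior_set S \<subseteq> interior_set (interior_set S)"
    using interior_setI[OF S] unfolding interior_set_def[of "interior_set S"] by (auto simp: interior_set_def[of S])
qed

lemma interior_inf_set_subset:
  assumes "is_char_set S"
  shows "interior_inf_set S \<subseteq> S"
  using is_char_setD(3)[OF assms] by (auto simp: interior_inf_set_def)

lemma interior_inf_setI: "is_char_set S \<Longrightarrow> \<kappa> \<in> S \<Longrightarrow> quasiconvex \<kappa> \<Longrightarrow> \<kappa> \<in> interior_inf_set S"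
  using dominated_refl by (auto simp: interior_inf_set_def quasiconvex_def)

lemma is_char_set_interior_inf_set:
  "is_char_set S \<Longrightarrow> S \<noteq> {\<lambda>n. 0} \<Longrightarrow> is_char_set (interior_inf_set S)"
  using is_char_set_am_inf_set[OF is_char_set_pre_am_inf_set] am_inf_set_pre_am_inf_set by metis

lemma delta0_nonzero: "delta0 \<noteq> (\<lambda>n. 0)"
  by (auto simp: delta0_def fun_eq_iff)

lemma interior_inf_set_nonzero:
  assumes "is_char_set S" "S \<noteq> {\<lambda>n. 0}"
  shows "interior_inf_set S \<noteq> {\<lambda>n. 0}"
  using interior_inf_setI[OF assms(1) delta0_in_char_set[OF assms] delta0_quasiconvex] delta0_nonzero by blast

lemma interior_inf_set_idem:
  assumes S: "is_char_set S" "S \<noteq> {\<lambda>n. 0}"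
  shows "interior_inf_set (interior_inf_set S) = interior_inf_set S"
proof
  show "interior_inf_set (interior_inf_set S) \<subseteq> interior_inf_set S"
    by (rule interior_inf_set_subset[OF is_char_set_interior_inf_set[OF S]])
  show "interior_inf_set S \<subseteq> interior_inf_set (interior_inf_set S)"
    using interior_inf_setI[OF S(1)] unfolding interior_inf_set_def[of "interior_inf_set S"]
    by (auto simp: interior_inf_set_def[of S])
qed

subsection \<open>Envelopes\<close>

lemma quasiconcave_lower_envelope:
  assumes \<rho>: "\<rho> \<in> c0_star"
  obtains \<nu> where "quasiconcave \<nu>" "\<And>n. \<nu> n \<le> \<rho> n"
    "\<And>\<kappa>. quasiconcave \<kappa> \<Longrightarrow> \<kappa> \<in> principal_char_set \<rho> \<Longrightarrow> dominated \<kappa> \<nu>"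
proof -
  define \<phi> where "\<phi> m = real (Suc m) * \<rho> m" for m
  have \<phi>0: "0 \<le> \<phi> m" for m using c0_star_nonneg[OF \<rho>] by (simp add: \<phi>_def)
  define I where "I n = (INF m\<in>{n..}. \<phi> m)" for n
  have bdd: "bdd_below (\<phi> ` {n..})" for n by (rule bdd_belowI[of _ 0]) (auto simp: \<phi>0)
  have I_le: "I n \<le> \<phi> m" if "n \<le> m" for m n
    unfolding I_def by (rule cINF_lower[OF bdd]) (use that in simp)
  have I_ge: "c \<le> I n" if "\<And>m. n \<le> m \<Longrightarrow> c \<le> \<phi> m" for c n
    unfolding I_def by (rule cINF_greatest) (use that in auto)
  have I0: "0 \<le> I n" for n by (rule I_ge[OF \<phi>0])
  have I_mono: "I n \<le> I (Suc n)" for n by (rule I_ge[OF I_le]) simp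
  define \<nu> where "\<nu> n = I n / real (Suc n)" for n
  have le: "\<nu> n \<le> \<rho> n" for n
    using I_le[of n n] by (simp add: \<nu>_def \<phi>_def divide_le_eq mult.commute del: of_nat_Suc)
  have dec: "\<nu> (Suc n) \<le> \<nu> n" for n
  proof -
    \<comment> \<open>The infimum \<open>I n\<close> takes into account one more term than
      \<open>I (Suc n)\<close>, the one at \<open>n\<close>. For that term monotonicity of \<rho> is
      used, for the others \<open>I (Suc n)\<close> itself.\<close>
    have "real (Suc n) * \<nu> (Suc n) \<le> I n"
    proof (rule I_ge)
      fix m assume "n \<le> m"
      show "real (Suc n) * \<nu> (Suc n) \<le> \<phi> m"
      proof (cases "m = n")
        case True
        have "\<nu> (Suc n) \<le> \<rho> n" using le[of "Suc n"] c0_star_antimono[OF \<rho>, of n "Suc n"] by simp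
        then show ?thesis unfolding True \<phi>_def by (rule mult_left_mono) simp
      next
        case False
        have "real (Suc n) / real (Suc (Suc n)) * I (Suc n) \<le> 1 * I (Suc n)"
          by (rule mult_right_mono[OF _ I0]) simp
        then show ?thesis using I_le[of "Suc n" m] False \<open>n \<le> m\<close> by (simp add: \<nu>_def)
      qed
    qed
    then show ?thesis by (simp add: \<nu>_def[of n] le_divide_eq mult.commute del: of_nat_Suc)
  qed
  have \<nu>0: "0 \<le> \<nu> n" for n using I0 by (simp add: \<nu>_def)
  have "\<nu> \<longlonglongrightarrow> 0"
    by (rule tendsto_sandwich[OF _ _ tendsto_const c0_star_tendsto[OF \<rho>]]) (use \<nu>0 le in auto)
  moreover have "mono (\<lambda>n. real (Suc n) * \<nu> n)"
    unfolding mono_iff_le_Suc using I_mono by (simp add: \<nu>_def)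
  ultimately have "quasiconcave \<nu>"
    using \<nu>0 dec by (simp add: quasiconcave_def c0_star_def decseq_Suc_iff)
  moreover have "dominated \<kappa> \<nu>" if \<kappa>: "quasiconcave \<kappa>" "\<kappa> \<in> principal_char_set \<rho>" for \<kappa>
  proof -
    obtain k M where M: "M > 0" "\<And>n. \<kappa> n \<le> M * \<rho> (n div 2 ^ k)"
      by (rule in_principal_char_setD[OF \<kappa>(2) \<rho>]) blast
    have "\<kappa> n \<le> (M * 2 ^ k) * \<nu> n" for n
    proof -
      have "real (Suc n) * \<kappa> n / (M * 2 ^ k) \<le> I n"
      proof (rule I_ge)
        fix m assume "n \<le> m"
        \<comment> \<open>At \<open>2 ^ k * m\<close> the ampliation of \<rho> takes the value
          \<open>\<rho> m\<close>, and \<open>(j + 1) * \<kappa> j\<close> has not decreased between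
          \<open>n\<close> and this index. The change of index costs the factor
          \<open>2 ^ k\<close>, and no ampliation remains.\<close>
        have "n \<le> 2 ^ k * m" using \<open>n \<le> m\<close> by (metis le_trans mult_le_mono1 mult_1 one_le_numeral one_le_power)
        then have "real (Suc n) * \<kappa> n \<le> real (Suc (2 ^ k * m)) * \<kappa> (2 ^ k * m)"
          by (rule quasiconcave_le[OF \<kappa>(1)])
        also have "\<dots> \<le> real (Suc (2 ^ k * m)) * (M * \<rho> m)"
          using M(2)[of "2 ^ k * m"] by (intro mult_left_mono) auto
        also have "\<dots> \<le> (2 ^ k * real (Suc m)) * (M * \<rho> m)"
          using M(1) c0_star_nonneg[OF \<rho>] by (intro mult_right_mono) (auto simp: algebra_simps)
        finally show "real (Suc n) * \<kappa> n / (M * 2 ^ k) \<le> \<phi> m"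
          using M(1) by (simp add: divide_le_eq \<phi>_def mult_ac)
      qed
      then show ?thesis using M(1) by (simp add: \<nu>_def field_simps)
    qed
    then show ?thesis by (rule dominatedI)
  qed
  ultimately show ?thesis using that le by blast
qed

text \<open>\<open>am_seq \<rho>\<close> is one quasiconcave majorant of \<rho>, so the least one,
  built from the running maximum of \<open>(m + 1) * \<rho> m\<close>, tends to 0 as well.\<close>

lemma quasiconcave_upper_envelope:
  assumes \<rho>: "\<rho> \<in> c0_star"
  obtains \<mu> where "quasiconcave \<mu>" "\<And>n. \<rho> n \<le> \<mu> n"
    "\<And>\<kappa>. quasiconcave \<kappa> \<Longrightarrow> dominated \<rho> \<kappa> \<Longrightarrow> dominated \<mu> \<kappa>"
proof -
  define \<phi> where "\<phi> m = real (Suc m) * \<rho> m" for m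
  define B where "B n = Max (\<phi> ` {..n})" for n
  have B_ge: "\<phi> m \<le> B n" if "m \<le> n" for m n unfolding B_def using that by (intro Max_ge) auto
  have B_le: "B n \<le> c" if "\<And>m. m \<le> n \<Longrightarrow> \<phi> m \<le> c" for c n unfolding B_def using that by (subst Max_le_iff) auto
  define \<mu> where "\<mu> n = B n / real (Suc n)" for n
  have ge: "\<rho> n \<le> \<mu> n" for n
    using B_ge[of n n] by (simp add: \<mu>_def \<phi>_def le_divide_eq mult.commute del: of_nat_Suc)
  have \<mu>0: "0 \<le> \<mu> n" for n using ge[of n] c0_star_nonneg[OF \<rho>, of n] by simp
  have B0: "0 \<le> B n" for n
    using B_ge[of n n] c0_star_nonneg[OF \<rho>, of n] order_trans[of 0 "\<phi> n" "B n"] by (simp add: \<phi>_def)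
  have B_mono: "B n \<le> B (Suc n)" for n by (rule B_le[OF B_ge]) simp
  have dec: "\<mu> (Suc n) \<le> \<mu> n" for n
  proof -
    have "B (Suc n) \<le> real (Suc (Suc n)) * \<mu> n"
    proof (rule B_le)
      fix m assume "m \<le> Suc n"
      show "\<phi> m \<le> real (Suc (Suc n)) * \<mu> n"
      proof (cases "m = Suc n")
        case True
        have "\<rho> (Suc n) \<le> \<mu> n" using ge[of n] c0_star_antimono[OF \<rho>, of n "Suc n"] by simp
        then show ?thesis unfolding True \<phi>_def by (rule mult_left_mono) simp
      next
        case False
        then have "\<phi> m \<le> real (Suc n) * \<mu> n" using B_ge[of m n] \<open>m \<le> Suc n\<close> by (simp add: \<mu>_def)
        also have "\<dots> \<le> real (Suc (Suc n)) * \<mu> n" by (rule mult_right_mono[OF _ \<mu>0]) simp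
        finally show ?thesis .
      qed
    qed
    then show ?thesis by (simp add: \<mu>_def[of "Suc n"] divide_le_eq mult.commute del: of_nat_Suc)
  qed
  have "\<mu> n \<le> am_seq \<rho> n" for n
  proof -
    have "B n \<le> real (Suc n) * am_seq \<rho> n"
    proof (rule B_le)
      fix m assume "m \<le> n"
      have "\<phi> m \<le> real (Suc m) * am_seq \<rho> m"
        unfolding \<phi>_def by (intro mult_left_mono am_seq_ge[OF c0_star_decseq[OF \<rho>]]) simp
      also have "\<dots> \<le> real (Suc n) * am_seq \<rho> n"
        by (rule quasiconcave_le[OF am_seq_quasiconcave[OF \<rho>] \<open>m \<le> n\<close>])
      finally show "\<phi> m \<le> real (Suc n) * am_seq \<rho> n" .
    qed
    then show ?thesis by (simp add: \<mu>_def divide_le_eq mult.commute del: of_nat_Suc)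
  qed
  then have "\<mu> \<longlonglongrightarrow> 0"
    by (intro tendsto_sandwich[OF _ _ tendsto_const c0_star_tendsto[OF am_seq_c0_star[OF \<rho>]]]
        always_eventually allI \<mu>0)
  moreover have "mono (\<lambda>n. real (Suc n) * \<mu> n)"
    unfolding mono_iff_le_Suc using B_mono by (simp add: \<mu>_def)
  ultimately have "quasiconcave \<mu>"
    using \<mu>0 dec by (simp add: quasiconcave_def c0_star_def decseq_Suc_iff)
  moreover have "dominated \<mu> \<kappa>" if \<kappa>: "quasiconcave \<kappa>" "dominated \<rho> \<kappa>" for \<kappa>
  proof -
    obtain M where M: "M > 0" "\<And>n. \<rho> n \<le> M * \<kappa> n"
      using dominated_pos[OF \<kappa>(2)] c0_star_nonneg[OF quasiconcave_c0_star[OF \<kappa>(1)]] by blast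
    have "\<mu> n \<le> M * \<kappa> n" for n
    proof -
      have "B n \<le> M * (real (Suc n) * \<kappa> n)"
      proof (rule B_le)
        fix m assume "m \<le> n"
        have "\<phi> m \<le> real (Suc m) * (M * \<kappa> m)" unfolding \<phi>_def by (rule mult_left_mono[OF M(2)]) simp
        also have "\<dots> = M * (real (Suc m) * \<kappa> m)" by (simp only: mult_ac)
        also have "\<dots> \<le> M * (real (Suc n) * \<kappa> n)"
          using M(1) by (intro mult_left_mono quasiconcave_le[OF \<kappa>(1) \<open>m \<le> n\<close>]) simp
        finally show "\<phi> m \<le> M * (real (Suc n) * \<kappa> n)" .
      qed
      then show ?thesis by (simp add: \<mu>_def divide_le_eq mult_ac del: of_nat_Suc)
    qed
    then show ?thesis by (rule dominatedI)
  qed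
  ultimately show ?thesis using that ge by blast
qed

section \<open>The ideal \<open>se_omega\<close> and envelopes at infinity\<close>

definition se_set :: "(nat \<Rightarrow> real) set" where
  "se_set = {\<xi> \<in> c0_star. (\<lambda>n. real (Suc n) * \<xi> n) \<longlonglongrightarrow> 0}"

definition omega :: "nat \<Rightarrow> real" where
  "omega n = 1 / real (Suc n)"

lemma omega_c0_star: "omega \<in> c0_star"
  unfolding omega_def[abs_def] c0_star_def
  using LIMSEQ_Suc[OF lim_1_over_n] by (auto simp: decseq_def intro!: divide_left_mono)

lemma se_set_smallo: "se_set = {\<xi> \<in> c0_star. \<xi> \<in> o(\<lambda>n. 1 / real (Suc n))}"
proof -
  have "(\<lambda>n. real (Suc n) * \<xi> n) \<longlonglongrightarrow> 0 \<longleftrightarrow> \<xi> \<in> o(\<lambda>n. 1 / real (Suc n))" for \<xi>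
  proof -
    have eq: "(\<lambda>n. \<xi> n / (1 / real (Suc n))) = (\<lambda>n. real (Suc n) * \<xi> n)" by (auto simp: mult.commute)
    show ?thesis
      using smalloD_tendsto[of \<xi> sequentially "\<lambda>n. 1 / real (Suc n)"]
        smalloI_tendsto[of \<xi> "\<lambda>n. 1 / real (Suc n)" sequentially]
      unfolding eq by (auto simp: always_eventually)
  qed
  then show ?thesis by (auto simp: se_set_def)
qed

lemma is_char_set_se_set: "is_char_set se_set"
proof (rule is_char_setI)
  show "(\<lambda>n. 0) \<in> se_set" by (simp add: se_set_def c0_star_zero)
  show "(\<lambda>n. \<xi> n + \<eta> n) \<in> se_set" if "\<xi> \<in> se_set" "\<eta> \<in> se_set" for \<xi> \<eta>
    using that tendsto_add[of "\<lambda>n. real (Suc n) * \<xi> n" 0 sequentially "\<lambda>n. real (Suc n) * \<eta> n" 0]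
    by (simp add: se_set_def c0_star_add distrib_left del: of_nat_Suc)
  show "\<eta> \<in> se_set" if "\<xi> \<in> se_set" "\<eta> \<in> c0_star" and dom: "dominated \<eta> \<xi>" for \<xi> \<eta>
  proof -
    obtain M where M: "\<And>n. \<eta> n \<le> M * \<xi> n" using dom by (auto simp: dominated_def)
    have "(\<lambda>n. real (Suc n) * \<eta> n) \<longlonglongrightarrow> 0"
    proof (rule tendsto_sandwich[of "\<lambda>_. 0" _ _ "\<lambda>n. M * (real (Suc n) * \<xi> n)"])
      show "\<forall>\<^sub>F n in sequentially. real (Suc n) * \<eta> n \<le> M * (real (Suc n) * \<xi> n)"
        using mult_left_mono[OF M, of "real (Suc _)"] by (intro always_eventually allI) (simp add: mult_ac)
      show "(\<lambda>n. M * (real (Suc n) * \<xi> n)) \<longlonglongrightarrow> 0"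
        using that(1) by (intro tendsto_mult_right_zero) (simp add: se_set_def)
    qed (use c0_star_nonneg[OF that(2)] in auto)
    then show ?thesis using that(2) by (simp add: se_set_def)
  qed
  show "(\<lambda>n. \<xi> (n div 2)) \<in> se_set" if \<xi>: "\<xi> \<in> se_set" for \<xi>
  proof -
    have c0: "\<xi> \<in> c0_star" and lim: "(\<lambda>n. real (Suc n) * \<xi> n) \<longlonglongrightarrow> 0" using \<xi> by (auto simp: se_set_def)
    have "(\<lambda>n. real (Suc n) * \<xi> (n div 2)) \<longlonglongrightarrow> 0"
    proof (rule tendsto_sandwich[of "\<lambda>_. 0" _ _ "\<lambda>n. 2 * (real (Suc (n div 2)) * \<xi> (n div 2))"])
      have "real (Suc n) * \<xi> (n div 2) \<le> 2 * (real (Suc (n div 2)) * \<xi> (n div 2))" for n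
        using mult_right_mono[OF real_Suc_le_ampliation[of n 1] c0_star_nonneg[OF c0, of "n div 2 ^ 1"]]
        by (simp add: mult.assoc del: of_nat_Suc)
      then show "\<forall>\<^sub>F n in sequentially. real (Suc n) * \<xi> (n div 2) \<le> 2 * (real (Suc (n div 2)) * \<xi> (n div 2))"
        by (intro always_eventually allI)
      show "(\<lambda>n. 2 * (real (Suc (n div 2)) * \<xi> (n div 2))) \<longlonglongrightarrow> 0"
        by (rule tendsto_mult_right_zero[OF filterlim_compose[OF lim filterlim_div_sequentially]]) simp
    qed (use c0_star_nonneg[OF c0] in auto)
    then show ?thesis using c0_star_ampliation[OF c0, of 2] by (simp add: se_set_def)
  qed
qed (simp add: se_set_def)

lemma quasiconvex_se_set: "quasiconvex \<kappa> \<Longrightarrow> \<kappa> \<in> se_set"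
  by (simp add: quasiconvex_def se_set_def)

lemma interior_inf_set_se_set: "interior_inf_set S \<subseteq> se_set"
  using is_char_setD(3)[OF is_char_set_se_set quasiconvex_se_set] by (auto simp: interior_inf_set_def)

lemma quasiconvex_dominated_omega: "quasiconvex \<kappa> \<Longrightarrow> dominated \<kappa> omega"
  using quasiconvex_le[of \<kappa> 0] by (intro dominatedI[of _ "\<kappa> 0"]) (simp add: omega_def le_divide_eq mult.commute)

text \<open>Membership in \<open>se_set\<close> makes the suprema of
  \<open>(m + 1) * \<rho> m\<close> over \<open>m \<ge> n\<close> finite and lets them tend to
  0.\<close>

lemma quasiconvex_upper_envelope:
  assumes \<rho>: "\<rho> \<in> se_set"
  obtains \<mu> where "quasiconvex \<mu>" "\<And>n. \<rho> n \<le> \<mu> n"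
    "\<And>\<kappa>. quasiconvex \<kappa> \<Longrightarrow> dominated \<rho> \<kappa> \<Longrightarrow> dominated \<mu> \<kappa>"
proof -
  define \<phi> where "\<phi> m = real (Suc m) * \<rho> m" for m
  have c0: "\<rho> \<in> c0_star" and lim: "\<phi> \<longlonglongrightarrow> 0" using \<rho> by (auto simp: se_set_def \<phi>_def[abs_def])
  have \<phi>0: "0 \<le> \<phi> m" for m using c0_star_nonneg[OF c0] by (simp add: \<phi>_def)
  obtain M where M: "\<And>n. \<phi> n \<le> M"
    using Bseq_bdd_above[OF convergent_imp_Bseq[OF convergentI[OF lim]]] by (auto simp: bdd_above_def)
  define B where "B n = (SUP m\<in>{n..}. \<phi> m)" for n
  have bdd: "bdd_above (\<phi> ` {n..})" for n by (rule bdd_aboveI[of _ M]) (auto simp: M)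
  have B_ge: "\<phi> m \<le> B n" if "n \<le> m" for m n
    unfolding B_def by (rule cSUP_upper[OF _ bdd]) (use that in simp)
  have B_le: "B n \<le> c" if "\<And>m. n \<le> m \<Longrightarrow> \<phi> m \<le> c" for c n
    unfolding B_def by (rule cSUP_least) (use that in auto)
  have B0: "0 \<le> B n" for n using order_trans[OF \<phi>0 B_ge] by blast
  have "decseq B" unfolding decseq_def
  proof (intro allI impI)
    fix m n :: nat assume "m \<le> n"
    show "B n \<le> B m" by (rule B_le[OF B_ge]) (use \<open>m \<le> n\<close> in simp)
  qed
  moreover have "B \<longlonglongrightarrow> 0"
  proof (rule LIMSEQ_I)
    fix r :: real assume "0 < r"
    then have "\<forall>\<^sub>F n in sequentially. \<phi> n < r / 2" using lim by (intro order_tendstoD(2)) auto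
    then obtain N where N: "\<And>n. n \<ge> N \<Longrightarrow> \<phi> n < r / 2" by (auto simp: eventually_sequentially)
    have "B n \<le> r / 2" if "N \<le> n" for n by (rule B_le) (use that N in \<open>auto intro: less_imp_le\<close>)
    then show "\<exists>N. \<forall>n\<ge>N. norm (B n - 0) < r" using B0 \<open>0 < r\<close> by (intro exI[of _ N]) fastforce
  qed
  ultimately have "quasiconvex (\<lambda>n. B n / real (Suc n))" by (rule quasiconvexI[OF B0])
  moreover have "\<rho> n \<le> B n / real (Suc n)" for n
    using B_ge[of n n] by (simp add: \<phi>_def le_divide_eq mult.commute del: of_nat_Suc)
  moreover have "dominated (\<lambda>n. B n / real (Suc n)) \<kappa>" if \<kappa>: "quasiconvex \<kappa>" "dominated \<rho> \<kappa>" for \<kappa>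
  proof -
    obtain M where M: "M > 0" "\<And>n. \<rho> n \<le> M * \<kappa> n"
      using dominated_pos[OF \<kappa>(2)] c0_star_nonneg[OF quasiconvex_c0_star[OF \<kappa>(1)]] by blast
    have "B n / real (Suc n) \<le> M * \<kappa> n" for n
    proof -
      have "B n \<le> M * (real (Suc n) * \<kappa> n)"
      proof (rule B_le)
        fix m assume "n \<le> m"
        have "\<phi> m \<le> real (Suc m) * (M * \<kappa> m)" unfolding \<phi>_def by (rule mult_left_mono[OF M(2)]) simp
        also have "\<dots> = M * (real (Suc m) * \<kappa> m)" by (simp only: mult_ac)
        also have "\<dots> \<le> M * (real (Suc n) * \<kappa> n)"
          using M(1) by (intro mult_left_mono quasiconvex_le[OF \<kappa>(1) \<open>n \<le> m\<close>]) simp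
        finally show "\<phi> m \<le> M * (real (Suc n) * \<kappa> n)" .
      qed
      then show ?thesis by (simp add: divide_le_eq mult_ac del: of_nat_Suc)
    qed
    then show ?thesis by (rule dominatedI)
  qed
  ultimately show ?thesis using that by blast
qed

text \<open>If \<open>(n + 1) * \<rho> n\<close> were bounded below by a positive constant,
  \<open>omega\<close> would be dominated by \<rho>; hence the running minimum tends to 0. The value
  at 0 is recorded because it keeps the ideal of the envelope nonzero when that of \<rho>
  is.\<close>

lemma quasiconvex_lower_envelope:
  assumes \<rho>: "\<rho> \<in> c0_star" and "omega \<notin> principal_char_set \<rho>"
  obtains \<nu> where "quasiconvex \<nu>" "\<And>n. \<nu> n \<le> \<rho> n" "\<nu> 0 = \<rho> 0"
    "\<And>\<kappa>. quasiconvex \<kappa> \<Longrightarrow> \<kappa> \<in> principal_char_set \<rho> \<Longrightarrow> \<kappa> \<in> principal_char_set \<nu>"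
proof -
  define \<phi> where "\<phi> m = real (Suc m) * \<rho> m" for m
  have \<phi>0: "0 \<le> \<phi> m" for m using c0_star_nonneg[OF \<rho>] by (simp add: \<phi>_def)
  define I where "I n = Min (\<phi> ` {..n})" for n
  have I_le: "I n \<le> \<phi> m" if "m \<le> n" for m n unfolding I_def using that by (intro Min_le) auto
  have I_ge: "c \<le> I n" if "\<And>m. m \<le> n \<Longrightarrow> c \<le> \<phi> m" for c n unfolding I_def using that by (subst Min_ge_iff) auto
  have I0: "0 \<le> I n" for n by (rule I_ge[OF \<phi>0])
  have "decseq I" unfolding decseq_def
  proof (intro allI impI)
    fix m n :: nat assume "m \<le> n"
    show "I n \<le> I m" by (rule I_ge[OF I_le]) (use \<open>m \<le> n\<close> in simp)
  qed
  moreover have "I \<longlonglongrightarrow> 0"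
  proof (rule LIMSEQ_I)
    fix r :: real assume "0 < r"
    have "\<not> (\<forall>n. omega n \<le> (1 / r) * \<rho> n)"
      using dominated_in_principal_char_set[OF omega_c0_star dominatedI] assms(2) by blast
    then obtain N where "\<phi> N < r"
      using \<open>0 < r\<close> by (auto simp: omega_def \<phi>_def not_le field_simps)
    then have "norm (I n - 0) < r" if "N \<le> n" for n using I_le[OF that] I0[of n] by simp
    then show "\<exists>N. \<forall>n\<ge>N. norm (I n - 0) < r" by blast
  qed
  ultimately have qc: "quasiconvex (\<lambda>n. I n / real (Suc n))" by (rule quasiconvexI[OF I0])
  have le: "I n / real (Suc n) \<le> \<rho> n" for n
    using I_le[of n n] by (simp add: \<phi>_def divide_le_eq mult.commute del: of_nat_Suc)
  have zero: "I 0 / real (Suc 0) = \<rho> 0" by (simp add: I_def \<phi>_def)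
  have "\<kappa> \<in> principal_char_set (\<lambda>n. I n / real (Suc n))"
    if \<kappa>: "quasiconvex \<kappa>" "\<kappa> \<in> principal_char_set \<rho>" for \<kappa>
  proof -
    obtain k M where M: "M > 0" "\<And>n. \<kappa> n \<le> M * \<rho> (n div 2 ^ k)"
      by (rule in_principal_char_setD[OF \<kappa>(2) \<rho>]) blast
    have "\<kappa> n \<le> (M * 2 ^ k) * (I (n div 2 ^ k) / real (Suc (n div 2 ^ k)))" for n
    proof -
      have "real (Suc n) * \<kappa> n / (M * 2 ^ k) \<le> I (n div 2 ^ k)"
      proof (rule I_ge)
        fix m assume m: "m \<le> n div 2 ^ k"
        \<comment> \<open>Here \<open>(j + 1) * \<kappa> j\<close> decreases, so \<kappa> has to be
          evaluated at an index below \<open>n\<close>. For \<open>2 ^ k * m\<close> this means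
          \<open>m \<le> n div 2 ^ k\<close>, whence the ampliation of the envelope in the
          result.\<close>
        have "2 ^ k * m \<le> n" using mult_le_mono2[OF m, of "2 ^ k"] times_div_less_eq_dividend[of "2 ^ k" n] by linarith
        then have "real (Suc n) * \<kappa> n \<le> real (Suc (2 ^ k * m)) * \<kappa> (2 ^ k * m)"
          by (rule quasiconvex_le[OF \<kappa>(1)])
        also have "\<dots> \<le> real (Suc (2 ^ k * m)) * (M * \<rho> m)"
          using M(2)[of "2 ^ k * m"] by (intro mult_left_mono) auto
        also have "\<dots> \<le> (2 ^ k * real (Suc m)) * (M * \<rho> m)"
          using M(1) c0_star_nonneg[OF \<rho>] by (intro mult_right_mono) (auto simp: algebra_simps)
        finally show "real (Suc n) * \<kappa> n / (M * 2 ^ k) \<le> \<phi> m"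
          using M(1) by (simp add: divide_le_eq \<phi>_def mult_ac)
      qed
      then have "\<kappa> n \<le> (M * 2 ^ k) * I (n div 2 ^ k) / real (Suc n)" using M(1) by (simp add: field_simps)
      also have "\<dots> \<le> (M * 2 ^ k) * I (n div 2 ^ k) / real (Suc (n div 2 ^ k))"
        using M(1) I0 by (intro divide_left_mono) auto
      finally show ?thesis by simp
    qed
    then show ?thesis by (rule in_principal_char_setI[OF quasiconvex_c0_star[OF \<kappa>(1)]])
  qed
  then show ?thesis using that[OF qc le zero] by blast
qed

section \<open>Modifying a sequence on long flat stretches\<close>

text \<open>Comparability with both ends and in both directions serves increasing and decreasing
  \<open>(n + 1) * \<rho> n\<close> alike.\<close>

definition flat_on :: "(nat \<Rightarrow> real) \<Rightarrow> nat \<Rightarrow> nat \<Rightarrow> bool" where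
  "flat_on \<rho> p q \<longleftrightarrow> (\<forall>n\<in>{p..q}.
     real (Suc n) * \<rho> n \<le> 2 * (real (Suc p) * \<rho> p) \<and> real (Suc n) * \<rho> n \<le> 2 * (real (Suc q) * \<rho> q) \<and>
     real (Suc p) * \<rho> p \<le> 2 * (real (Suc n) * \<rho> n) \<and> real (Suc q) * \<rho> q \<le> 2 * (real (Suc n) * \<rho> n))"

text \<open>Arbitrary \<open>K\<close> is there to beat any constant together with any ampliation,
  arbitrary \<open>N\<close> to find infinitely many disjoint stretches.\<close>

definition long_flat :: "(nat \<Rightarrow> real) \<Rightarrow> bool" where
  "long_flat \<rho> \<longleftrightarrow> (\<forall>K N. \<exists>p\<ge>N. \<exists>q. 2 ^ K * Suc p \<le> Suc q \<and> flat_on \<rho> p q)"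

text \<open>
  On disjoint flat stretches from \<open>p\<close> to \<open>q\<close> of unbounded relative length, \<open>\<eta>\<^sub>1\<close> drops to \<open>\<rho> q\<close>
  immediately after \<open>p\<close>, whereas \<open>\<eta>\<^sub>2\<close> keeps the value \<open>\<rho> p\<close> until just before \<open>q\<close>. Running
  suprema and infima of \<open>(n + 1) \<rho> n\<close> change by a factor 2 at most.
\<close>

lemma flat_modification:
  assumes \<rho>: "\<rho> \<in> c0_star" and pos: "\<And>n. 0 < \<rho> n" and flat: "long_flat \<rho>"
  obtains \<eta>\<^sub>1 \<eta>\<^sub>2 where "\<eta>\<^sub>1 \<in> c0_star" "\<eta>\<^sub>2 \<in> c0_star" "\<And>n. \<eta>\<^sub>1 n \<le> \<rho> n" "\<And>n. \<rho> n \<le> \<eta>\<^sub>2 n"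
    "\<rho> \<notin> principal_char_set \<eta>\<^sub>1" "\<eta>\<^sub>2 \<notin> principal_char_set \<rho>"
    "\<And>n. \<exists>p\<le>n. real (Suc n) * \<rho> n \<le> 2 * (real (Suc p) * \<eta>\<^sub>1 p)"
    "\<And>n. \<exists>q\<ge>n. real (Suc n) * \<rho> n \<le> 2 * (real (Suc q) * \<eta>\<^sub>1 q)"
    "\<And>n. \<exists>p\<le>n. real (Suc p) * \<eta>\<^sub>2 p \<le> 2 * (real (Suc n) * \<rho> n)"
    "\<And>n. \<exists>q\<ge>n. real (Suc q) * \<eta>\<^sub>2 q \<le> 2 * (real (Suc n) * \<rho> n)"
proof -
  \<comment> \<open>The relative length contains one factor 2 more than the bound \<open>len\<close>
    below; it absorbs the difference between \<open>q k\<close> and \<open>Suc (q k)\<close> in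
    \<open>short\<close>.\<close>
  define stretch where "stretch k x \<longleftrightarrow> 2 ^ Suc (Suc k) * Suc (fst x) \<le> Suc (snd x) \<and> flat_on \<rho> (fst x) (snd x)"
    for k x
  have "\<exists>x. N \<le> fst x \<and> stretch k x" for N k
    using flat unfolding long_flat_def stretch_def by (metis fst_conv snd_conv)
  then have "\<exists>f. \<forall>k. stretch k (f k) \<and> Suc (snd (f k)) \<le> fst (f (Suc k))"
    by (intro dependent_nat_choice) blast+
  then obtain f where f: "\<And>k. stretch k (f k)" "\<And>k. Suc (snd (f k)) \<le> fst (f (Suc k))" by blast
  define p q where "p k = fst (f k)" and "q k = snd (f k)" for k
  have len': "2 ^ Suc (Suc k) * Suc (p k) \<le> Suc (q k)" and fl: "flat_on \<rho> (p k) (q k)" for k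
    using f(1)[of k] by (simp_all only: stretch_def p_def q_def)
  have len: "2 ^ Suc k * Suc (p k) \<le> Suc (q k)" for k
    by (rule order_trans[OF _ len']) (intro mult_right_mono power_increasing; simp)
  have q_p: "q k < p (Suc k)" for k using f(2)[of k] by (simp add: p_def q_def)
  have p_q: "p k < q k" for k
  proof -
    have "2 * Suc (p k) \<le> 2 ^ Suc k * Suc (p k)" by (intro mult_right_mono) (simp_all add: self_le_power)
    from order_trans[OF this len[of k]] show ?thesis by simp
  qed
  have q_p': "q j < p k" if "j < k" for j k
    using that
  proof (induction k)
    case (Suc k)
    then show ?case using q_p[of k] p_q[of k] by (cases "j = k") auto
  qed simp
  \<comment> \<open>Only the interiors of the stretches are collected: their ends stay outside
    \<open>U\<close>, so there both modifications agree with \<rho>.\<close>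
  define U where "U = (\<Union>k. {p k<..<q k})"
  have p_U: "p k \<notin> U" and q_U: "q k \<notin> U" for k
  proof -
    have "\<not> (p j < p k \<and> p k < q j)" "\<not> (p j < q k \<and> q k < q j)" for j
      using q_p'[of j k] q_p'[of k j] p_q[of j] p_q[of k] by (cases j k rule: linorder_cases; simp)+
    then show "p k \<notin> U" "q k \<notin> U" by (auto simp: U_def)
  qed
  \<comment> \<open>\<open>a n\<close> is the next and \<open>b n\<close> the previous index outside
    \<open>U\<close>. Both maps are monotone, so \<open>\<rho> \<circ> a\<close> and
    \<open>\<rho> \<circ> b\<close> are again nonincreasing, and they lie below and above
    \<rho>.\<close>
  define a where "a n = (LEAST m. n \<le> m \<and> m \<notin> U)" for n
  define b where "b n = (GREATEST m. m \<le> n \<and> m \<notin> U)" for n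
  have a_ex: "\<exists>m. n \<le> m \<and> m \<notin> U" for n
    using q_U unfolding U_def by (metis (no_types, lifting) UN_E greaterThanLessThan_iff le_refl less_imp_le)
  have b_ex: "\<exists>m. m \<le> n \<and> m \<notin> U" for n
    using p_U unfolding U_def by (metis (no_types, lifting) UN_E greaterThanLessThan_iff le_refl less_imp_le)
  have a: "n \<le> a n" "a n \<notin> U" for n using LeastI_ex[OF a_ex[of n]] by (auto simp: a_def)
  have a_le: "a n \<le> m" if "n \<le> m" "m \<notin> U" for m n unfolding a_def by (rule Least_le) (use that in simp)
  have b: "b n \<le> n" "b n \<notin> U" for n using GreatestI_ex_nat[OF b_ex[of n], of n] by (auto simp: b_def)
  have b_ge: "m \<le> b n" if "m \<le> n" "m \<notin> U" for m n
    unfolding b_def by (rule Greatest_le_nat[where b = n]) (use that in auto)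
  have good: "a n = n" "b n = n" if "n \<notin> U" for n
    using a(1)[of n] a_le[OF le_refl that] b(1)[of n] b_ge[OF le_refl that] by auto
  have inside: "a n = q k" "b n = p k" if "p k < n" "n < q k" for n k
  proof -
    have "a n \<le> q k" using a_le[OF less_imp_le[OF that(2)] q_U] .
    moreover have "\<not> a n < q k" using a[of n] that by (auto simp: U_def)
    ultimately show "a n = q k" by simp
    have "p k \<le> b n" using b_ge[OF less_imp_le[OF that(1)] p_U] .
    moreover have "\<not> p k < b n" using b[of n] that by (auto simp: U_def)
    ultimately show "b n = p k" by simp
  qed
  have cases: "n \<notin> U \<or> (\<exists>k. p k < n \<and> n < q k)" for n by (auto simp: U_def)
  have a_mono: "a m \<le> a n" if "m \<le> n" for m n using a_le[of m "a n"] a[of n] that by simp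
  have b_mono: "b m \<le> b n" if "m \<le> n" for m n using b_ge[of "b m" n] b[of m] that by simp
  define \<eta>\<^sub>1 \<eta>\<^sub>2 where "\<eta>\<^sub>1 n = \<rho> (a n)" and "\<eta>\<^sub>2 n = \<rho> (b n)" for n
  note anti = c0_star_antimono[OF \<rho>]
  have le1: "\<eta>\<^sub>1 n \<le> \<rho> n" and le2: "\<rho> n \<le> \<eta>\<^sub>2 n" for n
    unfolding \<eta>\<^sub>1_def \<eta>\<^sub>2_def using anti[OF a(1)] anti[OF b(1)] by auto
  have "\<eta>\<^sub>1 \<longlonglongrightarrow> 0"
    by (rule tendsto_sandwich[OF _ _ tendsto_const c0_star_tendsto[OF \<rho>]])
      (use le1 c0_star_nonneg[OF \<rho>] in \<open>auto simp: \<eta>\<^sub>1_def\<close>)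
  then have c1: "\<eta>\<^sub>1 \<in> c0_star"
    using c0_star_nonneg[OF \<rho>] anti[OF a_mono] by (auto simp: c0_star_def decseq_def \<eta>\<^sub>1_def)
  have "k \<le> p k" for k
  proof (induction k)
    case (Suc k)
    then show ?case using p_q[of k] q_p[of k] by linarith
  qed simp
  then have "Z \<le> b n" if "p Z \<le> n" for Z n using b_ge[OF that p_U] order_trans by blast
  then have "filterlim b sequentially sequentially"
    unfolding filterlim_at_top eventually_sequentially by blast
  then have "\<eta>\<^sub>2 \<longlonglongrightarrow> 0"
    unfolding \<eta>\<^sub>2_def using filterlim_compose[OF c0_star_tendsto[OF \<rho>]] by blast
  then have c2: "\<eta>\<^sub>2 \<in> c0_star"
    using c0_star_nonneg[OF \<rho>] anti[OF b_mono] by (auto simp: c0_star_def decseq_def \<eta>\<^sub>2_def)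
  have at_ends: "\<eta>\<^sub>1 n = \<rho> n" "\<eta>\<^sub>2 n = \<rho> n" if "n \<notin> U" for n
    using good[OF that] by (simp_all add: \<eta>\<^sub>1_def \<eta>\<^sub>2_def)
  have flat_ends: "\<exists>p\<le>n. \<exists>q\<ge>n. p \<notin> U \<and> q \<notin> U \<and> flat_on \<rho> p q" for n
  proof (cases "n \<in> U")
    case True
    then obtain k where "p k < n" "n < q k" using cases by blast
    then show ?thesis using p_U q_U fl by (meson less_imp_le)
  next
    case False
    have "flat_on \<rho> n n" using c0_star_nonneg[OF \<rho>, of n] by (simp add: flat_on_def)
    with False show ?thesis by blast
  qed
  \<comment> \<open>The exponent \<open>j + 2\<close> collects the ampliation by
    \<open>2 ^ j\<close>, the factor 2 of flatness, and another factor 2 from rounding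
    indices.\<close>
  have large: "\<exists>k\<ge>j. C * 2 ^ (j + 2) < 2 ^ Suc k" for C :: real and j
  proof -
    obtain l where "C < 2 ^ l" using real_arch_pow[of 2 C] by auto
    then have "C * 2 ^ (j + 2) < 2 ^ Suc (j + l + 1)" by (simp add: power_add)
    then show ?thesis by (intro exI[of _ "j + l + 1"]) simp
  qed
  have len_real: "2 ^ Suc k * real (Suc (p k)) \<le> real (Suc (q k))" for k
    using of_nat_mono[OF len[of k], where 'a = real] by (simp only: of_nat_mult of_nat_power of_nat_numeral)
  have short: "2 ^ j * Suc (p k) < q k" if "j \<le> k" for j k
  proof -
    have "2 ^ j * Suc (p k) \<le> 2 ^ k * Suc (p k)" using that by (intro mult_right_mono power_increasing) auto
    moreover have "0 < 2 ^ k * Suc (p k)" by simp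
    moreover have "4 * (2 ^ k * Suc (p k)) \<le> Suc (q k)" using len'[of k] by simp
    ultimately show ?thesis by linarith
  qed
  have n1: "\<rho> \<notin> principal_char_set \<eta>\<^sub>1"
  proof
    assume "\<rho> \<in> principal_char_set \<eta>\<^sub>1"
    then obtain j M where M: "M > 0" "\<And>n. \<rho> n \<le> M * \<eta>\<^sub>1 (n div 2 ^ j)"
      by (rule in_principal_char_setD[OF _ c1]) blast
    obtain k where k: "j \<le> k" "M * 2 ^ (j + 2) < 2 ^ Suc k" using large by blast
    \<comment> \<open>The ampliated index of \<open>n\<close> is \<open>Suc (p k)\<close>, where
      \<open>\<eta>\<^sub>1\<close> has already dropped to \<open>\<rho> (q k)\<close>, while
      \<open>n\<close> itself is close to the left end of the stretch.\<close>
    define n where "n = 2 ^ j * Suc (p k)"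
    have "n < q k" unfolding n_def by (rule short[OF k(1)])
    have "p k < n" unfolding n_def by (metis Suc_le_eq mult_le_mono1 mult_1 one_le_numeral one_le_power)
    have "a (Suc (p k)) = q k"
    proof (cases "Suc (p k) = q k")
      case True
      then show ?thesis using good[OF q_U] by simp
    next
      case False
      then show ?thesis using inside[of k "Suc (p k)"] p_q[of k] by simp
    qed
    then have "\<rho> n \<le> M * \<rho> (q k)" using M(2)[of n] by (simp add: n_def \<eta>\<^sub>1_def)
    have "real (Suc (q k)) * \<rho> (q k) \<le> 2 * (real (Suc n) * \<rho> n)"
      using fl[of k] \<open>p k < n\<close> \<open>n < q k\<close> unfolding flat_on_def by auto
    also have "\<dots> \<le> 2 * (real (Suc n) * (M * \<rho> (q k)))"
      using \<open>\<rho> n \<le> M * \<rho> (q k)\<close> by (intro mult_left_mono) auto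
    finally have "real (Suc (q k)) * \<rho> (q k) \<le> (2 * M * real (Suc n)) * \<rho> (q k)" by (simp only: mult_ac)
    then have "real (Suc (q k)) \<le> 2 * M * real (Suc n)" using pos[of "q k"] by (rule mult_right_le_imp_le)
    also have "\<dots> \<le> 2 * M * (2 ^ Suc j * real (Suc (p k)))"
    proof (intro mult_left_mono)
      have "2 ^ Suc j * Suc (p k) = 2 * n" by (simp only: n_def power_Suc mult.assoc)
      then have "Suc n \<le> 2 ^ Suc j * Suc (p k)" using \<open>p k < n\<close> by linarith
      from of_nat_mono[OF this, where 'a = real] show "real (Suc n) \<le> 2 ^ Suc j * real (Suc (p k))"
        by (simp only: of_nat_mult of_nat_power of_nat_numeral)
    qed (use M(1) in simp)
    also have "\<dots> = (M * 2 ^ (j + 2)) * real (Suc (p k))" by (simp add: power_add del: of_nat_Suc)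
    finally have "2 ^ Suc k * real (Suc (p k)) \<le> (M * 2 ^ (j + 2)) * real (Suc (p k))"
      by (rule order_trans[OF len_real])
    then have "2 ^ Suc k \<le> M * 2 ^ (j + 2)" by (rule mult_right_le_imp_le) simp
    then show False using k(2) by simp
  qed
  have n2: "\<eta>\<^sub>2 \<notin> principal_char_set \<rho>"
  proof
    assume "\<eta>\<^sub>2 \<in> principal_char_set \<rho>"
    then obtain j M where M: "M > 0" "\<And>n. \<eta>\<^sub>2 n \<le> M * \<rho> (n div 2 ^ j)"
      by (rule in_principal_char_setD[OF _ \<rho>]) blast
    obtain k where k: "j \<le> k" "M * 2 ^ (j + 2) < 2 ^ Suc k" using large by blast
    \<comment> \<open>The mirror image: at the last index before \<open>q k\<close>, the sequence
      \<open>\<eta>\<^sub>2\<close> still has the value \<open>\<rho> (p k)\<close>, while the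
      ampliated index \<open>m\<close> is far to the right of \<open>p k\<close>.\<close>
    define n m where "n = q k - 1" and "m = n div 2 ^ j"
    have "q k = Suc n" using p_q[of k] by (simp add: n_def)
    have "b n = p k"
    proof (cases "n = p k")
      case True
      then show ?thesis using good[OF p_U] by simp
    next
      case False
      then show ?thesis using inside[of k n] p_q[of k] by (simp add: n_def)
    qed
    then have le: "\<rho> (p k) \<le> M * \<rho> m" using M(2)[of n] by (simp add: \<eta>\<^sub>2_def m_def)
    have "Suc (p k) * 2 ^ j \<le> n" using short[OF k(1)] by (simp add: n_def mult.commute)
    then have "Suc (p k) \<le> m" unfolding m_def by (metis div_le_mono nonzero_mult_div_cancel_right power_not_zero zero_neq_numeral)
    moreover have "m \<le> q k" using div_le_dividend[of n "2 ^ j"] \<open>q k = Suc n\<close> unfolding m_def by linarith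
    ultimately have "real (Suc m) * \<rho> m \<le> 2 * (real (Suc (p k)) * \<rho> (p k))"
      using fl[of k] unfolding flat_on_def by auto
    also have "\<dots> \<le> 2 * (real (Suc (p k)) * (M * \<rho> m))" using le by (intro mult_left_mono) auto
    finally have "real (Suc m) * \<rho> m \<le> (2 * M * real (Suc (p k))) * \<rho> m" by (simp only: mult_ac)
    then have m_le: "real (Suc m) \<le> 2 * M * real (Suc (p k))" using pos[of m] by (rule mult_right_le_imp_le)
    have "real (q k) \<le> 2 ^ j * real (Suc m)"
      using real_Suc_le_ampliation[of n j] \<open>q k = Suc n\<close> by (simp only: m_def)
    moreover have "1 \<le> 2 ^ j * real (Suc m)"
      using mult_mono[of 1 "2 ^ j" 1 "real (Suc m)"] by simp
    ultimately have "real (Suc (q k)) \<le> 2 ^ Suc j * real (Suc m)" by simp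
    also have "\<dots> \<le> 2 ^ Suc j * (2 * M * real (Suc (p k)))" by (rule mult_left_mono[OF m_le]) simp
    also have "\<dots> = (M * 2 ^ (j + 2)) * real (Suc (p k))" by (simp add: power_add del: of_nat_Suc)
    finally have "2 ^ Suc k * real (Suc (p k)) \<le> (M * 2 ^ (j + 2)) * real (Suc (p k))"
      by (rule order_trans[OF len_real])
    then have "2 ^ Suc k \<le> M * 2 ^ (j + 2)" by (rule mult_right_le_imp_le) simp
    then show False using k(2) by simp
  qed
  show ?thesis
  proof (rule that[OF c1 c2 le1 le2 n1 n2])
    fix n
    obtain r s where rs: "r \<le> n" "n \<le> s" "r \<notin> U" "s \<notin> U" "flat_on \<rho> r s" using flat_ends by blast
    then have bounds: "real (Suc n) * \<rho> n \<le> 2 * (real (Suc r) * \<rho> r)" "real (Suc n) * \<rho> n \<le> 2 * (real (Suc s) * \<rho> s)"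
      "real (Suc r) * \<rho> r \<le> 2 * (real (Suc n) * \<rho> n)" "real (Suc s) * \<rho> s \<le> 2 * (real (Suc n) * \<rho> n)"
      unfolding flat_on_def by auto
    show "\<exists>p\<le>n. real (Suc n) * \<rho> n \<le> 2 * (real (Suc p) * \<eta>\<^sub>1 p)"
      "\<exists>q\<ge>n. real (Suc n) * \<rho> n \<le> 2 * (real (Suc q) * \<eta>\<^sub>1 q)"
      "\<exists>p\<le>n. real (Suc p) * \<eta>\<^sub>2 p \<le> 2 * (real (Suc n) * \<rho> n)"
      "\<exists>q\<ge>n. real (Suc q) * \<eta>\<^sub>2 q \<le> 2 * (real (Suc n) * \<rho> n)"
      using bounds
        at_ends[OF rs(3)] at_ends[OF rs(4)] rs(1,2) by metis+
  qed
qed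

lemma omega_long_flat: "long_flat omega"
  unfolding long_flat_def
proof (intro allI)
  fix K N :: nat
  have "2 ^ K * Suc N \<le> Suc (2 ^ K * Suc N)" "flat_on omega N (2 ^ K * Suc N)"
    by (simp_all add: flat_on_def omega_def del: of_nat_Suc)
  then show "\<exists>p\<ge>N. \<exists>q. 2 ^ K * Suc p \<le> Suc q \<and> flat_on omega p q" by blast
qed

section \<open>Instability produces long flat stretches\<close>

lemma pre_am_set_subset:
  assumes "is_char_set S"
  shows "pre_am_set S \<subseteq> S"
proof
  fix \<xi> assume "\<xi> \<in> pre_am_set S"
  then have \<xi>: "\<xi> \<in> c0_star" "am_seq \<xi> \<in> S" by (auto simp: pre_am_set_def)
  have "dominated \<xi> (am_seq \<xi>)"
    using am_seq_ge[OF c0_star_decseq[OF \<xi>(1)]] by (intro dominatedI[of _ 1]) simp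
  then show "\<xi> \<in> S" by (rule is_char_setD(3)[OF assms \<xi>(2,1)])
qed

text \<open>By contraposition. Without long flat stretches, \<open>(n + 1) * \<rho> n\<close>
  doubles, beyond some index, whenever the index grows by a fixed factor. The partial sums of \<rho>
  are then at most a constant multiple of it, so \<open>am_seq \<rho>\<close> is dominated by
  \<rho>.\<close>

lemma quasiconcave_unstable_long_flat:
  assumes \<rho>: "quasiconcave \<rho>" and "0 < \<rho> 0"
    and unstable: "pre_am_set (principal_char_set \<rho>) \<noteq> principal_char_set \<rho>"
  shows "long_flat \<rho>"
proof (rule ccontr)
  assume "\<not> long_flat \<rho>"
  then obtain K N where no: "\<And>p q. N \<le> p \<Longrightarrow> 2 ^ K * Suc p \<le> Suc q \<Longrightarrow> \<not> flat_on \<rho> p q"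
    unfolding long_flat_def by blast
  define \<phi> where "\<phi> m = real (Suc m) * \<rho> m" for m
  have c0: "\<rho> \<in> c0_star" by (rule quasiconcave_c0_star[OF \<rho>])
  have \<phi>_mono: "\<phi> m \<le> \<phi> n" if "m \<le> n" for m n using quasiconcave_le[OF \<rho> that] by (simp add: \<phi>_def)
  have \<phi>_pos: "0 < \<phi> n" for n using \<phi>_mono[of 0 n] \<open>0 < \<rho> 0\<close> by (simp add: \<phi>_def)
  have growth: "2 * \<phi> p \<le> \<phi> q" if "N \<le> p" "2 ^ K * Suc p \<le> Suc q" for p q
  proof (rule ccontr)
    assume "\<not> ?thesis"
    then have "\<phi> q \<le> 2 * \<phi> p" by simp
    then have "flat_on \<rho> p q"
      unfolding flat_on_def \<phi>_def[symmetric] using \<phi>_mono \<phi>_pos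
      by (smt (verit, best) atLeastAtMost_iff)
    then show False using no[OF that] by simp
  qed
  define L where "L = (2 :: nat) ^ K"
  have "0 < L" by (simp add: L_def)
  define F where "F n = (\<Sum>j\<le>n. \<rho> j)" for n
  have F_mono: "F m \<le> F n" if "m \<le> n" for m n
    unfolding F_def using that c0_star_nonneg[OF c0] by (intro sum_mono2) auto
  \<comment> \<open>\<open>2 * real L\<close> pays for one block in the induction, the quotient for
    the initial indices, where no block of ratio \<open>L\<close> starting beyond \<open>N\<close>
    fits.\<close>
  define C where "C = 2 * real L + F (L * Suc N) / \<phi> 0"
  have "0 \<le> F (L * Suc N)" unfolding F_def by (intro sum_nonneg c0_star_nonneg[OF c0])
  then have C: "2 * real L \<le> C" "F (L * Suc N) \<le> C * \<phi> 0" "0 \<le> C"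
    using \<phi>_pos[of 0] by (auto simp: C_def distrib_right)
  have "F n \<le> C * \<phi> n" for n
  proof (induction n rule: less_induct)
    case (less n)
    show ?case
    proof (cases "Suc n \<le> L * Suc N")
      case True
      have "F n \<le> F (L * Suc N)" using True by (intro F_mono) simp
      also have "\<dots> \<le> C * \<phi> 0" by (rule C)
      also have "\<dots> \<le> C * \<phi> n" by (intro mult_left_mono \<phi>_mono C) simp
      finally show ?thesis .
    next
      case False
      \<comment> \<open>The largest \<open>p\<close> with \<open>L * Suc p \<le> Suc n\<close>. The
        block from \<open>p\<close> to \<open>n\<close> contributes at most
        \<open>2 * real L * \<phi> p\<close>, hence at most \<open>C * \<phi> p\<close>; together
        with the induction hypothesis this is \<open>2 * C * \<phi> p\<close>, and the doubling of
        \<phi> from \<open>p\<close> to \<open>n\<close> compensates the 2.\<close>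
      define p where "p = Suc n div L - 1"
      have "Suc N \<le> Suc n div L"
        using div_le_mono[of "L * Suc N" "Suc n" L] False \<open>0 < L\<close> by simp
      then have p: "Suc p = Suc n div L" "N \<le> p" by (auto simp: p_def)
      have "L * Suc p \<le> Suc n" unfolding p(1) by (rule times_div_less_eq_dividend)
      then have grow: "2 * \<phi> p \<le> \<phi> n" using growth[OF p(2), of n] by (simp only: L_def)
      have "Suc p \<le> Suc n" unfolding p(1) by (rule div_le_dividend)
      moreover have "p \<noteq> n" using grow \<phi>_pos[of n] by auto
      ultimately have "p < n" by simp
      have "Suc n < L * Suc (Suc p)"
        using dividend_less_times_div[OF \<open>0 < L\<close>, of "Suc n"] by (simp only: p(1) mult_Suc_right)
      also have "\<dots> \<le> L * (2 * Suc p)" by (intro mult_left_mono) auto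
      finally have "Suc n \<le> 2 * (L * Suc p)" by simp
      then have n_le: "real n \<le> 2 * real L * real (Suc p)"
        using of_nat_mono[of "Suc n" "2 * (L * Suc p)", where 'a = real] by (simp add: mult.assoc del: mult_Suc_right)
      have "F n = F p + (\<Sum>j\<in>{p<..n}. \<rho> j)"
        unfolding F_def using \<open>p < n\<close> by (subst sum.union_disjoint[symmetric]) (auto intro!: sum.cong)
      also have "(\<Sum>j\<in>{p<..n}. \<rho> j) \<le> (\<Sum>j\<in>{p<..n}. \<rho> p)"
        by (intro sum_mono c0_star_antimono[OF c0]) simp
      also have "\<dots> \<le> real n * \<rho> p" using c0_star_nonneg[OF c0, of p] by (simp add: mult_right_mono)
      also have "\<dots> \<le> (2 * real L * real (Suc p)) * \<rho> p" by (rule mult_right_mono[OF n_le c0_star_nonneg[OF c0]])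
      also have "\<dots> = 2 * real L * \<phi> p" by (simp only: \<phi>_def mult.assoc)
      also have "F p \<le> C * \<phi> p" by (rule less.IH[OF \<open>p < n\<close>])
      finally have "F n \<le> (C + 2 * real L) * \<phi> p" by (simp add: distrib_right)
      also have "\<dots> \<le> (2 * C) * \<phi> p" using C(1) less_imp_le[OF \<phi>_pos] by (intro mult_right_mono) auto
      also have "\<dots> = C * (2 * \<phi> p)" by simp
      also have "\<dots> \<le> C * \<phi> n" by (rule mult_left_mono[OF grow C(3)])
      finally show ?thesis .
    qed
  qed
  then have "am_seq \<rho> n \<le> C * \<rho> n" for n
    by (simp add: am_seq_def F_def \<phi>_def divide_le_eq mult_ac del: of_nat_Suc)
  then have "am_seq \<rho> \<in> principal_char_set \<rho>"
    by (intro dominated_in_principal_char_set am_seq_c0_star[OF c0] dominatedI)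
  then have "\<rho> \<in> pre_am_set (principal_char_set \<rho>)" by (simp add: pre_am_set_def c0)
  then have "principal_char_set \<rho> \<subseteq> pre_am_set (principal_char_set \<rho>)"
    using principal_char_set_least[OF is_char_set_pre_am_set[OF is_char_set_principal[OF c0]] c0] by simp
  then show False using unstable pre_am_set_subset[OF is_char_set_principal[OF c0]] by blast
qed

text \<open>For \<open>n > 0\<close> and \<open>l = (n - 1) div 2\<close>, the indices from
  \<open>l + 1\<close> to \<open>n\<close> number at least \<open>l + 1\<close>, and the terms there
  are at least \<open>\<xi> n\<close>; so the mean at infinity at \<open>l\<close> bounds
  \<open>\<xi> n\<close>. The first term is left to \<open>delta0\<close>.\<close>

lemma pre_am_inf_set_subset:
  assumes S: "is_char_set S" "S \<noteq> {\<lambda>n. 0}"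
  shows "pre_am_inf_set S \<subseteq> S"
proof
  fix \<xi> assume "\<xi> \<in> pre_am_inf_set S"
  then have \<xi>: "\<xi> \<in> l1_star" "am_inf_seq \<xi> \<in> S" by (auto simp: pre_am_inf_set_def)
  have c0: "\<xi> \<in> c0_star" by (rule l1_starD(1)[OF \<xi>(1)])
  have am0: "am_inf_seq \<xi> \<in> c0_star" by (rule am_inf_seq_c0_star[OF \<xi>(1)])
  have le: "\<xi> n \<le> am_inf_seq \<xi> (n div 4)" if "0 < n" for n
  proof -
    define l where "l = (n - 1) div 2"
    have l: "Suc l \<le> n - l" "n div 4 \<le> l" using that by (auto simp: l_def)
    have "real (n - l) * \<xi> n = (\<Sum>j<n - l. \<xi> n)" by simp
    also have "\<dots> \<le> (\<Sum>j<n - l. \<xi> (j + Suc l))"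
      by (intro sum_mono c0_star_antimono[OF c0]) auto
    also have "\<dots> \<le> tail \<xi> (Suc l)"
      unfolding tail_def
      by (intro sum_le_suminf summable_ignore_initial_segment l1_starD(2)[OF \<xi>(1)] c0_star_nonneg[OF c0]) simp
    finally have "real (n - l) * \<xi> n \<le> tail \<xi> (Suc l)" .
    moreover have "real (Suc l) * \<xi> n \<le> real (n - l) * \<xi> n"
      using l(1) by (intro mult_right_mono c0_star_nonneg[OF c0]) simp
    ultimately have "\<xi> n \<le> am_inf_seq \<xi> l"
      by (simp add: am_inf_seq_tail le_divide_eq mult.commute del: of_nat_Suc)
    also have "\<dots> \<le> am_inf_seq \<xi> (n div 4)" by (rule c0_star_antimono[OF am0 l(2)])
    finally show ?thesis .
  qed
  have 4: "(\<lambda>n. am_inf_seq \<xi> (n div 4)) \<in> S" using char_set_ampliation[OF S(1) \<xi>(2), of 2] by simp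
  have "\<xi> n \<le> (1 + \<xi> 0) * (am_inf_seq \<xi> (n div 4) + delta0 n)" for n
  proof (cases "n = 0")
    case True
    have "(1 + \<xi> 0) * 1 \<le> (1 + \<xi> 0) * (am_inf_seq \<xi> 0 + 1)"
      using c0_star_nonneg[OF am0, of 0] c0_star_nonneg[OF c0, of 0] by (intro mult_left_mono) auto
    then show ?thesis by (simp add: True delta0_def)
  next
    case False
    have "1 * am_inf_seq \<xi> (n div 4) \<le> (1 + \<xi> 0) * am_inf_seq \<xi> (n div 4)"
      using c0_star_nonneg[OF c0, of 0] by (intro mult_right_mono c0_star_nonneg[OF am0]) simp
    then show ?thesis using le[of n] False by (simp add: delta0_def)
  qed
  then have "dominated \<xi> (\<lambda>n. am_inf_seq \<xi> (n div 4) + delta0 n)" by (rule dominatedI)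
  then show "\<xi> \<in> S"
    by (rule is_char_setD(3)[OF S(1) is_char_setD(2)[OF S(1) 4 delta0_in_char_set[OF S]] c0])
qed

lemma principal_char_set_nonzero:
  assumes "\<xi> \<in> c0_star" "0 < \<xi> 0"
  shows "principal_char_set \<xi> \<noteq> {\<lambda>n. 0}"
  using principal_char_set_self[OF assms(1)] assms(2) by (metis less_irrefl singletonD)

text \<open>Contraposition as for ordinary means, with halving in place of doubling: the sums over
  successive blocks decrease geometrically, so the tails are at most a multiple of
  \<open>(n + 1) * \<rho> n\<close>. Positivity comes from the strict inequality in
  \<open>slow\<close>, which prevents \<phi> from vanishing from some index on.\<close>

lemma quasiconvex_unstable_long_flat:
  assumes \<rho>: "quasiconvex \<rho>" and "0 < \<rho> 0"
    and unstable: "pre_am_inf_set (principal_char_set \<rho>) \<noteq> principal_char_set \<rho>"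
  shows "long_flat \<rho> \<and> (\<forall>n. 0 < \<rho> n)"
proof -
  define \<phi> where "\<phi> m = real (Suc m) * \<rho> m" for m
  have c0: "\<rho> \<in> c0_star" by (rule quasiconvex_c0_star[OF \<rho>])
  note S = is_char_set_principal[OF c0] principal_char_set_nonzero[OF c0 \<open>0 < \<rho> 0\<close>]
  have \<phi>_dec: "\<phi> n \<le> \<phi> m" if "m \<le> n" for m n using quasiconvex_le[OF \<rho> that] by (simp add: \<phi>_def)
  have \<phi>0: "0 \<le> \<phi> m" for m using c0_star_nonneg[OF c0] by (simp add: \<phi>_def)
  have slow: "\<exists>p\<ge>N. \<exists>q. 2 ^ K * Suc p \<le> Suc q \<and> \<phi> p < 2 * \<phi> q" for K N
  proof (rule ccontr)
    assume "\<not> ?thesis"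
    then have decay: "2 * \<phi> q \<le> \<phi> p" if "N \<le> p" "2 ^ K * Suc p \<le> Suc q" for p q
      using that by (meson not_le)
    \<comment> \<open>One factor 2 more than \<open>2 ^ K\<close>, so that the end \<open>q\<close>
      of a block exceeds \<open>p\<close> even for \<open>K = 0\<close>.\<close>
    define L where "L = (2 :: nat) ^ Suc K"
    have L: "2 \<le> L" "2 ^ K \<le> L" by (simp_all add: L_def)
    \<comment> \<open>One block costs at most \<open>real L * \<phi> p\<close>. The rest costs at
      most \<open>2 * real L * \<phi> q\<close> by induction, which is again at most
      \<open>real L * \<phi> p\<close> because \<phi> halves from \<open>p\<close> to
      \<open>q\<close>.\<close>
    have part: "(\<Sum>j\<in>{p<..n}. \<rho> j) \<le> 2 * real L * \<phi> p" if "N \<le> p" for p n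
      using that
    proof (induction "n - p" arbitrary: p rule: less_induct)
      case less
      define q where "q = L * Suc p - 1"
      have "2 * Suc p \<le> L * Suc p" using L(1) by (rule mult_right_mono) simp
      then have "p < q" and Suc_q: "Suc q = L * Suc p" by (auto simp: q_def)
      have block: "(\<Sum>j\<in>{p<..m}. \<rho> j) \<le> real L * \<phi> p" if "m \<le> q" for m
      proof -
        have "(\<Sum>j\<in>{p<..m}. \<rho> j) \<le> (\<Sum>j\<in>{p<..m}. \<rho> p)"
          by (intro sum_mono c0_star_antimono[OF c0]) simp
        also have "\<dots> \<le> real (Suc q) * \<rho> p"
          using that c0_star_nonneg[OF c0, of p] by (simp add: mult_right_mono)
        also have "\<dots> = real L * \<phi> p" by (simp only: Suc_q \<phi>_def of_nat_mult mult.assoc)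
        finally show ?thesis .
      qed
      show ?case
      proof (cases "n \<le> q")
        case True
        have "real L * \<phi> p \<le> 2 * real L * \<phi> p" using \<phi>0[of p] by (simp add: mult_right_mono)
        then show ?thesis using block[OF True] by linarith
      next
        case False
        have "(\<Sum>j\<in>{q<..n}. \<rho> j) \<le> 2 * real L * \<phi> q"
          using False \<open>p < q\<close> less.prems by (intro less.hyps) auto
        moreover have "2 ^ K * Suc p \<le> Suc q" unfolding Suc_q by (rule mult_right_mono[OF L(2)]) simp
        then have "2 * \<phi> q \<le> \<phi> p" by (rule decay[OF less.prems])
        then have "real L * (2 * \<phi> q) \<le> real L * \<phi> p" by (rule mult_left_mono) simp
        moreover have "(\<Sum>j\<in>{p<..n}. \<rho> j) = (\<Sum>j\<in>{p<..q}. \<rho> j) + (\<Sum>j\<in>{q<..n}. \<rho> j)"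
          using False \<open>p < q\<close> by (subst sum.union_disjoint[symmetric]) (auto intro!: sum.cong)
        ultimately show ?thesis using block[OF le_refl] by simp
      qed
    qed
    have "summable \<rho>"
    proof (rule summableI_nonneg_bounded[OF c0_star_nonneg[OF c0]])
      fix n
      have "(\<Sum>j<n. \<rho> j) \<le> (\<Sum>j\<in>{..N} \<union> {N<..n}. \<rho> j)"
        using c0_star_nonneg[OF c0] by (intro sum_mono2) auto
      also have "\<dots> = (\<Sum>j\<le>N. \<rho> j) + (\<Sum>j\<in>{N<..n}. \<rho> j)" by (rule sum.union_disjoint) auto
      also have "\<dots> \<le> (\<Sum>j\<le>N. \<rho> j) + 2 * real L * \<phi> N" using part[of N n] by simp
      finally show "(\<Sum>j<n. \<rho> j) \<le> (\<Sum>j\<le>N. \<rho> j) + 2 * real L * \<phi> N" .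
    qed
    then have l1: "\<rho> \<in> l1_star" by (simp add: l1_star_def c0)
    have am_le: "am_inf_seq \<rho> p \<le> 2 * real L * \<rho> p" if "N \<le> p" for p
    proof -
      have "tail \<rho> (Suc p) \<le> 2 * real L * \<phi> p"
        unfolding tail_def
      proof (rule suminf_le_const[OF summable_ignore_initial_segment[OF \<open>summable \<rho>\<close>]])
        fix n
        have "(\<Sum>j<n. \<rho> (j + Suc p)) = (\<Sum>j\<in>{p<..p + n}. \<rho> j)"
          by (rule sum.reindex_bij_witness[of _ "\<lambda>j. j - Suc p" "\<lambda>j. j + Suc p"]) auto
        then show "(\<Sum>j<n. \<rho> (j + Suc p)) \<le> 2 * real L * \<phi> p" using part[OF that] by simp
      qed
      then show ?thesis by (simp add: am_inf_seq_tail \<phi>_def divide_le_eq mult_ac del: of_nat_Suc)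
    qed
    \<comment> \<open>The quotient handles the indices below \<open>N\<close>: the ampliation by
      \<open>2 ^ N\<close> sends all of them to 0, where \<rho> is positive.\<close>
    define C where "C = 2 * real L + am_inf_seq \<rho> 0 / \<rho> 0"
    have am0: "am_inf_seq \<rho> \<in> c0_star" by (rule am_inf_seq_c0_star[OF l1])
    have "am_inf_seq \<rho> n \<le> C * \<rho> (n div 2 ^ N)" for n
    proof (cases "N \<le> n")
      case True
      have "am_inf_seq \<rho> n \<le> 2 * real L * \<rho> n" by (rule am_le[OF True])
      also have "\<dots> \<le> C * \<rho> (n div 2 ^ N)"
        using \<open>0 < \<rho> 0\<close> c0_star_nonneg[OF am0, of 0] c0_star_nonneg[OF c0] c0_star_antimono[OF c0, of "n div 2 ^ N" n]
        by (intro mult_mono) (auto simp: C_def)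
      finally show ?thesis .
    next
      case False
      then have "n div 2 ^ N = 0" by (simp add: less_trans[OF _ less_exp])
      moreover have "am_inf_seq \<rho> n \<le> am_inf_seq \<rho> 0" by (rule c0_star_antimono[OF am0]) simp
      moreover have "am_inf_seq \<rho> 0 \<le> C * \<rho> 0"
        using \<open>0 < \<rho> 0\<close> by (simp add: C_def distrib_right)
      ultimately show ?thesis by simp
    qed
    then have "am_inf_seq \<rho> \<in> principal_char_set \<rho>" by (rule in_principal_char_setI[OF am0])
    then have "\<rho> \<in> pre_am_inf_set (principal_char_set \<rho>)" by (simp add: pre_am_inf_set_def l1)
    then have "principal_char_set \<rho> \<subseteq> pre_am_inf_set (principal_char_set \<rho>)"
      using principal_char_set_least[OF is_char_set_pre_am_inf_set[OF S] c0] by simp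
    then show False using unstable pre_am_inf_set_subset[OF S] by blast
  qed
  have "long_flat \<rho>"
    unfolding long_flat_def
  proof (intro allI)
    fix K N
    obtain p q where pq: "N \<le> p" "2 ^ K * Suc p \<le> Suc q" "\<phi> p < 2 * \<phi> q" using slow by blast
    have "\<phi> n \<le> 2 * \<phi> p \<and> \<phi> n \<le> 2 * \<phi> q \<and> \<phi> p \<le> 2 * \<phi> n \<and> \<phi> q \<le> 2 * \<phi> n" if "n \<in> {p..q}" for n
      using \<phi>_dec[of p n] \<phi>_dec[of n q] \<phi>0[of p] \<phi>0[of n] that pq(3) by auto
    then have "flat_on \<rho> p q" unfolding flat_on_def \<phi>_def by blast
    then show "\<exists>p\<ge>N. \<exists>q. 2 ^ K * Suc p \<le> Suc q \<and> flat_on \<rho> p q" using pq by blast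
  qed
  moreover have "0 < \<rho> n" for n
  proof -
    obtain p q where "n \<le> p" "2 ^ 0 * Suc p \<le> Suc q" "\<phi> p < 2 * \<phi> q" using slow by blast
    then have "0 < \<phi> p" using \<phi>_dec[of p q] by simp
    then have "0 < \<rho> p" by (simp add: \<phi>_def zero_less_mult_iff)
    then show ?thesis using c0_star_antimono[OF c0 \<open>n \<le> p\<close>] by simp
  qed
  ultimately show ?thesis by blast
qed

section \<open>Interiors and open hulls of principal characteristic sets\<close>

definition open_hull :: "(nat \<Rightarrow> real) set \<Rightarrow> (nat \<Rightarrow> real) set \<Rightarrow> bool" where
  "open_hull S T \<longleftrightarrow> is_char_set T \<and> interior_set T = T \<and> S \<subseteq> T \<and>
     (\<forall>J. is_char_set J \<and> interior_set J = J \<and> S \<subseteq> J \<longrightarrow> T \<subseteq> J)"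

text \<open>\<open>T\<close> has to be nonzero because the interior at infinity is translated
  between ideals and characteristic sets only for nonzero ideals.\<close>

definition open_inf_hull :: "(nat \<Rightarrow> real) set \<Rightarrow> (nat \<Rightarrow> real) set \<Rightarrow> bool" where
  "open_inf_hull S T \<longleftrightarrow> is_char_set T \<and> T \<noteq> {\<lambda>n. 0} \<and> interior_inf_set T = T \<and> S \<inter> se_set \<subseteq> T \<and>
     (\<forall>J. is_char_set J \<and> interior_inf_set J = J \<and> S \<inter> se_set \<subseteq> J \<longrightarrow> T \<subseteq> J)"

lemma open_hullI:
  assumes \<eta>: "\<eta> \<in> c0_star" and T: "is_char_set T" and "\<eta> \<in> interior_set T"
    and "\<And>J. is_char_set J \<Longrightarrow> interior_set J = J \<Longrightarrow> \<eta> \<in> J \<Longrightarrow> interior_set T \<subseteq> J"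
  shows "open_hull (principal_char_set \<eta>) (interior_set T)"
  unfolding open_hull_def
  using is_char_set_interior_set[OF T] interior_set_idem[OF T] assms(3,4)
    principal_char_set_least[OF _ \<eta>] principal_char_set_self[OF \<eta>] by auto

theorem principal_open_hulls:
  assumes \<rho>: "\<rho> \<in> c0_star" and "0 < \<rho> 0"
    and unstable: "pre_am_set (principal_char_set \<rho>) \<noteq> principal_char_set \<rho>"
  shows "\<exists>\<eta>1\<in>c0_star. \<exists>\<eta>2\<in>c0_star.
    principal_char_set \<eta>1 \<subset> principal_char_set \<rho> \<and> principal_char_set \<rho> \<subset> principal_char_set \<eta>2 \<and>
    open_hull (principal_char_set \<eta>1) (interior_set (principal_char_set \<rho>)) \<and>
    open_hull (principal_char_set \<rho>) (interior_set (principal_char_set \<eta>2))"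
proof (cases "interior_set (principal_char_set \<rho>) = principal_char_set \<rho>")
  case False
  let ?S = "principal_char_set \<rho>"
  note S = is_char_set_principal[OF \<rho>]
  \<comment> \<open>The envelope vanishes identically exactly when \<open>(n + 1) * \<rho> n\<close>
    has lower limit 0; this is how the zero ideal can occur below.\<close>
  obtain \<nu> where \<nu>: "quasiconcave \<nu>" "\<And>n. \<nu> n \<le> \<rho> n"
    "\<And>\<kappa>. quasiconcave \<kappa> \<Longrightarrow> \<kappa> \<in> ?S \<Longrightarrow> dominated \<kappa> \<nu>"
    by (rule quasiconcave_lower_envelope[OF \<rho>]) blast
  obtain \<mu> where \<mu>: "quasiconcave \<mu>" "\<And>n. \<rho> n \<le> \<mu> n"
    "\<And>\<kappa>. quasiconcave \<kappa> \<Longrightarrow> dominated \<rho> \<kappa> \<Longrightarrow> dominated \<mu> \<kappa>"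
    by (rule quasiconcave_upper_envelope[OF \<rho>]) blast
  note c0 = quasiconcave_c0_star[OF \<nu>(1)] quasiconcave_c0_star[OF \<mu>(1)]
  have \<nu>_S: "\<nu> \<in> ?S"
    using \<nu>(2) by (intro dominated_in_principal_char_set[OF c0(1)] dominatedI[of _ 1]) simp
  have \<rho>_\<mu>: "\<rho> \<in> principal_char_set \<mu>"
    using \<mu>(2) by (intro dominated_in_principal_char_set[OF \<rho>] dominatedI[of _ 1]) simp
  have \<nu>_int: "\<nu> \<in> interior_set ?S" by (rule interior_setI[OF S \<nu>_S \<nu>(1)])
  have \<mu>_int: "\<mu> \<in> interior_set (principal_char_set \<mu>)"
    by (rule interior_setI[OF is_char_set_principal[OF c0(2)] principal_char_set_self[OF c0(2)] \<mu>(1)])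
  have \<rho>_notin: "\<rho> \<notin> interior_set ?S"
    using False interior_set_subset[OF S] principal_char_set_least[OF is_char_set_interior_set[OF S] \<rho>] by blast
  have \<rho>_\<nu>: "\<rho> \<notin> principal_char_set \<nu>"
    using \<rho>_notin \<nu>_int principal_char_set_least[OF is_char_set_interior_set[OF S] c0(1)] by blast
  \<comment> \<open>If \<mu> were in \<open>?S\<close>, then \<rho> would lie below a quasiconcave
    member of \<open>?S\<close>, and \<open>?S\<close> would be open.\<close>
  have \<mu>_\<rho>: "\<mu> \<notin> ?S"
  proof
    assume "\<mu> \<in> ?S"
    then have "\<mu> \<in> interior_set ?S" using interior_setI[OF S _ \<mu>(1)] by blast
    moreover have "dominated \<rho> \<mu>" using \<mu>(2) by (intro dominatedI[of _ 1]) simp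
    ultimately show False using is_char_setD(3)[OF is_char_set_interior_set[OF S] _ \<rho>] \<rho>_notin by blast
  qed
  have hull1: "open_hull (principal_char_set \<nu>) (interior_set ?S)"
  proof (rule open_hullI[OF c0(1) S \<nu>_int])
    fix J assume J: "is_char_set J" "\<nu> \<in> J"
    show "interior_set ?S \<subseteq> J"
    proof
      fix \<xi> assume "\<xi> \<in> interior_set ?S"
      then obtain \<kappa> where \<kappa>: "\<xi> \<in> c0_star" "\<kappa> \<in> ?S" "quasiconcave \<kappa>" "dominated \<xi> \<kappa>"
        by (auto simp: interior_set_def)
      have "\<kappa> \<in> J" by (rule is_char_setD(3)[OF J quasiconcave_c0_star[OF \<kappa>(3)] \<nu>(3)[OF \<kappa>(3,2)]])
      then show "\<xi> \<in> J" by (rule is_char_setD(3)[OF J(1) _ \<kappa>(1,4)])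
    qed
  qed
  have hull2: "open_hull ?S (interior_set (principal_char_set \<mu>))"
  proof (rule open_hullI[OF \<rho> is_char_set_principal[OF c0(2)]])
    show "\<rho> \<in> interior_set (principal_char_set \<mu>)"
      using \<mu>(1,2) \<rho> principal_char_set_self[OF c0(2)] dominatedI[of \<rho> 1 \<mu>] by (auto simp: interior_set_def)
    fix J assume J: "is_char_set J" "interior_set J = J" "\<rho> \<in> J"
    then obtain \<kappa> where \<kappa>: "\<kappa> \<in> J" "quasiconcave \<kappa>" "dominated \<rho> \<kappa>" by (auto simp: interior_set_def)
    have "\<mu> \<in> J" by (rule is_char_setD(3)[OF J(1) \<kappa>(1) c0(2) \<mu>(3)[OF \<kappa>(2,3)]])
    then have "principal_char_set \<mu> \<subseteq> J" using principal_char_set_least[OF J(1) c0(2)] by simp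
    then show "interior_set (principal_char_set \<mu>) \<subseteq> J"
      using interior_set_subset[OF is_char_set_principal[OF c0(2)]] by blast
  qed
  show ?thesis
    using c0 hull1 hull2 \<nu>_S \<rho>_\<mu> \<rho>_\<nu> \<mu>_\<rho> \<rho> principal_char_set_subset_iff
    by (intro bexI[of _ \<nu>] bexI[of _ \<mu>]) (auto simp: psubset_eq)
next
  case True
  then have "\<rho> \<in> interior_set (principal_char_set \<rho>)" using principal_char_set_self[OF \<rho>] by simp
  \<comment> \<open>Openness supplies a quasiconcave generator \<kappa> of the same ideal; from here
    on it replaces \<rho>.\<close>
  then obtain \<kappa> where \<kappa>: "\<kappa> \<in> principal_char_set \<rho>" "quasiconcave \<kappa>" "dominated \<rho> \<kappa>"
    by (auto simp: interior_set_def)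
  have c0: "\<kappa> \<in> c0_star" by (rule quasiconcave_c0_star[OF \<kappa>(2)])
  have eq: "principal_char_set \<rho> = principal_char_set \<kappa>"
    by (rule principal_char_set_eqI[OF \<rho> c0 dominated_in_principal_char_set[OF \<rho> \<kappa>(3)] \<kappa>(1)])
  let ?S = "principal_char_set \<kappa>"
  note S = is_char_set_principal[OF c0]
  have "0 < \<kappa> 0"
  proof -
    obtain M where "\<rho> 0 \<le> M * \<kappa> 0" using \<kappa>(3) by (auto simp: dominated_def)
    then have "\<kappa> 0 \<noteq> 0" using \<open>0 < \<rho> 0\<close> by auto
    then show ?thesis using c0_star_nonneg[OF c0, of 0] by simp
  qed
  have pos: "0 < \<kappa> n" for n
  proof -
    have "0 < real (Suc n) * \<kappa> n" using quasiconcave_le[OF \<kappa>(2), of 0 n] \<open>0 < \<kappa> 0\<close> by simp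
    then show ?thesis by (simp add: zero_less_mult_iff)
  qed
  have flat: "long_flat \<kappa>"
    using quasiconcave_unstable_long_flat[OF \<kappa>(2) \<open>0 < \<kappa> 0\<close>] unstable by (simp add: eq)
  obtain \<eta>1 \<eta>2 where \<eta>: "\<eta>1 \<in> c0_star" "\<eta>2 \<in> c0_star" "\<And>n. \<eta>1 n \<le> \<kappa> n" "\<And>n. \<kappa> n \<le> \<eta>2 n"
    "\<kappa> \<notin> principal_char_set \<eta>1" "\<eta>2 \<notin> ?S"
    and below: "\<And>n. \<exists>p\<le>n. real (Suc n) * \<kappa> n \<le> 2 * (real (Suc p) * \<eta>1 p)"
    and above: "\<And>n. \<exists>q\<ge>n. real (Suc q) * \<eta>2 q \<le> 2 * (real (Suc n) * \<kappa> n)"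
    by (rule flat_modification[OF c0 pos flat]) blast
  have dom: "dominated \<eta>1 \<kappa>" "dominated \<kappa> \<eta>2" using \<eta>(3,4) by (auto intro!: dominatedI[of _ 1])
  have int: "interior_set ?S = ?S" using True by (simp add: eq)
  have hull1: "open_hull (principal_char_set \<eta>1) (interior_set ?S)"
  proof (rule open_hullI[OF \<eta>(1) S])
    show "\<eta>1 \<in> interior_set ?S" unfolding int by (rule dominated_in_principal_char_set[OF \<eta>(1) dom(1)])
    fix J assume J: "is_char_set J" "interior_set J = J" "\<eta>1 \<in> J"
    then obtain \<theta> where \<theta>: "\<theta> \<in> J" "quasiconcave \<theta>" "dominated \<eta>1 \<theta>" by (auto simp: interior_set_def)
    then obtain M where M: "M > 0" "\<And>n. \<eta>1 n \<le> M * \<theta> n"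
      using dominated_pos[OF \<theta>(3)] c0_star_nonneg[OF quasiconcave_c0_star[OF \<theta>(2)]] by blast
    \<comment> \<open>At some \<open>p \<le> n\<close> the smaller sequence still reaches half of
      \<open>(n + 1) * \<kappa> n\<close>, and monotonicity of \<open>(n + 1) * \<theta> n\<close>
      carries the bound from \<open>p\<close> to \<open>n\<close>.\<close>
    have "\<kappa> n \<le> (2 * M) * \<theta> n" for n
    proof -
      obtain p where p: "p \<le> n" "real (Suc n) * \<kappa> n \<le> 2 * (real (Suc p) * \<eta>1 p)" using below by blast
      note p(2)
      also have "2 * (real (Suc p) * \<eta>1 p) \<le> 2 * (real (Suc p) * (M * \<theta> p))"
        using M(2)[of p] by (intro mult_left_mono) auto
      also have "\<dots> = (2 * M) * (real (Suc p) * \<theta> p)" by (simp only: mult_ac)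
      also have "\<dots> \<le> (2 * M) * (real (Suc n) * \<theta> n)"
        using M(1) by (intro mult_left_mono quasiconcave_le[OF \<theta>(2) p(1)]) simp
      also have "\<dots> = real (Suc n) * ((2 * M) * \<theta> n)" by (simp only: mult_ac)
      finally show ?thesis by (rule mult_left_le_imp_le) simp
    qed
    then have "\<kappa> \<in> J" by (intro is_char_setD(3)[OF J(1) \<theta>(1) c0] dominatedI)
    then show "interior_set ?S \<subseteq> J" unfolding int using principal_char_set_least[OF J(1) c0] by simp
  qed
  have hull2: "open_hull ?S (interior_set (principal_char_set \<eta>2))"
  proof (rule open_hullI[OF c0 is_char_set_principal[OF \<eta>(2)]])
    show "\<kappa> \<in> interior_set (principal_char_set \<eta>2)"
      by (rule interior_setI[OF is_char_set_principal[OF \<eta>(2)] dominated_in_principal_char_set[OF c0 dom(2)] \<kappa>(2)])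
    fix J assume J: "is_char_set J" "\<kappa> \<in> J"
    show "interior_set (principal_char_set \<eta>2) \<subseteq> J"
    proof
      fix \<xi> assume "\<xi> \<in> interior_set (principal_char_set \<eta>2)"
      then obtain \<theta> where \<theta>: "\<xi> \<in> c0_star" "\<theta> \<in> principal_char_set \<eta>2" "quasiconcave \<theta>" "dominated \<xi> \<theta>"
        by (auto simp: interior_set_def)
      obtain k M where M: "M > 0" "\<And>n. \<theta> n \<le> M * \<eta>2 (n div 2 ^ k)"
        by (rule in_principal_char_setD[OF \<theta>(2) \<eta>(2)]) blast
      \<comment> \<open>Evaluation at \<open>2 ^ k * q\<close>, where the ampliation of \<eta>2
        equals \<open>\<eta>2 q\<close>. The index \<open>q \<ge> n\<close> is one at which \<eta>2
        is not essentially larger than \<kappa> at \<open>n\<close>, measured by the products with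
        the index.\<close>
      have "\<theta> n \<le> (2 * M * 2 ^ k) * \<kappa> n" for n
      proof -
        obtain q where q: "n \<le> q" "real (Suc q) * \<eta>2 q \<le> 2 * (real (Suc n) * \<kappa> n)" using above by blast
        have "n \<le> 2 ^ k * q" using q(1) by (metis le_trans mult_le_mono1 mult_1 one_le_numeral one_le_power)
        then have "real (Suc n) * \<theta> n \<le> real (Suc (2 ^ k * q)) * \<theta> (2 ^ k * q)"
          by (rule quasiconcave_le[OF \<theta>(3)])
        also have "\<dots> \<le> real (Suc (2 ^ k * q)) * (M * \<eta>2 q)"
          using M(2)[of "2 ^ k * q"] by (intro mult_left_mono) auto
        also have "\<dots> \<le> (2 ^ k * real (Suc q)) * (M * \<eta>2 q)"
          using M(1) c0_star_nonneg[OF \<eta>(2)] by (intro mult_right_mono) (auto simp: algebra_simps)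
        also have "\<dots> = (M * 2 ^ k) * (real (Suc q) * \<eta>2 q)" by (simp only: mult_ac)
        also have "\<dots> \<le> (M * 2 ^ k) * (2 * (real (Suc n) * \<kappa> n))" using M(1) by (intro mult_left_mono q(2)) simp
        also have "\<dots> = real (Suc n) * ((2 * M * 2 ^ k) * \<kappa> n)" by (simp only: mult_ac)
        finally show ?thesis by (rule mult_left_le_imp_le) simp
      qed
      then have "\<theta> \<in> J" by (intro is_char_setD(3)[OF J quasiconcave_c0_star[OF \<theta>(3)]] dominatedI)
      then show "\<xi> \<in> J" by (rule is_char_setD(3)[OF J(1) _ \<theta>(1,4)])
    qed
  qed
  have "principal_char_set \<eta>1 \<subset> ?S" "?S \<subset> principal_char_set \<eta>2"
    using \<eta>(5,6) dominated_in_principal_char_set[OF \<eta>(1) dom(1)] dominated_in_principal_char_set[OF c0 dom(2)]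
      principal_char_set_subset_iff[OF \<eta>(1) c0] principal_char_set_subset_iff[OF c0 \<eta>(1)]
      principal_char_set_subset_iff[OF \<eta>(2) c0] principal_char_set_subset_iff[OF c0 \<eta>(2)] by blast+
  then show ?thesis using \<eta>(1,2) hull1 hull2 unfolding eq by blast
qed

section \<open>Open hulls at infinity\<close>

lemma open_inf_hullI:
  assumes T: "is_char_set T" "T \<noteq> {\<lambda>n. 0}" and "S \<inter> se_set \<subseteq> interior_inf_set T"
    and "\<And>J. is_char_set J \<Longrightarrow> interior_inf_set J = J \<Longrightarrow> S \<inter> se_set \<subseteq> J \<Longrightarrow> interior_inf_set T \<subseteq> J"
  shows "open_inf_hull S (interior_inf_set T)"
  unfolding open_inf_hull_def
  using is_char_set_interior_inf_set[OF T] interior_inf_set_nonzero[OF T] interior_inf_set_idem[OF T] assms(3,4)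
  by blast

text \<open>A member of \<open>se_set\<close> has a quasiconvex majorant, and every quasiconvex
  sequence is dominated by \<open>omega\<close>.\<close>

lemma interior_inf_set_omega:
  assumes S: "is_char_set S" and "omega \<in> S"
  shows "interior_inf_set S = se_set"
proof
  show "se_set \<subseteq> interior_inf_set S"
  proof
    fix \<xi> assume \<xi>: "\<xi> \<in> se_set"
    obtain \<mu> where \<mu>: "quasiconvex \<mu>" "\<And>n. \<xi> n \<le> \<mu> n" by (rule quasiconvex_upper_envelope[OF \<xi>]) blast
    have "\<mu> \<in> S"
      by (rule is_char_setD(3)[OF S assms(2) quasiconvex_c0_star[OF \<mu>(1)] quasiconvex_dominated_omega[OF \<mu>(1)]])
    moreover have "dominated \<xi> \<mu>" using \<mu>(2) by (intro dominatedI[of _ 1]) simp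
    ultimately show "\<xi> \<in> interior_inf_set S" using \<mu>(1) \<xi> by (auto simp: interior_inf_set_def se_set_def)
  qed
qed (rule interior_inf_set_se_set)

text \<open>Since \<theta> is not in \<open>se_set\<close>, \<open>(n + 1) * \<theta> n\<close> is
  at least some \<open>c > 0\<close> at infinitely many sample indices. A given \<xi> is imitated by
  a sequence \<eta> in \<open>se_set\<close>, dominated by \<theta> and large only at the samples.
  Openness of \<open>J\<close> gives a quasiconvex \<kappa> above \<eta>, and quasiconvexity extends
  the bound at a sample to all indices before it.\<close>

lemma se_set_subset_open:
  assumes \<theta>: "\<theta> \<in> c0_star" "\<theta> \<notin> se_set" and J: "is_char_set J" "interior_inf_set J = J"
    and sub: "principal_char_set \<theta> \<inter> se_set \<subseteq> J"
  shows "se_set \<subseteq> J"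
proof
  have "\<not> (\<lambda>n. real (Suc n) * \<theta> n) \<longlonglongrightarrow> 0" using \<theta> by (simp add: se_set_def)
  then obtain c where c: "c > 0" "\<And>N. \<exists>n\<ge>N. c \<le> real (Suc n) * \<theta> n"
    using c0_star_nonneg[OF \<theta>(1)] by (auto simp: LIMSEQ_iff not_less)
  define nxt where "nxt n = (LEAST m. n \<le> m \<and> c \<le> real (Suc m) * \<theta> m)" for n
  have nxt: "n \<le> nxt n" "c \<le> real (Suc (nxt n)) * \<theta> (nxt n)" for n
    using LeastI_ex[of "\<lambda>m. n \<le> m \<and> c \<le> real (Suc m) * \<theta> m"] c(2)[of n] by (auto simp: nxt_def)
  have nxt_mono: "nxt m \<le> nxt n" if "m \<le> n" for m n
    unfolding nxt_def[of m] by (rule Least_le) (use nxt[of n] that in auto)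
  \<comment> \<open>A generalized inverse of \<open>nxt\<close>: \<open>g (nxt n) \<le> n\<close>
    makes \<open>\<phi> (g (nxt n))\<close> at least \<open>\<phi> n\<close>, while \<open>g\<close>
    tends to infinity, so that \<open>\<phi> (g n)\<close> still tends to 0.\<close>
  define g where "g m = (LEAST k. m \<le> nxt k)" for m
  have g: "m \<le> nxt (g m)" for m unfolding g_def by (rule LeastI[of _ m]) (rule nxt)
  have g_le: "g m \<le> k" if "m \<le> nxt k" for m k unfolding g_def by (rule Least_le) (rule that)
  have g_mono: "g m \<le> g n" if "m \<le> n" for m n using g_le[of m "g n"] g[of n] that by simp
  have "k \<le> g m" if "Suc (nxt k) \<le> m" for k m
    using g[of m] nxt_mono[of "g m" k] that by (cases "g m \<le> k") auto
  then have g_lim: "filterlim g sequentially sequentially"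
    unfolding filterlim_at_top eventually_sequentially by blast
  fix \<xi> assume \<xi>: "\<xi> \<in> se_set"
  obtain \<mu> where \<mu>: "quasiconvex \<mu>" "\<And>n. \<xi> n \<le> \<mu> n" by (rule quasiconvex_upper_envelope[OF \<xi>]) blast
  define \<phi> where "\<phi> m = real (Suc m) * \<mu> m" for m
  have \<phi>0: "0 \<le> \<phi> m" for m using c0_star_nonneg[OF quasiconvex_c0_star[OF \<mu>(1)]] by (simp add: \<phi>_def)
  have \<phi>_dec: "\<phi> n \<le> \<phi> m" if "m \<le> n" for m n using quasiconvex_le[OF \<mu>(1) that] by (simp add: \<phi>_def)
  have "\<phi> \<longlonglongrightarrow> 0" using \<mu>(1) by (simp add: quasiconvex_def \<phi>_def[abs_def])
  then have \<phi>_lim: "(\<lambda>n. c * \<phi> (g n)) \<longlonglongrightarrow> 0"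
    by (intro tendsto_mult_right_zero filterlim_compose[OF _ g_lim])
  \<comment> \<open>Constant between consecutive samples. The second factor is at most
    \<open>\<theta> n\<close> and the first at most \<open>\<phi> 0\<close>, so \<eta> is dominated
    by \<theta>.\<close>
  define \<eta> where "\<eta> n = \<phi> (g n) * (c / real (Suc (nxt n)))" for n
  have \<eta>0: "0 \<le> \<eta> n" for n using \<phi>0 c(1) by (simp add: \<eta>_def)
  have \<eta>_le: "real (Suc n) * \<eta> n \<le> c * \<phi> (g n)" for n
  proof -
    have "real (Suc n) / real (Suc (nxt n)) \<le> 1" using nxt(1)[of n] by simp
    then have "(real (Suc n) / real (Suc (nxt n))) * (c * \<phi> (g n)) \<le> 1 * (c * \<phi> (g n))"
      using c(1) \<phi>0 by (intro mult_right_mono) auto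
    then show ?thesis by (simp add: \<eta>_def mult_ac)
  qed
  have lim: "(\<lambda>n. real (Suc n) * \<eta> n) \<longlonglongrightarrow> 0"
    by (rule tendsto_sandwich[OF _ _ tendsto_const \<phi>_lim]) (use \<eta>_le \<eta>0 in auto)
  have "\<eta> n \<le> real (Suc n) * \<eta> n" for n using mult_right_mono[of 1 "real (Suc n)" "\<eta> n"] \<eta>0 by simp
  then have "\<eta> \<longlonglongrightarrow> 0"
    by (intro tendsto_sandwich[OF _ _ tendsto_const lim] always_eventually allI \<eta>0)
  moreover have "\<eta> n \<le> \<eta> m" if "m \<le> n" for m n
    unfolding \<eta>_def using c(1) \<phi>0 nxt_mono[OF that]
    by (intro mult_mono \<phi>_dec[OF g_mono[OF that]] divide_left_mono) auto
  ultimately have \<eta>_c0: "\<eta> \<in> c0_star" using \<eta>0 by (simp add: c0_star_def decseq_def)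
  then have "\<eta> \<in> se_set" using lim by (simp add: se_set_def)
  moreover have "\<eta> n \<le> \<phi> 0 * \<theta> n" for n
  proof -
    have "c / real (Suc (nxt n)) \<le> \<theta> (nxt n)" using nxt(2)[of n] by (simp add: divide_le_eq mult.commute del: of_nat_Suc)
    also have "\<dots> \<le> \<theta> n" by (rule c0_star_antimono[OF \<theta>(1) nxt(1)])
    finally show ?thesis unfolding \<eta>_def using c(1) \<phi>0 by (intro mult_mono \<phi>_dec) auto
  qed
  then have "\<eta> \<in> principal_char_set \<theta>" by (intro dominated_in_principal_char_set[OF \<eta>_c0] dominatedI)
  ultimately have "\<eta> \<in> interior_inf_set J" using sub J(2) by blast
  then obtain \<kappa> where \<kappa>: "\<kappa> \<in> J" "quasiconvex \<kappa>" "dominated \<eta> \<kappa>" by (auto simp: interior_inf_set_def)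
  obtain M where M: "M > 0" "\<And>n. \<eta> n \<le> M * \<kappa> n"
    using dominated_pos[OF \<kappa>(3)] c0_star_nonneg[OF quasiconvex_c0_star[OF \<kappa>(2)]] by blast
  have "\<xi> n \<le> (M / c) * \<kappa> n" for n
  proof -
    let ?m = "nxt n"
    have same: "nxt ?m = ?m" if "c \<le> real (Suc ?m) * \<theta> ?m"
      using Least_le[of "\<lambda>k. ?m \<le> k \<and> c \<le> real (Suc k) * \<theta> k" ?m] that nxt(1)[of ?m] by (simp add: nxt_def)
    have "\<phi> n \<le> \<phi> (g ?m)" by (intro \<phi>_dec g_le) simp
    then have "c * \<phi> n \<le> real (Suc ?m) * \<eta> ?m"
      using c(1) same[OF nxt(2)] by (simp add: \<eta>_def mult.commute)
    also have "\<dots> \<le> real (Suc ?m) * (M * \<kappa> ?m)" by (rule mult_left_mono[OF M(2)]) simp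
    also have "\<dots> = M * (real (Suc ?m) * \<kappa> ?m)" by (simp only: mult_ac)
    also have "\<dots> \<le> M * (real (Suc n) * \<kappa> n)"
      using M(1) by (intro mult_left_mono quasiconvex_le[OF \<kappa>(2) nxt(1)]) simp
    finally have "real (Suc n) * (c * \<mu> n) \<le> real (Suc n) * (M * \<kappa> n)" by (simp only: \<phi>_def mult_ac)
    then have "c * \<mu> n \<le> M * \<kappa> n" by (rule mult_left_le_imp_le) simp
    then have "\<mu> n \<le> (M / c) * \<kappa> n" using c(1) by (simp add: field_simps)
    then show ?thesis using \<mu>(2)[of n] by simp
  qed
  then have "dominated \<xi> \<kappa>" by (rule dominatedI)
  then show "\<xi> \<in> J" using is_char_setD(3)[OF J(1) \<kappa>(1)] \<xi> by (simp add: se_set_def)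
qed

text \<open>The square root beats every constant, since \<open>sqrt (\<theta> m)\<close> is much
  larger than \<open>\<theta> m\<close> for small values, and the slow reindexing by the integer
  square root beats every ampliation.\<close>

lemma strictly_larger_sequence:
  assumes \<theta>: "\<theta> \<in> c0_star" and pos: "\<And>n. 0 < \<theta> n"
  obtains \<eta> where "\<eta> \<in> c0_star" "dominated \<theta> \<eta>" "\<eta> \<notin> principal_char_set \<theta>"
proof -
  define r where "r n = nat \<lfloor>sqrt (real n)\<rfloor>" for n
  define \<eta> where "\<eta> n = sqrt (\<theta> (r n))" for n
  have r_mono: "r m \<le> r n" if "m \<le> n" for m n
    unfolding r_def using that by (intro nat_mono floor_mono) simp
  have r_square: "r (m ^ 2) = m" for m by (simp add: r_def)
  have "filterlim r sequentially sequentially"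
    unfolding filterlim_at_top eventually_sequentially using r_mono r_square by metis
  then have "(\<lambda>n. sqrt (\<theta> (r n))) \<longlonglongrightarrow> sqrt 0"
    by (intro tendsto_real_sqrt filterlim_compose[OF c0_star_tendsto[OF \<theta>]])
  then have "\<eta> \<longlonglongrightarrow> 0" by (simp add: \<eta>_def[abs_def])
  then have \<eta>: "\<eta> \<in> c0_star"
    using c0_star_antimono[OF \<theta> r_mono] c0_star_nonneg[OF \<theta>] by (auto simp: c0_star_def decseq_def \<eta>_def)
  have "\<theta> n \<le> sqrt (\<theta> 0) * \<eta> n" for n
  proof -
    have "r n \<le> n"
      using power2_nat_le_eq_le[of "r n" n] real_sqrt_le_iff
      by (metis le_square of_nat_le_iff power2_eq_square r_mono r_square)
    then have "\<theta> n \<le> \<theta> (r n)" by (rule c0_star_antimono[OF \<theta>])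
    also have "\<dots> = sqrt (\<theta> (r n)) * sqrt (\<theta> (r n))" using c0_star_nonneg[OF \<theta>] by simp
    also have "\<dots> \<le> sqrt (\<theta> 0) * \<eta> n"
      unfolding \<eta>_def using c0_star_antimono[OF \<theta>, of 0 "r n"] c0_star_nonneg[OF \<theta>]
      by (intro mult_right_mono) auto
    finally show ?thesis .
  qed
  then have dom: "dominated \<theta> \<eta>" by (rule dominatedI)
  have "\<eta> \<notin> principal_char_set \<theta>"
  proof
    assume "\<eta> \<in> principal_char_set \<theta>"
    then obtain k M where M: "M > 0" "\<And>n. \<eta> n \<le> M * \<theta> (n div 2 ^ k)"
      by (rule in_principal_char_setD[OF _ \<theta>]) blast
    have "(\<lambda>n. sqrt (\<theta> n)) \<longlonglongrightarrow> sqrt 0" by (intro tendsto_real_sqrt c0_star_tendsto[OF \<theta>])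
    then have "\<forall>\<^sub>F n in sequentially. sqrt (\<theta> n) < 1 / M" using M(1) by (intro order_tendstoD(2)) auto
    then obtain N where N: "\<And>n. n \<ge> N \<Longrightarrow> sqrt (\<theta> n) < 1 / M" by (auto simp: eventually_sequentially)
    \<comment> \<open>At \<open>m ^ 2\<close> the reindexing returns \<open>m\<close>;
      \<open>m \<ge> 2 ^ k\<close> keeps the ampliated index at or above \<open>m\<close>, and
      \<open>m \<ge> N\<close> makes \<open>M * sqrt (\<theta> m)\<close> less than 1.\<close>
    define m where "m = max N (2 ^ k)"
    have "m * 2 ^ k \<le> m ^ 2" by (simp add: m_def power2_eq_square)
    then have "m \<le> m ^ 2 div 2 ^ k"
      by (metis div_le_mono nonzero_mult_div_cancel_right power_not_zero zero_neq_numeral)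
    have "sqrt (\<theta> m) \<le> M * \<theta> (m ^ 2 div 2 ^ k)" using M(2)[of "m ^ 2"] by (simp add: \<eta>_def r_square)
    also have "\<dots> \<le> M * \<theta> m"
      using M(1) by (intro mult_left_mono c0_star_antimono[OF \<theta> \<open>m \<le> m ^ 2 div 2 ^ k\<close>]) simp
    also have "\<dots> = (M * sqrt (\<theta> m)) * sqrt (\<theta> m)" using pos[of m] by simp
    finally have "1 * sqrt (\<theta> m) \<le> (M * sqrt (\<theta> m)) * sqrt (\<theta> m)" by simp
    then have "1 \<le> M * sqrt (\<theta> m)" by (rule mult_right_le_imp_le) (use pos in simp)
    moreover have "M * sqrt (\<theta> m) < 1" using N[of m] M(1) by (simp add: m_def field_simps)
    ultimately show False by simp
  qed
  with \<eta> dom show ?thesis by (rule that)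
qed

text \<open>The case of an ideal that is open but not stable at infinity, with quasiconvex generator
  \<kappa>. The estimates mirror those for ordinary means, with smaller and larger indices
  exchanged.\<close>

lemma quasiconvex_open_inf_hulls:
  assumes \<kappa>: "quasiconvex \<kappa>" and "0 < \<kappa> 0"
    and unstable: "pre_am_inf_set (principal_char_set \<kappa>) \<noteq> principal_char_set \<kappa>"
  obtains \<eta>1 \<eta>2 where "\<eta>1 \<in> c0_star" "\<eta>2 \<in> c0_star" "0 < \<eta>1 0"
    "principal_char_set \<eta>1 \<subset> principal_char_set \<kappa>" "principal_char_set \<kappa> \<subset> principal_char_set \<eta>2"
    "open_inf_hull (principal_char_set \<eta>1) (interior_inf_set (principal_char_set \<kappa>))"
    "open_inf_hull (principal_char_set \<kappa>) (interior_inf_set (principal_char_set \<eta>2))"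
proof -
  have c0: "\<kappa> \<in> c0_star" by (rule quasiconvex_c0_star[OF \<kappa>])
  let ?S = "principal_char_set \<kappa>"
  note S = is_char_set_principal[OF c0]
  have flat: "long_flat \<kappa>" and pos: "\<And>n. 0 < \<kappa> n"
    using quasiconvex_unstable_long_flat[OF assms] by auto
  obtain \<eta>1 \<eta>2 where \<eta>: "\<eta>1 \<in> c0_star" "\<eta>2 \<in> c0_star" "\<And>n. \<eta>1 n \<le> \<kappa> n" "\<And>n. \<kappa> n \<le> \<eta>2 n"
    "\<kappa> \<notin> principal_char_set \<eta>1" "\<eta>2 \<notin> ?S"
    and zero: "\<And>n. \<exists>p\<le>n. real (Suc n) * \<kappa> n \<le> 2 * (real (Suc p) * \<eta>1 p)"
    and above: "\<And>n. \<exists>q\<ge>n. real (Suc n) * \<kappa> n \<le> 2 * (real (Suc q) * \<eta>1 q)"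
    and below: "\<And>n. \<exists>p\<le>n. real (Suc p) * \<eta>2 p \<le> 2 * (real (Suc n) * \<kappa> n)"
    by (rule flat_modification[OF c0 pos flat]) blast
  have dom: "dominated \<eta>1 \<kappa>" "dominated \<kappa> \<eta>2" using \<eta>(3,4) by (auto intro!: dominatedI[of _ 1])
  have "\<kappa> \<in> interior_inf_set ?S" by (rule interior_inf_setI[OF S principal_char_set_self[OF c0] \<kappa>])
  moreover have nz: "?S \<noteq> {\<lambda>n. 0}" by (rule principal_char_set_nonzero[OF c0 \<open>0 < \<kappa> 0\<close>])
  ultimately have int: "interior_inf_set ?S = ?S"
    using interior_inf_set_subset[OF S] principal_char_set_least[OF is_char_set_interior_inf_set[OF S nz] c0] by blast
  have sub: "principal_char_set \<eta>1 \<subset> ?S" "?S \<subset> principal_char_set \<eta>2"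
    using \<eta>(5,6) dominated_in_principal_char_set[OF \<eta>(1) dom(1)] dominated_in_principal_char_set[OF c0 dom(2)]
      principal_char_set_subset_iff[OF \<eta>(1) c0] principal_char_set_subset_iff[OF c0 \<eta>(1)]
      principal_char_set_subset_iff[OF \<eta>(2) c0] principal_char_set_subset_iff[OF c0 \<eta>(2)] by blast+
  have \<kappa>_se: "\<kappa> \<in> se_set" by (rule quasiconvex_se_set[OF \<kappa>])
  have \<eta>1_se: "\<eta>1 \<in> se_set" by (rule is_char_setD(3)[OF is_char_set_se_set \<kappa>_se \<eta>(1) dom(1)])
  have "0 < \<eta>1 0" using zero[of 0] pos[of 0] by simp
  have hull1: "open_inf_hull (principal_char_set \<eta>1) (interior_inf_set ?S)"
  proof (rule open_inf_hullI[OF S nz])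
    show "principal_char_set \<eta>1 \<inter> se_set \<subseteq> interior_inf_set ?S" unfolding int using sub(1) by blast
    fix J assume J: "is_char_set J" "interior_inf_set J = J" "principal_char_set \<eta>1 \<inter> se_set \<subseteq> J"
    then have "\<eta>1 \<in> interior_inf_set J" using \<eta>1_se principal_char_set_self[OF \<eta>(1)] by blast
    then obtain \<theta> where \<theta>: "\<theta> \<in> J" "quasiconvex \<theta>" "dominated \<eta>1 \<theta>" by (auto simp: interior_inf_set_def)
    then obtain M where M: "M > 0" "\<And>n. \<eta>1 n \<le> M * \<theta> n"
      using dominated_pos[OF \<theta>(3)] c0_star_nonneg[OF quasiconvex_c0_star[OF \<theta>(2)]] by blast
    have "\<kappa> n \<le> (2 * M) * \<theta> n" for n
    proof -
      obtain q where q: "n \<le> q" "real (Suc n) * \<kappa> n \<le> 2 * (real (Suc q) * \<eta>1 q)" using above by blast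
      note q(2)
      also have "2 * (real (Suc q) * \<eta>1 q) \<le> 2 * (real (Suc q) * (M * \<theta> q))"
        using M(2)[of q] by (intro mult_left_mono) auto
      also have "\<dots> = (2 * M) * (real (Suc q) * \<theta> q)" by (simp only: mult_ac)
      also have "\<dots> \<le> (2 * M) * (real (Suc n) * \<theta> n)"
        using M(1) by (intro mult_left_mono quasiconvex_le[OF \<theta>(2) q(1)]) simp
      also have "\<dots> = real (Suc n) * ((2 * M) * \<theta> n)" by (simp only: mult_ac)
      finally show ?thesis by (rule mult_left_le_imp_le) simp
    qed
    then have "\<kappa> \<in> J" by (intro is_char_setD(3)[OF J(1) \<theta>(1) c0] dominatedI)
    then show "interior_inf_set ?S \<subseteq> J" unfolding int using principal_char_set_least[OF J(1) c0] by simp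
  qed
  note S2 = is_char_set_principal[OF \<eta>(2)]
  have "0 < \<eta>2 0" using \<eta>(4)[of 0] pos[of 0] by simp
  note nz2 = principal_char_set_nonzero[OF \<eta>(2) this]
  have hull2: "open_inf_hull ?S (interior_inf_set (principal_char_set \<eta>2))"
  proof (rule open_inf_hullI[OF S2 nz2])
    have "\<kappa> \<in> interior_inf_set (principal_char_set \<eta>2)"
      by (rule interior_inf_setI[OF S2 dominated_in_principal_char_set[OF c0 dom(2)] \<kappa>])
    then show "?S \<inter> se_set \<subseteq> interior_inf_set (principal_char_set \<eta>2)"
      using principal_char_set_least[OF is_char_set_interior_inf_set[OF S2 nz2] c0] by blast
    fix J assume J: "is_char_set J" "?S \<inter> se_set \<subseteq> J"
    then have "\<kappa> \<in> J" using \<kappa>_se principal_char_set_self[OF c0] by blast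
    then have "?S \<subseteq> J" using principal_char_set_least[OF J(1) c0] by simp
    show "interior_inf_set (principal_char_set \<eta>2) \<subseteq> J"
    proof
      fix \<xi> assume "\<xi> \<in> interior_inf_set (principal_char_set \<eta>2)"
      then obtain \<theta> where \<theta>: "\<xi> \<in> c0_star" "\<theta> \<in> principal_char_set \<eta>2" "quasiconvex \<theta>" "dominated \<xi> \<theta>"
        by (auto simp: interior_inf_set_def)
      obtain k M where M: "M > 0" "\<And>n. \<theta> n \<le> M * \<eta>2 (n div 2 ^ k)"
        by (rule in_principal_char_setD[OF \<theta>(2) \<eta>(2)]) blast
      \<comment> \<open>From \<open>p \<le> n div 2 ^ k\<close> follows
        \<open>2 ^ k * p \<le> n\<close>, so the decrease of \<open>(n + 1) * \<theta> n\<close>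
        applies. The ampliation stays on the right-hand side, which suffices for membership in
        \<open>?S\<close>.\<close>
      have "\<theta> n \<le> (2 * M * 2 ^ k) * \<kappa> (n div 2 ^ k)" for n
      proof -
        let ?m = "n div 2 ^ k"
        obtain p where p: "p \<le> ?m" "real (Suc p) * \<eta>2 p \<le> 2 * (real (Suc ?m) * \<kappa> ?m)" using below by blast
        have "2 ^ k * p \<le> n"
          using mult_le_mono2[OF p(1), of "2 ^ k"] times_div_less_eq_dividend[of "2 ^ k" n] by linarith
        then have "real (Suc n) * \<theta> n \<le> real (Suc (2 ^ k * p)) * \<theta> (2 ^ k * p)"
          by (rule quasiconvex_le[OF \<theta>(3)])
        also have "\<dots> \<le> real (Suc (2 ^ k * p)) * (M * \<eta>2 p)"
          using M(2)[of "2 ^ k * p"] by (intro mult_left_mono) auto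
        also have "\<dots> \<le> (2 ^ k * real (Suc p)) * (M * \<eta>2 p)"
          using M(1) c0_star_nonneg[OF \<eta>(2)] by (intro mult_right_mono) (auto simp: algebra_simps)
        also have "\<dots> = (M * 2 ^ k) * (real (Suc p) * \<eta>2 p)" by (simp only: mult_ac)
        also have "\<dots> \<le> (M * 2 ^ k) * (2 * (real (Suc ?m) * \<kappa> ?m))" using M(1) by (intro mult_left_mono p(2)) simp
        also have "\<dots> \<le> (M * 2 ^ k) * (2 * (real (Suc n) * \<kappa> ?m))"
          using M(1) pos[of ?m] by (intro mult_left_mono mult_right_mono) auto
        also have "\<dots> = real (Suc n) * ((2 * M * 2 ^ k) * \<kappa> ?m)" by (simp only: mult_ac)
        finally show ?thesis by (rule mult_left_le_imp_le) simp
      qed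
      then have "\<theta> \<in> ?S" by (rule in_principal_char_setI[OF quasiconvex_c0_star[OF \<theta>(3)]])
      then have "\<theta> \<in> J" using \<open>?S \<subseteq> J\<close> by blast
      then show "\<xi> \<in> J" by (rule is_char_setD(3)[OF J(1) _ \<theta>(1,4)])
    qed
  qed
  show ?thesis by (rule that[OF \<eta>(1,2) \<open>0 < \<eta>1 0\<close> sub hull1 hull2])
qed

lemma principal_open_inf_hull_below:
  assumes \<rho>: "\<rho> \<in> c0_star" and "0 < \<rho> 0"
    and unstable: "pre_am_inf_set (principal_char_set \<rho>) \<noteq> principal_char_set \<rho>"
  shows "\<exists>\<eta>\<in>c0_star. 0 < \<eta> 0 \<and> principal_char_set \<eta> \<subset> principal_char_set \<rho> \<and>
    open_inf_hull (principal_char_set \<eta>) (interior_inf_set (principal_char_set \<rho>))"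
proof -
  let ?S = "principal_char_set \<rho>"
  note S = is_char_set_principal[OF \<rho>]
  have nz: "?S \<noteq> {\<lambda>n. 0}" by (rule principal_char_set_nonzero[OF \<rho> \<open>0 < \<rho> 0\<close>])
  show ?thesis
  proof (cases "omega \<in> ?S")
    \<comment> \<open>The interior is \<open>se_set\<close>. The smaller generator is
      \<open>omega\<close> lowered on its flat stretches: it generates a strictly smaller ideal but
      stays outside \<open>se_set\<close>, so its open hull is still all of
      \<open>se_set\<close>.\<close>
    case True
    have "0 < omega n" for n by (simp add: omega_def)
    then obtain \<eta> where \<eta>: "\<eta> \<in> c0_star" "\<And>n. \<eta> n \<le> omega n" "omega \<notin> principal_char_set \<eta>"
      and below: "\<And>n. \<exists>p\<le>n. real (Suc n) * omega n \<le> 2 * (real (Suc p) * \<eta> p)"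
      and above: "\<And>n. \<exists>q\<ge>n. real (Suc n) * omega n \<le> 2 * (real (Suc q) * \<eta> q)"
      by (rule flat_modification[OF omega_c0_star _ omega_long_flat]) blast
    have "\<eta> \<notin> se_set"
    proof
      assume "\<eta> \<in> se_set"
      then have "\<forall>\<^sub>F n in sequentially. real (Suc n) * \<eta> n < 1 / 2"
        unfolding se_set_def by (intro order_tendstoD(2)) auto
      then obtain N where N: "\<And>n. n \<ge> N \<Longrightarrow> real (Suc n) * \<eta> n < 1 / 2" by (auto simp: eventually_sequentially)
      obtain q where "N \<le> q" "real (Suc N) * omega N \<le> 2 * (real (Suc q) * \<eta> q)" using above by blast
      moreover have "real (Suc N) * omega N = 1" by (simp add: omega_def)
      ultimately show False using N[of q] by linarith
    qed
    have "0 < \<eta> 0" using below[of 0] by (simp add: omega_def)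
    have "dominated \<eta> omega" using \<eta>(2) by (intro dominatedI[of _ 1]) simp
    then have "\<eta> \<in> ?S" by (rule is_char_setD(3)[OF S True \<eta>(1)])
    then have "principal_char_set \<eta> \<subset> ?S"
      using principal_char_set_least[OF S \<eta>(1)] True \<eta>(3) by blast
    moreover have "open_inf_hull (principal_char_set \<eta>) (interior_inf_set ?S)"
      by (rule open_inf_hullI[OF S nz])
        (use se_set_subset_open[OF \<eta>(1) \<open>\<eta> \<notin> se_set\<close>] in \<open>auto simp: interior_inf_set_omega[OF S True]\<close>)
    ultimately show ?thesis using \<eta>(1) \<open>0 < \<eta> 0\<close> by blast
  next
    case False
    obtain \<nu> where \<nu>: "quasiconvex \<nu>" "\<And>n. \<nu> n \<le> \<rho> n" "\<nu> 0 = \<rho> 0"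
      "\<And>\<kappa>. quasiconvex \<kappa> \<Longrightarrow> \<kappa> \<in> ?S \<Longrightarrow> \<kappa> \<in> principal_char_set \<nu>"
      by (rule quasiconvex_lower_envelope[OF \<rho> False]) blast
    note c0 = quasiconvex_c0_star[OF \<nu>(1)]
    have "\<nu> \<in> ?S" using \<nu>(2) by (intro dominated_in_principal_char_set[OF c0] dominatedI[of _ 1]) simp
    \<comment> \<open>If the envelope generates the same ideal, that ideal has a quasiconvex
      generator and instability provides the modification; otherwise the envelope itself is the
      smaller generator.\<close>
    show ?thesis
    proof (cases "\<rho> \<in> principal_char_set \<nu>")
      case True
      then have eq: "?S = principal_char_set \<nu>" by (rule principal_char_set_eqI[OF \<rho> c0 _ \<open>\<nu> \<in> ?S\<close>])
      show ?thesis
        by (rule quasiconvex_open_inf_hulls[OF \<nu>(1)])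
          (use \<nu>(3) \<open>0 < \<rho> 0\<close> unstable eq in auto)
    next
      case False
      then have "principal_char_set \<nu> \<subset> ?S"
        using principal_char_set_subset_iff[OF c0 \<rho>] \<open>\<nu> \<in> ?S\<close> principal_char_set_self[OF \<rho>] by blast
      moreover have "open_inf_hull (principal_char_set \<nu>) (interior_inf_set ?S)"
      proof (rule open_inf_hullI[OF S nz])
        have "\<nu> \<in> interior_inf_set ?S" by (rule interior_inf_setI[OF S \<open>\<nu> \<in> ?S\<close> \<nu>(1)])
        then show "principal_char_set \<nu> \<inter> se_set \<subseteq> interior_inf_set ?S"
          using principal_char_set_least[OF is_char_set_interior_inf_set[OF S nz] c0] by blast
        fix J assume J: "is_char_set J" "principal_char_set \<nu> \<inter> se_set \<subseteq> J"
        have "\<nu> \<in> J" using J(2) quasiconvex_se_set[OF \<nu>(1)] principal_char_set_self[OF c0] by blast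
        then have "principal_char_set \<nu> \<subseteq> J" using principal_char_set_least[OF J(1) c0] by simp
        then show "interior_inf_set ?S \<subseteq> J"
          using \<nu>(4) is_char_setD(3)[OF J(1)] unfolding interior_inf_set_def by blast
      qed
      moreover have "0 < \<nu> 0" using \<nu>(3) \<open>0 < \<rho> 0\<close> by simp
      ultimately show ?thesis using c0 by blast
    qed
  qed
qed

lemma principal_open_inf_hull_above:
  assumes \<rho>: "\<rho> \<in> c0_star" and "0 < \<rho> 0"
    and unstable: "pre_am_inf_set (principal_char_set \<rho>) \<noteq> principal_char_set \<rho>"
  shows "\<exists>\<eta>\<in>c0_star. principal_char_set \<rho> \<subset> principal_char_set \<eta> \<and>
    open_inf_hull (principal_char_set \<rho>) (interior_inf_set (principal_char_set \<eta>))"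
proof (cases "\<rho> \<in> se_set")
  case False
  let ?S = "principal_char_set \<rho>"
  \<comment> \<open>No quasiconvex sequence dominates \<rho> here, and the hull is
    \<open>se_set\<close>. A strictly larger principal ideal has this interior as soon as it
    contains \<open>omega\<close>; adding \<open>omega\<close> achieves that and makes all terms
    positive.\<close>
  define \<theta> where "\<theta> n = \<rho> n + omega n" for n
  have \<theta>: "\<theta> \<in> c0_star" unfolding \<theta>_def by (rule c0_star_add[OF \<rho> omega_c0_star])
  have "0 < \<theta> n" for n using c0_star_nonneg[OF \<rho>, of n] by (simp add: \<theta>_def omega_def add_nonneg_pos)
  then obtain \<eta> where \<eta>: "\<eta> \<in> c0_star" "dominated \<theta> \<eta>" "\<eta> \<notin> principal_char_set \<theta>"
    by (rule strictly_larger_sequence[OF \<theta>]) blast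
  note S = is_char_set_principal[OF \<eta>(1)]
  have \<theta>_\<eta>: "\<theta> \<in> principal_char_set \<eta>" by (rule dominated_in_principal_char_set[OF \<theta> \<eta>(2)])
  have dom: "dominated \<rho> \<theta>" "dominated omega \<theta>"
    using c0_star_nonneg[OF \<rho>] by (auto intro!: dominatedI[of _ 1] simp: \<theta>_def omega_def)
  have "\<rho> \<in> principal_char_set \<eta>" by (rule is_char_setD(3)[OF S \<theta>_\<eta> \<rho> dom(1)])
  moreover have omega: "omega \<in> principal_char_set \<eta>" by (rule is_char_setD(3)[OF S \<theta>_\<eta> omega_c0_star dom(2)])
  moreover have "\<eta> \<notin> ?S"
    using \<eta>(3) principal_char_set_subset_iff[OF \<rho> \<theta>] dominated_in_principal_char_set[OF \<rho> dom(1)] by blast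
  ultimately have "?S \<subset> principal_char_set \<eta>"
    using principal_char_set_subset_iff[OF \<rho> \<eta>(1)] principal_char_set_self[OF \<eta>(1)] by blast
  moreover have "principal_char_set \<eta> \<noteq> {\<lambda>n. 0}"
    using omega by (auto simp: omega_def[abs_def] fun_eq_iff)
  then have "open_inf_hull ?S (interior_inf_set (principal_char_set \<eta>))"
    by (rule open_inf_hullI[OF S])
      (use se_set_subset_open[OF \<rho> False] in \<open>auto simp: interior_inf_set_omega[OF S omega]\<close>)
  ultimately show ?thesis using \<eta>(1) by blast
next
  case True
  let ?S = "principal_char_set \<rho>"
  obtain \<mu> where \<mu>: "quasiconvex \<mu>" "\<And>n. \<rho> n \<le> \<mu> n"
    "\<And>\<kappa>. quasiconvex \<kappa> \<Longrightarrow> dominated \<rho> \<kappa> \<Longrightarrow> dominated \<mu> \<kappa>"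
    by (rule quasiconvex_upper_envelope[OF True]) blast
  note c0 = quasiconvex_c0_star[OF \<mu>(1)]
  note S = is_char_set_principal[OF c0]
  have "0 < \<mu> 0" using \<mu>(2)[of 0] \<open>0 < \<rho> 0\<close> by simp
  note nz = principal_char_set_nonzero[OF c0 this]
  have "dominated \<rho> \<mu>" using \<mu>(2) by (intro dominatedI[of _ 1]) simp
  then have \<rho>_\<mu>: "\<rho> \<in> principal_char_set \<mu>" by (rule dominated_in_principal_char_set[OF \<rho>])
  show ?thesis
  proof (cases "\<mu> \<in> ?S")
    case True
    then have eq: "?S = principal_char_set \<mu>" by (rule principal_char_set_eqI[OF \<rho> c0 \<rho>_\<mu>])
    show ?thesis
      by (rule quasiconvex_open_inf_hulls[OF \<mu>(1) \<open>0 < \<mu> 0\<close>]) (use unstable eq in auto)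
  next
    case False
    then have "?S \<subset> principal_char_set \<mu>"
      using principal_char_set_subset_iff[OF \<rho> c0] \<rho>_\<mu> principal_char_set_self[OF c0] by blast
    moreover have "open_inf_hull ?S (interior_inf_set (principal_char_set \<mu>))"
    proof (rule open_inf_hullI[OF S nz])
      have "\<rho> \<in> interior_inf_set (principal_char_set \<mu>)"
        using is_char_setD(3)[OF is_char_set_interior_inf_set[OF S nz]
            interior_inf_setI[OF S principal_char_set_self[OF c0] \<mu>(1)] \<rho> \<open>dominated \<rho> \<mu>\<close>] .
      then show "?S \<inter> se_set \<subseteq> interior_inf_set (principal_char_set \<mu>)"
        using principal_char_set_least[OF is_char_set_interior_inf_set[OF S nz] \<rho>] by blast
      fix J assume J: "is_char_set J" "interior_inf_set J = J" "?S \<inter> se_set \<subseteq> J"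
      have "\<rho> \<in> interior_inf_set J" using J(2,3) principal_char_set_self[OF \<rho>] \<open>\<rho> \<in> se_set\<close> by blast
      then obtain \<kappa> where \<kappa>: "\<kappa> \<in> J" "quasiconvex \<kappa>" "dominated \<rho> \<kappa>" by (auto simp: interior_inf_set_def)
      have "\<mu> \<in> J" by (rule is_char_setD(3)[OF J(1) \<kappa>(1) c0 \<mu>(3)[OF \<kappa>(2,3)]])
      then have "principal_char_set \<mu> \<subseteq> J" using principal_char_set_least[OF J(1) c0] by simp
      then show "interior_inf_set (principal_char_set \<mu>) \<subseteq> J" using interior_inf_set_subset[OF S] by blast
    qed
    ultimately show ?thesis using c0 by blast
  qed
qed

section \<open>From characteristic sets back to ideals\<close>

context
  fixes e :: "nat \<Rightarrow> 'h::complex_hilbert"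
  assumes e: "orthonormal_sys e"
begin

lemma op_ideal_mem_char_set_iff:
  assumes J: "op_ideal J"
  shows "X \<in> J \<longleftrightarrow> X \<in> compact_operators \<and> s_numbers (X :: 'h \<Rightarrow>\<^sub>L 'h) \<in> char_set J"
proof
  show "X \<in> J \<Longrightarrow> X \<in> compact_operators \<and> s_numbers X \<in> char_set J"
    using J by (auto simp: op_ideal_def char_set_def)
next
  assume X: "X \<in> compact_operators \<and> s_numbers X \<in> char_set J"
  then have "diag e (s_numbers X) \<in> J" by (simp add: char_set_eq[OF e J])
  with X show "X \<in> J" using op_ideal_mem_iff[OF e J, of X] by blast
qed

lemma char_set_am_interior:
  assumes I: "op_ideal (I :: ('h \<Rightarrow>\<^sub>L 'h) set)"
  shows "op_ideal (am_interior I)" "char_set (am_interior I) = interior_set (char_set I)"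
proof -
  note S = is_char_set_char_set[OF e I]
  note P = is_char_set_pre_am_set[OF S]
  have pre: "pre_am I = ideal_of_char_set (pre_am_set (char_set I))"
    by (simp add: pre_am_def pre_am_set_def)
  have "am_interior I = ideal_of_char_set (am_set (pre_am_set (char_set I)))"
    by (simp only: am_interior_def am_def pre ideal_of_char_set(2)[OF e P] am_set_def)
  then show "op_ideal (am_interior I)" "char_set (am_interior I) = interior_set (char_set I)"
    using ideal_of_char_set[OF e is_char_set_am_set[OF P]] by (simp_all add: am_set_pre_am_set[OF S])
qed

lemma am_open_iff: "am_open J \<longleftrightarrow> op_ideal J \<and> interior_set (char_set J) = char_set (J :: ('h \<Rightarrow>\<^sub>L 'h) set)"
  unfolding am_open_def using char_set_am_interior op_ideal_eq_iff[OF e] by metis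

lemma am_stable_iff: "am_stable J \<longleftrightarrow> op_ideal J \<and> pre_am_set (char_set J) = char_set (J :: ('h \<Rightarrow>\<^sub>L 'h) set)"
proof (cases "op_ideal J")
  case True
  note P = ideal_of_char_set[OF e is_char_set_pre_am_set[OF is_char_set_char_set[OF e True]]]
  have "pre_am J = ideal_of_char_set (pre_am_set (char_set J))"
    by (simp add: pre_am_def pre_am_set_def)
  then show ?thesis
    using op_ideal_eq_iff[OF e True P(1)] P(2) True by (auto simp: am_stable_def)
qed (simp add: am_stable_def)

text \<open>Sets of operators are ordered by inclusion, so \<open>LEAST\<close> asks for a smallest
  open ideal. \<open>open_hull\<close> is the same property of characteristic sets, transferred by
  the Calkin correspondence.\<close>

lemma am_oo_eqI:
  assumes I: "op_ideal I" and T: "op_ideal (T :: ('h \<Rightarrow>\<^sub>L 'h) set)" and hull: "open_hull (char_set I) (char_set T)"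
  shows "am_oo I = T"
  unfolding am_oo_def
proof (rule Least_equality)
  show "am_open T \<and> I \<subseteq> T"
    using hull T op_ideal_subset_iff[OF e I T] by (simp add: open_hull_def am_open_iff)
  fix J assume "am_open J \<and> I \<subseteq> J"
  then show "T \<le> J"
    using hull op_ideal_subset_iff[OF e I, of J] op_ideal_subset_iff[OF e T, of J] is_char_set_char_set[OF e, of J]
    by (simp add: open_hull_def am_open_iff)
qed

lemma char_set_trace_class:
  assumes I: "op_ideal (I :: ('h \<Rightarrow>\<^sub>L 'h) set)"
  shows "char_set (I \<inter> trace_class) = char_set I \<inter> l1_star"
proof -
  have "X \<in> I \<Longrightarrow> X \<in> trace_class \<longleftrightarrow> s_numbers X \<in> l1_star" for X
    using op_ideal_mem_char_set_iff[OF I, of X] is_char_setD(1)[OF is_char_set_char_set[OF e I]]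
    by (auto simp: trace_class_def l1_star_def)
  then show ?thesis by (auto simp: char_set_def)
qed

lemma char_set_am_inf_interior:
  assumes I: "op_ideal (I :: ('h \<Rightarrow>\<^sub>L 'h) set)" and nz: "char_set I \<noteq> {\<lambda>n. 0}"
  shows "op_ideal (am_inf_interior I)" "char_set (am_inf_interior I) = interior_inf_set (char_set I)"
proof -
  note S = is_char_set_char_set[OF e I]
  note P = is_char_set_pre_am_inf_set[OF S nz]
  have pre: "pre_am_inf I = ideal_of_char_set (pre_am_inf_set (char_set I))"
    by (simp add: pre_am_inf_def pre_am_inf_set_def)
  note Q = ideal_of_char_set[OF e P]
  have "am_inf_interior I = ideal_of_char_set (am_inf_set (pre_am_inf_set (char_set I)))"
    by (simp only: am_inf_interior_def am_inf_def pre char_set_trace_class[OF Q(1)] Q(2) am_inf_set_def)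
  then show "op_ideal (am_inf_interior I)" "char_set (am_inf_interior I) = interior_inf_set (char_set I)"
    using ideal_of_char_set[OF e is_char_set_am_inf_set[OF P]] by (simp_all add: am_inf_set_pre_am_inf_set[OF S])
qed

lemma am_inf_open_iff:
  assumes "char_set (J :: ('h \<Rightarrow>\<^sub>L 'h) set) \<noteq> {\<lambda>n. 0}"
  shows "am_inf_open J \<longleftrightarrow> op_ideal J \<and> interior_inf_set (char_set J) = char_set J"
  unfolding am_inf_open_def using char_set_am_inf_interior[OF _ assms] op_ideal_eq_iff[OF e] by metis

lemma am_inf_stable_iff:
  assumes nz: "char_set (J :: ('h \<Rightarrow>\<^sub>L 'h) set) \<noteq> {\<lambda>n. 0}"
  shows "am_inf_stable J \<longleftrightarrow> op_ideal J \<and> pre_am_inf_set (char_set J) = char_set J"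
proof (cases "op_ideal J")
  case True
  note P = ideal_of_char_set[OF e is_char_set_pre_am_inf_set[OF is_char_set_char_set[OF e True] nz]]
  have "pre_am_inf J = ideal_of_char_set (pre_am_inf_set (char_set J))"
    by (simp add: pre_am_inf_def pre_am_inf_set_def)
  then show ?thesis
    using op_ideal_eq_iff[OF e True P(1)] P(2) True by (auto simp: am_inf_stable_def)
qed (simp add: am_inf_stable_def)

lemma Int_se_omega_subset_iff:
  assumes I: "op_ideal (I :: ('h \<Rightarrow>\<^sub>L 'h) set)" and J: "op_ideal J"
  shows "I \<inter> se_omega \<subseteq> J \<longleftrightarrow> char_set I \<inter> se_set \<subseteq> char_set J"
proof -
  have se: "se_omega = (ideal_of_char_set se_set :: ('h \<Rightarrow>\<^sub>L 'h) set)"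
    by (simp add: se_omega_def se_set_smallo)
  note E = ideal_of_char_set[OF e is_char_set_se_set, folded se]
  show ?thesis
  proof
    assume sub: "I \<inter> se_omega \<subseteq> J"
    show "char_set I \<inter> se_set \<subseteq> char_set J"
    proof
      fix \<xi> assume "\<xi> \<in> char_set I \<inter> se_set"
      then have "\<xi> \<in> c0_star" "diag e \<xi> \<in> I" "diag e \<xi> \<in> se_omega"
        using char_set_eq[OF e I] char_set_eq[OF e E(1)] E(2) by auto
      then show "\<xi> \<in> char_set J" using sub char_set_eq[OF e J] by auto
    qed
  next
    assume sub: "char_set I \<inter> se_set \<subseteq> char_set J"
    show "I \<inter> se_omega \<subseteq> J"
    proof
      fix X :: "'h \<Rightarrow>\<^sub>L 'h" assume "X \<in> I \<inter> se_omega"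
      then show "X \<in> J"
        using sub op_ideal_mem_char_set_iff[OF I, of X] op_ideal_mem_char_set_iff[OF E(1), of X] E(2)
          op_ideal_mem_char_set_iff[OF J, of X] by auto
    qed
  qed
qed

lemma am_inf_oo_eqI:
  assumes I: "op_ideal (I :: ('h \<Rightarrow>\<^sub>L 'h) set)" and nz: "char_set I \<noteq> {\<lambda>n. 0}"
    and T: "op_ideal T" and hull: "open_inf_hull (char_set I) (char_set T)"
  shows "am_inf_oo I = T"
  unfolding am_inf_oo_def
proof (rule Least_equality)
  have T_nz: "char_set T \<noteq> {\<lambda>n. 0}" using hull by (simp add: open_inf_hull_def)
  show "am_inf_open T \<and> I \<inter> se_omega \<subseteq> T"
    using hull T Int_se_omega_subset_iff[OF I T] by (simp add: open_inf_hull_def am_inf_open_iff[OF T_nz])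
  fix J assume J: "am_inf_open J \<and> I \<inter> se_omega \<subseteq> J"
  then have op: "op_ideal J" by (simp add: am_inf_open_def)
  have sub: "char_set I \<inter> se_set \<subseteq> char_set J" using J Int_se_omega_subset_iff[OF I op] by simp
  \<comment> \<open>Every competitor \<open>J\<close> contains the finite rank operators and is
    therefore nonzero, as the translation of openness at infinity requires.\<close>
  have "delta0 \<in> char_set I \<inter> se_set"
    using delta0_in_char_set[OF is_char_set_char_set[OF e I] nz] quasiconvex_se_set[OF delta0_quasiconvex] by simp
  then have "char_set J \<noteq> {\<lambda>n. 0}" using sub delta0_nonzero by blast
  then have "interior_inf_set (char_set J) = char_set J" using J am_inf_open_iff by blast
  then have "char_set T \<subseteq> char_set J"
    using hull sub is_char_set_char_set[OF e op] by (simp add: open_inf_hull_def)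
  then show "T \<le> J" using op_ideal_subset_iff[OF e T op] by simp
qed

lemma principal_ideal_subset_iff:
  assumes "\<xi> \<in> c0_star" "\<eta> \<in> c0_star"
  shows "principal_ideal e \<xi> \<subset> principal_ideal e \<eta> \<longleftrightarrow> principal_char_set \<xi> \<subset> principal_char_set \<eta>"
  using op_ideal_subset_iff[OF e] op_ideal_eq_iff[OF e] principal_ideal[OF e assms(1)] principal_ideal[OF e assms(2)]
  by (simp add: psubset_eq)

lemma principal_ideal_zero:
  assumes "\<xi> \<in> c0_star"
  shows "principal_ideal e \<xi> \<noteq> {0} \<longleftrightarrow> 0 < \<xi> 0"
proof
  assume nz: "principal_ideal e \<xi> \<noteq> {0}"
  interpret ring "BH :: ('h \<Rightarrow>\<^sub>L 'h) ring" by (rule ring_BH)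
  have "\<not> \<xi> 0 \<le> 0"
  proof
    assume "\<xi> 0 \<le> 0"
    then have "\<xi> n = 0" for n
      using c0_star_nonneg[OF assms, of n] c0_star_antimono[OF assms, of 0 n] by simp
    then have "diag e \<xi> = 0" by (simp add: diag_def zero_blinfun_def)
    then have "principal_ideal e \<xi> = {0}" using genideal_zero by (simp add: principal_ideal_def)
    with nz show False by simp
  qed
  then show "0 < \<xi> 0" by simp
next
  assume pos: "0 < \<xi> 0"
  have diag0: "diag e (\<lambda>n. 0) = 0" by (simp add: diag_def zero_blinfun_def)
  have "s_numbers (0 :: 'h \<Rightarrow>\<^sub>L 'h) = (\<lambda>n. 0)" using s_numbers_diag[OF e c0_star_zero] by (simp add: diag0)
  then have "char_set {0 :: 'h \<Rightarrow>\<^sub>L 'h} = {\<lambda>n. 0}" by (simp add: char_set_def)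
  then show "principal_ideal e \<xi> \<noteq> {0}"
    using principal_ideal(2)[OF e assms] principal_char_set_nonzero[OF assms pos] by auto
qed

end

text \<open>Only in the first half may \<eta>1 generate the zero ideal: the am-interior of a nonzero
  ideal can be zero, whereas its interior at infinity contains the finite rank operators.\<close>

theorem proposition6p5:
  fixes e :: "nat \<Rightarrow> 'h::complex_hilbert" and \<rho> :: "nat \<Rightarrow> real"
  assumes "orthonormal_basis e"
    and "\<rho> \<in> c0_star" and "principal_ideal e \<rho> \<noteq> {0}"
  shows "(\<not> am_stable (principal_ideal e \<rho>) \<longrightarrow>
      (\<exists>\<eta>1\<in>c0_star. \<exists>\<eta>2\<in>c0_star.
        principal_ideal e \<eta>1 \<subset> principal_ideal e \<rho> \<and> principal_ideal e \<rho> \<subset> principal_ideal e \<eta>2 \<and>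
        am_oo (principal_ideal e \<eta>1) = am_interior (principal_ideal e \<rho>) \<and>
        am_oo (principal_ideal e \<rho>) = am_interior (principal_ideal e \<eta>2)))
    \<and> (\<not> am_inf_stable (principal_ideal e \<rho>) \<longrightarrow>
      (\<exists>\<eta>1\<in>c0_star. \<exists>\<eta>2\<in>c0_star.
        principal_ideal e \<eta>1 \<noteq> {0} \<and>
        principal_ideal e \<eta>1 \<subset> principal_ideal e \<rho> \<and> principal_ideal e \<rho> \<subset> principal_ideal e \<eta>2 \<and>
        am_inf_oo (principal_ideal e \<eta>1) = am_inf_interior (principal_ideal e \<rho>) \<and>
        am_inf_oo (principal_ideal e \<rho>) = am_inf_interior (principal_ideal e \<eta>2)))"
proof (intro conjI impI)
  have e: "orthonormal_sys e" using assms(1) by (simp add: orthonormal_basis_def orthonormal_sys_def)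
  note \<rho> = assms(2)
  have pos: "0 < \<rho> 0" using assms(3) principal_ideal_zero[OF e \<rho>] by simp
  note P = principal_ideal[OF e]
  note nz = principal_char_set_nonzero
  {
    assume "\<not> am_stable (principal_ideal e \<rho>)"
    then have "pre_am_set (principal_char_set \<rho>) \<noteq> principal_char_set \<rho>"
      using am_stable_iff[OF e, of "principal_ideal e \<rho>"] P[OF \<rho>] by simp
    then obtain \<eta>1 \<eta>2 where \<eta>: "\<eta>1 \<in> c0_star" "\<eta>2 \<in> c0_star"
      "principal_char_set \<eta>1 \<subset> principal_char_set \<rho>" "principal_char_set \<rho> \<subset> principal_char_set \<eta>2"
      "open_hull (principal_char_set \<eta>1) (interior_set (principal_char_set \<rho>))"
      "open_hull (principal_char_set \<rho>) (interior_set (principal_char_set \<eta>2))"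
      using principal_open_hulls[OF \<rho> pos] by blast
    have eq1: "am_oo (principal_ideal e \<eta>1) = am_interior (principal_ideal e \<rho>)"
      by (rule am_oo_eqI[OF e P(1)[OF \<eta>(1)] char_set_am_interior(1)[OF e P(1)[OF \<rho>]]])
        (simp add: char_set_am_interior(2)[OF e P(1)[OF \<rho>]] P(2) \<rho> \<eta>)
    have eq2: "am_oo (principal_ideal e \<rho>) = am_interior (principal_ideal e \<eta>2)"
      by (rule am_oo_eqI[OF e P(1)[OF \<rho>] char_set_am_interior(1)[OF e P(1)[OF \<eta>(2)]]])
        (simp add: char_set_am_interior(2)[OF e P(1)[OF \<eta>(2)]] P(2) \<rho> \<eta>)
    show "\<exists>\<eta>1\<in>c0_star. \<exists>\<eta>2\<in>c0_star.
        principal_ideal e \<eta>1 \<subset> principal_ideal e \<rho> \<and> principal_ideal e \<rho> \<subset> principal_ideal e \<eta>2 \<and>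
        am_oo (principal_ideal e \<eta>1) = am_interior (principal_ideal e \<rho>) \<and>
        am_oo (principal_ideal e \<rho>) = am_interior (principal_ideal e \<eta>2)"
      by (rule bexI[OF bexI[OF _ \<eta>(2)] \<eta>(1)])
        (simp only: principal_ideal_subset_iff[OF e] eq1 eq2 \<eta> \<rho> simp_thms)
  next
    assume "\<not> am_inf_stable (principal_ideal e \<rho>)"
    then have unstable: "pre_am_inf_set (principal_char_set \<rho>) \<noteq> principal_char_set \<rho>"
      using am_inf_stable_iff[OF e, of "principal_ideal e \<rho>"] P[OF \<rho>] nz[OF \<rho> pos] by simp
    obtain \<eta>1 where \<eta>1: "\<eta>1 \<in> c0_star" "0 < \<eta>1 0" "principal_char_set \<eta>1 \<subset> principal_char_set \<rho>"
      "open_inf_hull (principal_char_set \<eta>1) (interior_inf_set (principal_char_set \<rho>))"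
      using principal_open_inf_hull_below[OF \<rho> pos unstable] by blast
    obtain \<eta>2 where \<eta>2: "\<eta>2 \<in> c0_star" "principal_char_set \<rho> \<subset> principal_char_set \<eta>2"
      "open_inf_hull (principal_char_set \<rho>) (interior_inf_set (principal_char_set \<eta>2))"
      using principal_open_inf_hull_above[OF \<rho> pos unstable] by blast
    have nz\<rho>: "char_set (principal_ideal e \<rho>) \<noteq> {\<lambda>n. 0}" using nz[OF \<rho> pos] by (simp add: P(2)[OF \<rho>])
    have nz1: "char_set (principal_ideal e \<eta>1) \<noteq> {\<lambda>n. 0}" using nz[OF \<eta>1(1,2)] by (simp add: P(2)[OF \<eta>1(1)])
    have nz2: "char_set (principal_ideal e \<eta>2) \<noteq> {\<lambda>n. 0}"
    proof
      assume "char_set (principal_ideal e \<eta>2) = {\<lambda>n. 0}"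
      then have "principal_char_set \<rho> \<subseteq> {\<lambda>n. 0}" using \<eta>2(2) by (simp add: P(2)[OF \<eta>2(1)] psubset_eq)
      then have "\<rho> = (\<lambda>n. 0)" using principal_char_set_self[OF \<rho>] by blast
      with pos show False by simp
    qed
    note I = char_set_am_inf_interior[OF e P(1)[OF \<rho>] nz\<rho>]
    note I2 = char_set_am_inf_interior[OF e P(1)[OF \<eta>2(1)] nz2]
    have eq1: "am_inf_oo (principal_ideal e \<eta>1) = am_inf_interior (principal_ideal e \<rho>)"
      by (rule am_inf_oo_eqI[OF e P(1)[OF \<eta>1(1)] nz1 I(1)]) (simp add: I(2) P(2) \<rho> \<eta>1)
    have eq2: "am_inf_oo (principal_ideal e \<rho>) = am_inf_interior (principal_ideal e \<eta>2)"
      by (rule am_inf_oo_eqI[OF e P(1)[OF \<rho>] nz\<rho> I2(1)]) (simp add: I2(2) P(2) \<rho> \<eta>2)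
    have ne: "principal_ideal e \<eta>1 \<noteq> {0}" using principal_ideal_zero[OF e \<eta>1(1)] \<eta>1(2) by simp
    show "\<exists>\<eta>1\<in>c0_star. \<exists>\<eta>2\<in>c0_star.
        principal_ideal e \<eta>1 \<noteq> {0} \<and>
        principal_ideal e \<eta>1 \<subset> principal_ideal e \<rho> \<and> principal_ideal e \<rho> \<subset> principal_ideal e \<eta>2 \<and>
        am_inf_oo (principal_ideal e \<eta>1) = am_inf_interior (principal_ideal e \<rho>) \<and>
        am_inf_oo (principal_ideal e \<rho>) = am_inf_interior (principal_ideal e \<eta>2)"
      by (rule bexI[OF bexI[OF _ \<eta>2(1)] \<eta>1(1)])
        (simp only: principal_ideal_subset_iff[OF e] ne eq1 eq2 \<eta>1 \<eta>2 \<rho> simp_thms)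
  }
qed

end
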